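(* Let $\boldsymbol\tau=(\tau_1,\tau_2)\in\mathbb{R}_{>0}^2$ satisfy $\tau_1+\tau_2>1$ and $\tau_1\ge\tau_2$. Let $B\subseteq[0,1]^2$ be a ball, let $\epsilon>0$, and let $\boldsymbol\rho=(\rho_1,\rho_2)\in\mathbb{Q}^2$ with $\rho_1,\rho_2\ge1$ satisfy $\rho_1+\rho_2=3$, $\rho_1\ge\rho_2$, and $1+\tau_i-\rho_i>0$ for $i=1,2$. Then there exists a (Cantor-type) set $\mathcal D_\epsilon(B)\subseteq B\cap\mathcal B_2(\Psi_{\boldsymbol\tau})$ such that $$\dim_{\mathcal H}\mathcal D_\epsilon(B)\ge\min\left\{\frac{3+\tau_1-\tau_2}{1+\tau_1},\ \frac{3}{1+\tau_2},\ 1+\frac{\rho_2}{1+\tau_2}\right\}-2\epsilon.$$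
   Context: For $\Psi=(\psi_1,\psi_2):\mathbb{N}\to\mathbb{R}_{>0}^2$, the set of $\Psi$-approximable vectors is $\mathcal A_2(\Psi)=\{\mathbf x=(x_1,x_2)\in[0,1]^2: |qx_i-p_i|<\psi_i(q)$ for $i=1,2$, for infinitely many $q\in\mathbb{N}$ and $(p_1,p_2)\in\mathbb{Z}^2\}$. For $c>0$, $c\Psi=(c\psi_1,c\psi_2)$. The set of weighted $\Psi$-badly approximable vectors is $\mathcal B_2(\Psi)=\mathcal A_2(\Psi)\setminus\bigcap_{0<c<1}\mathcal A_2(c\Psi)$. For $\boldsymbol\tau=(\tau_1,\tau_2)$, $\Psi_{\boldsymbol\tau}$ denotes the function $q\mapsto(q^{-\tau_1},q^{-\tau_2})$ (for positive integers $q$). Balls are taken with respect to the supremum norm on $\mathbb{R}^2$ (so they are squares), of positive radius. $\dim_{\mathcal H}$ denotes Hausdorff dimension. *)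

theory Defs
  imports "HOL-Analysis.Analysis"
begin

(* The convention for s = 0 is 0^0 = 1 on nonempty sets, so that H^0 is counting
   measure; note that 0 powr 0 = 0 in HOL. *)
definition diam_pow :: "real \<Rightarrow> 'a::metric_space set \<Rightarrow> real" where
  "diam_pow s U = (if U = {} then 0 else if s = 0 then 1 else diameter U powr s)"

(* The boundedness condition is needed because diameter is a junk value on unbounded sets. *)
definition hausdorff_premeasure :: "real \<Rightarrow> real \<Rightarrow> 'a::metric_space set \<Rightarrow> ennreal" where
  "hausdorff_premeasure s \<delta> E =
     (INF U \<in> {U :: nat \<Rightarrow> 'a set. E \<subseteq> (\<Union>i. U i) \<and> (\<forall>i. bounded (U i) \<and> diameter (U i) \<le> \<delta>)}.
        \<Sum>i. ennreal (diam_pow s (U i)))"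

definition hausdorff_measure :: "real \<Rightarrow> 'a::metric_space set \<Rightarrow> ennreal" where
  "hausdorff_measure s E = (SUP \<delta> \<in> {0<..}. hausdorff_premeasure s \<delta> E)"

(* Extended-real valued; the dimension of the empty set is 0. *)
definition hausdorff_dim :: "'a::metric_space set \<Rightarrow> ereal" where
  "hausdorff_dim E = (INF s \<in> {s. 0 \<le> s \<and> hausdorff_measure s E = 0}. ereal s)"

(* Approximating functions are total on nat; only their values at q > 0 matter.
   cbox 0 1 is the closed unit cube, since 1 is the vector with all entries 1. *)
definition approx_vectors :: "(nat \<Rightarrow> real ^ 'n) \<Rightarrow> (real ^ 'n) set" where
  "approx_vectors \<Psi> = {x \<in> cbox 0 1.
     infinite {(q :: nat, p :: int ^ 'n). q > 0 \<and>
                 (\<forall>i. \<bar>real q * x $ i - of_int (p $ i)\<bar> < \<Psi> q $ i)}}"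

definition badly_approx_vectors :: "(nat \<Rightarrow> real ^ 'n) \<Rightarrow> (real ^ 'n) set" where
  "badly_approx_vectors \<Psi> =
     approx_vectors \<Psi> - (\<Inter>c \<in> {0<..<1}. approx_vectors (\<lambda>q. c *\<^sub>R \<Psi> q))"

definition Psi_pow :: "real ^ 'n \<Rightarrow> nat \<Rightarrow> real ^ 'n" where
  "Psi_pow \<tau> q = (\<chi> i. real q powr (- (\<tau> $ i)))"

(* Open or closed; infnorm is the supremum norm. *)
definition is_sup_ball :: "(real ^ 'n) set \<Rightarrow> bool" where
  "is_sup_ball B \<longleftrightarrow>
     (\<exists>z r. r > 0 \<and> (B = {x. infnorm (x - z) < r} \<or> B = {x. infnorm (x - z) \<le> r}))"

end

(*
The set is a Cantor set of points that are approximated by one rational p/q per level to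
the exact order q^(-1-tau_i). Put sigma_i = rho_i - 1, so that sigma_1 + sigma_2 = 1 and
sigma_i < tau_i (if rho_2 = 1, rho_2 is first enlarged a little). Inside a box R, discard
the points x that are too well approximated by some denominator q' <= Q; a volume count
leaves a positive proportion of R. Dirichlet's theorem with weights sigma_i then attaches
to every remaining x a fraction p/q with q comparable to Q. Having avoided all
q' <= Q/2 to precision (11/20) Q^(-sigma_i), the fraction p/q is "rounded": the group
Z^2 + Z p/q has no nonzero element in a small multiple of the box with sides
q^(-sigma_i). Roundedness has three uses. Different p/q of the same level are separated
by boxes with sides Q^(-1-sigma_i); denominators slightly below q cannot
approximate points near p/q well; and a packing bound in blocks of q consecutive
denominators shows that the box of size q^(-1-tau_i) around p/q again contains few points
that are too well approximated, so that the construction can be repeated inside it.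
Every node of a level gets the same number of children, and comparing the number of nodes
that meet a square of side r with r^T gives the bound on the dimension.
*)
theory Submission
  imports Defs
begin

text \<open>The three quantities in the minimum are exponents of the uniform mass on the nodes at
  two critical radii. A level has about Q^3 nodes, each spread over a box of sides Q^(-1-\<tau>1)
  and Q^(-1-\<tau>2). A square of side Q^(-1-\<tau>1) inside one box has mass Q^(\<tau>2-\<tau>1-3),
  which gives the first. A square of side Q^(-1-\<tau>2) can carry the mass Q^(-3) of a whole box,
  which gives the second; if \<tau>2 < \<sigma>1 it can also meet a row of about
  Q^(\<sigma>1-\<tau>2) neighbouring boxes, and since \<sigma>1 = 2 - \<rho>2 this gives the third.
  No limit measure is built: ratios of finite counts suffice, because equal numbers of children make
  them monotone in the level. Each scale is chosen after the previous level, so factors depending on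
  that level are paid for by a power Q^(-e); a further power with exponent -g absorbs fixed
  constants. Both e and g are \<epsilon>, whence the loss 2 \<epsilon>.\<close>

section \<open>The mass distribution principle on nested compact sets\<close>

text \<open>By compactness, a countable cover of the intersection, enlarged to open balls, covers
  some \<open>D n\<close> by finitely many of these balls. A lower bound for all such finite covers
  therefore takes the place of a measure on the limit set.\<close>

lemma mass_distribution:
  fixes D :: "nat \<Rightarrow> 'a::metric_space set"
  assumes comp: "\<And>n. compact (D n)" and dec: "\<And>n. D (Suc n) \<subseteq> D n"
    and "\<kappa> > 0" "r0 > 0" "t \<ge> 0"
    and mass: "\<And>I x r. finite (I::nat set) \<Longrightarrow> (\<forall>i\<in>I. 0 < r i \<and> r i < r0) \<Longrightarrow>
      (\<forall>\<^sub>F n in sequentially. D n \<subseteq> (\<Union>i\<in>I. ball (x i) (r i))) \<Longrightarrow> \<kappa> \<le> (\<Sum>i\<in>I. r i powr t)"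
  shows "hausdorff_measure t (\<Inter>n. D n) \<noteq> 0"
proof
  let ?E = "\<Inter>n. D n"
  assume "hausdorff_measure t ?E = 0"
  then have "hausdorff_premeasure t (r0/2) ?E \<le> 0"
    unfolding hausdorff_measure_def using \<open>r0 > 0\<close> by (metis SUP_upper greaterThan_iff half_gt_zero)
  then have "hausdorff_premeasure t (r0/2) ?E < ennreal (\<kappa>/2)"
    using \<open>\<kappa> > 0\<close> by (auto simp: order.strict_trans1)
  then obtain U where U: "?E \<subseteq> (\<Union>i. U i)" "\<And>i. bounded (U i)" "\<And>i. diameter (U i) \<le> r0/2"
    and Us: "(\<Sum>i. ennreal (diam_pow t (U i))) < ennreal (\<kappa>/2)"
    unfolding hausdorff_premeasure_def INF_less_iff by auto
  \<comment> \<open>Enlarging the set of index i to an open ball costs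
    \<open>\<kappa> / 2 ^ (i + 2)\<close>; these costs add up to \<open>\<kappa> / 2\<close>, the
    part of \<open>\<kappa>\<close> that the cover itself does not use.\<close>
  have ex: "\<exists>x r. U i \<noteq> {} \<longrightarrow> (U i \<subseteq> ball x r \<and> 0 < r \<and> r < r0 \<and>
      r powr t \<le> diam_pow t (U i) + \<kappa> / 2 ^ (i + 2))" for i
  proof (cases "U i = {}")
    case False
    then obtain x where x: "x \<in> U i" by auto
    define d where "d = diameter (U i)"
    have d: "0 \<le> d" "d < r0" using U(2)[of i] U(3)[of i] \<open>r0 > 0\<close>
      by (auto simp: d_def diameter_ge_0 intro: le_less_trans)
    have "\<exists>r. d < r \<and> r < r0 \<and> r powr t \<le> diam_pow t (U i) + \<kappa> / 2 ^ (i + 2)"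
    proof (cases "t = 0")
      case True
      obtain r where "d < r" "r < r0" using d dense by blast
      then show ?thesis using True False \<open>\<kappa> > 0\<close> d by (intro exI[of _ r]) (auto simp: diam_pow_def)
    next
      case t: False
      have "((\<lambda>r. r powr t) \<longlongrightarrow> d powr t) (at_right d)"
        using d t \<open>t \<ge> 0\<close> by (intro tendsto_powr' tendsto_intros) (auto simp: eventually_at_filter)
      then have "\<forall>\<^sub>F r in at_right d. r powr t < d powr t + \<kappa> / 2 ^ (i + 2)"
        using \<open>\<kappa> > 0\<close> by (auto intro: order_tendstoD)
      moreover have "\<forall>\<^sub>F r in at_right d. r \<in> {d<..<r0}"
        using d eventually_at_right_real by blast
      ultimately have "\<forall>\<^sub>F r in at_right d. r powr t < d powr t + \<kappa> / 2 ^ (i + 2) \<and> r \<in> {d<..<r0}"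
        by (rule eventually_conj)
      then obtain r where "r powr t < d powr t + \<kappa> / 2 ^ (i + 2)" "d < r" "r < r0"
        using eventually_happens'[OF trivial_limit_at_right_real] by (metis (no_types, lifting) greaterThanLessThan_iff)
      then show ?thesis using t False by (intro exI[of _ r]) (auto simp: diam_pow_def d_def)
    qed
    then obtain r where r: "d < r" "r < r0" "r powr t \<le> diam_pow t (U i) + \<kappa> / 2 ^ (i + 2)" by auto
    have "U i \<subseteq> ball x r"
    proof
      fix y assume "y \<in> U i"
      then have "dist x y \<le> d" using diameter_bounded_bound[OF U(2)[of i] x] by (simp add: d_def)
      then show "y \<in> ball x r" using r(1) by simp
    qed
    then show ?thesis using r d by (intro exI[of _ x] exI[of _ r]) auto
  qed auto
  then obtain x r where xr: "\<And>i. U i \<noteq> {} \<Longrightarrow> (U i \<subseteq> ball (x i) (r i) \<and> 0 < r i \<and> r i < r0 \<and>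
      r i powr t \<le> diam_pow t (U i) + \<kappa> / 2 ^ (i + 2))" by metis
  \<comment> \<open>The complements of the \<open>D n\<close> complete the balls to an open cover of
    \<open>D 0\<close>. A finite subcover uses only finitely many of them, and these miss
    \<open>D n\<close> for all large n.\<close>
  define W where "W = (\<lambda>j::nat+nat. case j of Inl i \<Rightarrow> (if U i = {} then {} else ball (x i) (r i)) | Inr n \<Rightarrow> - D n)"
  have "D 0 \<subseteq> (\<Union>j. W j)"
  proof
    fix y assume "y \<in> D 0"
    show "y \<in> (\<Union>j. W j)"
    proof (cases "y \<in> ?E")
      case True
      then obtain i where "y \<in> U i" using U by auto
      then have "U i \<noteq> {}" by auto
      then have "y \<in> W (Inl i)" using xr[of i] \<open>y \<in> U i\<close> unfolding W_def by (simp add: subset_eq)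
      then show ?thesis by blast
    next
      case False
      then obtain n where "y \<in> W (Inr n)" by (auto simp: W_def)
      then show ?thesis by blast
    qed
  qed
  moreover have "open (W j)" for j
    using comp by (auto simp: W_def compact_imp_closed split: sum.split)
  ultimately obtain J where J: "finite J" "D 0 \<subseteq> (\<Union>j\<in>J. W j)"
    using compactE_image[OF comp, of UNIV W 0] by auto
  define I where "I = {i. Inl i \<in> J \<and> U i \<noteq> {}}"
  have fI: "finite I" 
  proof -
    have "I \<subseteq> Inl -` J" by (auto simp: I_def)
    then show ?thesis using J(1) finite_vimageI[of J Inl] by (auto intro: finite_subset)
  qed
  have fN: "finite {n. Inr n \<in> J}" using J(1) finite_vimageI[of J Inr] by (auto simp: vimage_def)
  then obtain n0 where n0: "\<And>n. Inr n \<in> J \<Longrightarrow> n \<le> n0"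
    using finite_nat_set_iff_bounded_le by auto
  have mono: "D n \<subseteq> D m" if "m \<le> n" for m n using lift_Suc_antimono_le[of D, OF dec that] .
  have "\<kappa> \<le> (\<Sum>i\<in>I. r i powr t)"
  proof (rule mass[OF fI, where x = x])
    show "\<forall>i\<in>I. 0 < r i \<and> r i < r0" using xr by (auto simp: I_def)
    show "\<forall>\<^sub>F n in sequentially. D n \<subseteq> (\<Union>i\<in>I. ball (x i) (r i))"
      using eventually_ge_at_top[of n0]
    proof eventually_elim
      case (elim n)
      show ?case
      proof
        fix y assume y: "y \<in> D n"
        then obtain j where j: "j \<in> J" "y \<in> W j" using J(2) mono[of 0 n] by auto
        show "y \<in> (\<Union>i\<in>I. ball (x i) (r i))"
        proof (cases j)
          case (Inl i)
          then show ?thesis using j by (auto simp: W_def I_def split: if_splits)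
        next
          case (Inr m)
          then have "m \<le> n" using n0 j elim by force
          then show ?thesis using mono y j Inr by (auto simp: W_def)
        qed
      qed
    qed
  qed
  also have "\<dots> \<le> (\<Sum>i\<in>I. diam_pow t (U i) + \<kappa> / 2 ^ (i + 2))"
    using xr by (intro sum_mono) (auto simp: I_def)
  also have "\<dots> = (\<Sum>i\<in>I. diam_pow t (U i)) + (\<Sum>i\<in>I. \<kappa> / 2 ^ (i + 2))" by (rule sum.distrib)
  also have "(\<Sum>i\<in>I. \<kappa> / 2 ^ (i + 2)) \<le> \<kappa>/2"
  proof -
    have s: "(\<lambda>i. \<kappa>/4 * (1/2) ^ i) sums (\<kappa>/4 * (1 / (1 - 1/2)))"
      by (intro sums_mult geometric_sums) auto
    have "(\<Sum>i\<in>I. \<kappa> / 2 ^ (i + 2)) = (\<Sum>i\<in>I. \<kappa>/4 * (1/2) ^ i)"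
      by (intro sum.cong) (auto simp: power_divide)
    also have "\<dots> \<le> (\<Sum>i. \<kappa>/4 * (1/2) ^ i)"
      using \<open>\<kappa> > 0\<close> by (intro sum_le_suminf[OF sums_summable[OF s] fI]) auto
    also have "\<dots> = \<kappa>/2" using sums_unique[OF s] by simp
    finally show ?thesis .
  qed
  also have "(\<Sum>i\<in>I. diam_pow t (U i)) < \<kappa>/2"
  proof -
    have nn: "diam_pow t (U i) \<ge> 0" for i by (auto simp: diam_pow_def)
    have "ennreal (\<Sum>i\<in>I. diam_pow t (U i)) = (\<Sum>i\<in>I. ennreal (diam_pow t (U i)))"
      using nn by simp
    also have "\<dots> \<le> (\<Sum>i. ennreal (diam_pow t (U i)))" by (intro sum_le_suminf fI) auto
    also have "\<dots> < ennreal (\<kappa>/2)" by (rule Us)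
    finally show ?thesis using nn by (subst (asm) ennreal_less_iff) (auto intro: sum_nonneg)
  qed
  finally show False by simp
qed

section \<open>Boxes, packing and the weighted Dirichlet theorem\<close>

definition sbox :: "real \<Rightarrow> real \<Rightarrow> real \<Rightarrow> real \<Rightarrow> (real ^ 2) set" where
  "sbox z1 z2 h1 h2 = {x. \<bar>x $ 1 - z1\<bar> \<le> h1 \<and> \<bar>x $ 2 - z2\<bar> \<le> h2}"

lemma mem_sbox: "x \<in> sbox z1 z2 h1 h2 \<longleftrightarrow> \<bar>x $ 1 - z1\<bar> \<le> h1 \<and> \<bar>x $ 2 - z2\<bar> \<le> h2"
  by (simp add: sbox_def)

lemma sbox_eq_cbox: "sbox z1 z2 h1 h2 = cbox (vector [z1 - h1, z2 - h2]) (vector [z1 + h1, z2 + h2])"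
  by (auto simp: sbox_def mem_box_cart forall_2 vector_2 abs_le_iff)

lemma compact_sbox: "compact (sbox z1 z2 h1 h2)"
  by (simp add: sbox_eq_cbox)

lemma measure_sbox:
  assumes "h1 \<ge> 0" "h2 \<ge> 0"
  shows "measure lborel (sbox z1 z2 h1 h2) = 4 * h1 * h2"
proof -
  have "vector [z1, z2] \<in> sbox z1 z2 h1 h2" using assms by (auto simp: sbox_def vector_2)
  then have "cbox (vector [z1 - h1, z2 - h2] :: real^2) (vector [z1 + h1, z2 + h2]) \<noteq> {}"
    by (auto simp: sbox_eq_cbox)
  then show ?thesis
    unfolding sbox_eq_cbox by (subst content_cbox_cart) (auto simp: prod_2 UNIV_2 vector_2)
qed

text \<open>A grid of cells of size d by e, anchored at a corner of the rectangle, has at most one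
  point per cell, because two points in one cell are closer than d and e.\<close>

lemma packing:
  fixes f g :: "'a \<Rightarrow> real"
  assumes d: "d > 0" "e > 0" and VW: "V \<ge> 0" "W \<ge> 0"
    and S: "\<And>s. s \<in> S \<Longrightarrow> \<bar>f s - u\<bar> \<le> V \<and> \<bar>g s - v\<bar> \<le> W"
    and sep: "\<And>s s'. s \<in> S \<Longrightarrow> s' \<in> S \<Longrightarrow> s \<noteq> s' \<Longrightarrow> \<bar>f s - f s'\<bar> \<ge> d \<or> \<bar>g s - g s'\<bar> \<ge> e"
  shows "finite S" "real (card S) \<le> (1 + 2 * V / d) * (1 + 2 * W / e)"
proof -
  define h where "h = (\<lambda>s. (\<lfloor>(f s - u + V) / d\<rfloor>, \<lfloor>(g s - v + W) / e\<rfloor>))"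
  let ?T = "{0..\<lfloor>2 * V / d\<rfloor>} \<times> {0..\<lfloor>2 * W / e\<rfloor>}"
  have close: "\<bar>a - b\<bar> < D" if "\<lfloor>(a - w) / D\<rfloor> = \<lfloor>(b - w) / D\<rfloor>" "D > 0" for a b w D :: real
  proof -
    have "\<bar>(a - w) / D - (b - w) / D\<bar> < 1" using that(1) by linarith
    also have "(a - w) / D - (b - w) / D = (a - b) / D" by (simp add: diff_divide_distrib)
    finally show ?thesis using that(2) by (simp add: abs_divide)
  qed
  have inj: "inj_on h S"
  proof (rule inj_onI, rule ccontr)
    fix s s' assume *: "s \<in> S" "s' \<in> S" "h s = h s'" "s \<noteq> s'"
    then have "\<bar>f s - f s'\<bar> < d" "\<bar>g s - g s'\<bar> < e"
      using close[of "f s" "u - V" d "f s'"] close[of "g s" "v - W" e "g s'"] d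
      by (auto simp: h_def algebra_simps)
    then show False using sep[OF *(1,2,4)] by linarith
  qed
  have im: "h ` S \<subseteq> ?T"
  proof
    fix y assume "y \<in> h ` S"
    then obtain s where s: "s \<in> S" "y = h s" by auto
    have "0 \<le> (f s - u + V) / d" "(f s - u + V) / d \<le> 2 * V / d"
      "0 \<le> (g s - v + W) / e" "(g s - v + W) / e \<le> 2 * W / e"
      using S[OF s(1)] d by (auto intro!: divide_nonneg_pos divide_right_mono simp: abs_le_iff)
    then show "y \<in> ?T" unfolding s h_def by (auto intro: floor_mono)
  qed
  show "finite S" using inj im by (meson finite_SigmaI finite_atLeastAtMost_int finite_imageD finite_subset)
  have "card S \<le> card ?T" using card_inj_on_le[OF inj im] by auto
  also have "card ?T = nat (\<lfloor>2 * V / d\<rfloor> + 1) * nat (\<lfloor>2 * W / e\<rfloor> + 1)" by (simp add: card_cartesian_product)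
  finally have "real (card S) \<le> real (nat (\<lfloor>2 * V / d\<rfloor> + 1)) * real (nat (\<lfloor>2 * W / e\<rfloor> + 1))"
    by (metis of_nat_le_iff of_nat_mult)
  also have "\<dots> \<le> (1 + 2 * V / d) * (1 + 2 * W / e)"
  proof (rule mult_mono)
    have "0 \<le> 2 * V / d" "0 \<le> 2 * W / e" using d VW by auto
    then show "real (nat (\<lfloor>2 * V / d\<rfloor> + 1)) \<le> 1 + 2 * V / d" "0 \<le> 1 + 2 * V / d"
      "real (nat (\<lfloor>2 * W / e\<rfloor> + 1)) \<le> 1 + 2 * W / e" by linarith+
  qed auto
  finally show "real (card S) \<le> (1 + 2 * V / d) * (1 + 2 * W / e)" .
qed

text \<open>Pigeonhole: the multiples with index 0 to N M are one more than the N M cells of the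
  unit square, and the difference of two indices in one cell is q.\<close>

lemma weighted_Dirichlet:
  fixes x y :: real and N M :: nat
  assumes "N > 0" "M > 0"
  shows "\<exists>q p1 p2. 0 < q \<and> q \<le> N * M \<and> \<bar>real q * x - of_int p1\<bar> \<le> 1 / N \<and> \<bar>real q * y - of_int p2\<bar> \<le> 1 / M"
proof -
  define f where "f = (\<lambda>q::nat. (\<lfloor>frac (real q * x) * N\<rfloor>, \<lfloor>frac (real q * y) * M\<rfloor>))"
  let ?T = "{0..<int N} \<times> {0..<int M}"
  have fl: "\<lfloor>frac t * real K\<rfloor> \<in> {0..<int K}" if "K > 0" for t :: real and K :: nat
  proof -
    have "frac t * real K < 1 * real K" using that frac_lt_1 by (intro mult_strict_right_mono) auto
    then show ?thesis using frac_ge_0[of t] by (auto simp: floor_less_iff)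
  qed
  have "f ` {0..N*M} \<subseteq> ?T" using assms fl by (auto simp: f_def)
  then have "card (f ` {0..N*M}) \<le> card ?T" by (intro card_mono) auto
  also have "\<dots> = N * M" by (simp add: card_cartesian_product)
  finally have "\<not> inj_on f {0..N*M}" by (intro pigeonhole) auto
  then obtain a b where ab: "a \<le> N * M" "b \<le> N * M" "a < b" "f a = f b"
    unfolding inj_on_def by (metis atLeastAtMost_iff linorder_neqE_nat)
  have close: "\<bar>(real b - real a) * t - of_int (\<lfloor>real b * t\<rfloor> - \<lfloor>real a * t\<rfloor>)\<bar> \<le> 1 / K"
    if "\<lfloor>frac (real a * t) * K\<rfloor> = \<lfloor>frac (real b * t) * K\<rfloor>" "K > 0" for t :: real and K :: nat
  proof -
    have "\<bar>frac (real b * t) * K - frac (real a * t) * K\<bar> \<le> 1" using that(1) by linarith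
    then have "\<bar>(frac (real b * t) - frac (real a * t)) * K\<bar> \<le> 1" by (simp add: left_diff_distrib)
    then have "\<bar>frac (real b * t) - frac (real a * t)\<bar> \<le> 1 / K"
      using that(2) by (simp only: abs_mult) (simp add: pos_le_divide_eq)
    then show ?thesis by (simp add: frac_def algebra_simps)
  qed
  show ?thesis
    using ab close[of x N] close[of y M] assms
    by (intro exI[of _ "b - a"] exI[of _ "\<lfloor>real b * x\<rfloor> - \<lfloor>real a * x\<rfloor>"] exI[of _ "\<lfloor>real b * y\<rfloor> - \<lfloor>real a * y\<rfloor>"])
      (auto simp: f_def of_nat_diff)
qed

lemma sum_powr_le:
  assumes "0 \<le> s" "s < 1"
  shows "(\<Sum>j=1..n. real j powr (-s)) \<le> real n powr (1 - s) / (1 - s)"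
proof (induction n)
  case 0
  then show ?case using assms by simp
next
  case (Suc n)
  define N where "N = real (Suc n)"
  have N: "N > 0" "real n = N - 1" by (auto simp: N_def)
  \<comment> \<open>Young's inequality, that is the tangent of x^(1-s) at N, replaces the comparison
    with an integral.\<close>
  have "real n powr (1 - s) * N powr s \<le> (1 - s) * real n + s * N"
    using Youngs_inequality_0[of "1 - s" s "real n" N] assms N by (cases "n = 0") auto
  also have "\<dots> = N - (1 - s)" unfolding N(2) by (simp add: algebra_simps)
  finally have "real n powr (1 - s) \<le> (N - (1 - s)) / N powr s" using N by (simp add: pos_le_divide_eq)
  also have "\<dots> = N powr (1 - s) - (1 - s) * N powr (-s)"
    using N by (simp add: powr_diff powr_minus divide_inverse algebra_simps)
  finally have "real n powr (1 - s) / (1 - s) \<le> N powr (1 - s) / (1 - s) - N powr (-s)"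
    using assms divide_right_mono[of "real n powr (1 - s)" "N powr (1 - s) - (1 - s) * N powr (-s)" "1 - s"]
    by (simp add: diff_divide_distrib)
  then show ?case using Suc.IH by (simp add: N_def)
qed

section \<open>Rational points near a box\<close>

definition near_set where
  "near_set w1 w2 z1 z2 h1 h2 A = {(q::nat, p1::int, p2::int). q \<in> A \<and>
     \<bar>of_int p1 - real q * z1\<bar> \<le> real q * h1 + w1 q \<and> \<bar>of_int p2 - real q * z2\<bar> \<le> real q * h2 + w2 q}"

definition near_vol :: "(nat \<Rightarrow> real) \<Rightarrow> (nat \<Rightarrow> real) \<Rightarrow> real \<Rightarrow> real \<Rightarrow> real \<Rightarrow> real \<Rightarrow> nat set \<Rightarrow> real" where
  "near_vol w1 w2 z1 z2 h1 h2 A =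
     (\<Sum>(q, p1, p2)\<in>near_set w1 w2 z1 z2 h1 h2 A. 4 * (w1 q / real q) * (w2 q / real q))"

text \<open>\<open>near_set\<close> collects the fractions whose box of half-sides \<open>wi q / q\<close> can meet the box of
  half-sides \<open>hi\<close> around \<open>(z1, z2)\<close>; \<open>near_vol\<close> is the total area of these boxes.\<close>

lemma near_set_fibre:
  assumes "h1 \<ge> 0" "h2 \<ge> 0" "0 \<le> w1 q" "w1 q \<le> 1" "0 \<le> w2 q" "w2 q \<le> 1"
  shows "finite (near_set w1 w2 z1 z2 h1 h2 {q})"
    "real (card (near_set w1 w2 z1 z2 h1 h2 {q})) \<le> (2 * real q * h1 + 3) * (2 * real q * h2 + 3)"
proof -
  let ?S = "near_set w1 w2 z1 z2 h1 h2 {q}"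
  let ?f = "\<lambda>s::nat \<times> int \<times> int. real_of_int (fst (snd s))" and ?g = "\<lambda>s::nat \<times> int \<times> int. real_of_int (snd (snd s))"
  have S: "\<bar>?f s - q * z1\<bar> \<le> q * h1 + w1 q \<and> \<bar>?g s - q * z2\<bar> \<le> q * h2 + w2 q" if "s \<in> ?S" for s
    using that by (auto simp: near_set_def)
  have int1: "1 \<le> \<bar>real_of_int a - real_of_int b\<bar>" if "a \<noteq> b" for a b
    using that by (simp flip: of_int_diff of_int_abs)
  have sep: "\<bar>?f s - ?f s'\<bar> \<ge> 1 \<or> \<bar>?g s - ?g s'\<bar> \<ge> 1" if "s \<in> ?S" "s' \<in> ?S" "s \<noteq> s'" for s s'
    using that int1 by (auto simp: near_set_def)
  have V: "0 \<le> q * h1 + w1 q" "0 \<le> q * h2 + w2 q" using assms by auto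
  show "finite ?S" by (rule packing(1)[OF _ _ V S sep]) auto
  have "real (card ?S) \<le> (1 + 2 * (q * h1 + w1 q) / 1) * (1 + 2 * (q * h2 + w2 q) / 1)"
    by (rule packing(2)[OF _ _ V S sep]) auto
  also have "\<dots> \<le> (2 * real q * h1 + 3) * (2 * real q * h2 + 3)"
    using assms by (intro mult_mono) auto
  finally show "real (card ?S) \<le> (2 * real q * h1 + 3) * (2 * real q * h2 + 3)" .
qed

lemma near_set_Union: "near_set w1 w2 z1 z2 h1 h2 A = (\<Union>q\<in>A. near_set w1 w2 z1 z2 h1 h2 {q})"
  by (auto simp: near_set_def)

lemma near_set_finite:
  assumes "h1 \<ge> 0" "h2 \<ge> 0" "finite A" "\<And>q. q \<in> A \<Longrightarrow> 0 \<le> w1 q \<and> w1 q \<le> 1 \<and> 0 \<le> w2 q \<and> w2 q \<le> 1"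
  shows "finite (near_set w1 w2 z1 z2 h1 h2 A)"
  unfolding near_set_Union[of _ _ _ _ _ _ A] using assms near_set_fibre(1) by blast

lemma near_vol_le:
  assumes h: "h1 \<ge> 0" "h2 \<ge> 0" "finite A" "0 \<notin> A"
    and w: "\<And>q. q \<in> A \<Longrightarrow> 0 \<le> w1 q \<and> w1 q \<le> 1 \<and> 0 \<le> w2 q \<and> w2 q \<le> 1"
  shows "near_vol w1 w2 z1 z2 h1 h2 A \<le>
    (\<Sum>q\<in>A. (2 * h1 + 3 / q) * (2 * h2 + 3 / q) * (4 * w1 q * w2 q))"
proof -
  let ?S = "\<lambda>q. near_set w1 w2 z1 z2 h1 h2 {q}"
  have "near_vol w1 w2 z1 z2 h1 h2 A = (\<Sum>q\<in>A. \<Sum>(q, p1, p2)\<in>?S q. 4 * (w1 q / real q) * (w2 q / real q))"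
    unfolding near_vol_def near_set_Union[of _ _ _ _ _ _ A]
    using h near_set_fibre(1)[OF h(1,2)] w by (intro sum.UNION_disjoint) (auto simp: near_set_def)
  also have "\<dots> \<le> (\<Sum>q\<in>A. (2 * h1 + 3 / q) * (2 * h2 + 3 / q) * (4 * w1 q * w2 q))"
  proof (rule sum_mono)
    fix q assume q: "q \<in> A"
    then have q0: "real q > 0" using h(4) by (cases q) auto
    have "(\<Sum>(q, p1, p2)\<in>?S q. 4 * (w1 q / real q) * (w2 q / real q))
        = (\<Sum>s\<in>?S q. 4 * (w1 q / real q) * (w2 q / real q))"
      by (intro sum.cong) (auto simp: near_set_def)
    also have "\<dots> = real (card (?S q)) * (4 * (w1 q / real q) * (w2 q / real q))" by simp
    also have "\<dots> \<le> ((2 * real q * h1 + 3) * (2 * real q * h2 + 3)) * (4 * (w1 q / real q) * (w2 q / real q))"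
      using near_set_fibre(2)[OF h(1,2)] w[OF q] q0 by (intro mult_right_mono) auto
    also have "\<dots> = (2 * h1 + 3 / q) * (2 * h2 + 3 / q) * (4 * w1 q * w2 q)"
      using q0 by (simp add: field_simps)
    finally show "(\<Sum>(q, p1, p2)\<in>?S q. 4 * (w1 q / real q) * (w2 q / real q))
        \<le> (2 * h1 + 3 / q) * (2 * h2 + 3 / q) * (4 * w1 q * w2 q)" .
  qed
  finally show ?thesis .
qed

text \<open>The boundary terms 1/q and 1/q^2 are weakened to q^(-1/2), so that they sum to O(sqrt n)
  without a logarithm. Anything of lower order than the main term, which grows like n, is good
  enough.\<close>

lemma box_count_factor_le:
  assumes "h1 \<ge> 0" "h2 \<ge> 0" "q > 0"
  shows "(2 * h1 + 3 / real q) * (2 * h2 + 3 / real q) \<le> 4 * h1 * h2 + (6 * h1 + 6 * h2 + 9) * real q powr (-1/2)"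
proof -
  have q: "1 / real q \<le> real q powr (-1/2)" "(1 / real q) * (1 / real q) \<le> real q powr (-1/2)"
  proof -
    have "real q powr (-1) \<le> real q powr (-1/2)" using assms by (intro powr_mono) auto
    then show 1: "1 / real q \<le> real q powr (-1/2)" using assms by (simp add: powr_minus_divide)
    have "(1 / real q) * (1 / real q) \<le> 1 / real q * 1" using assms by (intro mult_left_mono) auto
    then show "(1 / real q) * (1 / real q) \<le> real q powr (-1/2)" using 1 by simp
  qed
  have "(2 * h1 + 3 / real q) * (2 * h2 + 3 / real q) =
     4 * h1 * h2 + (6 * h1 + 6 * h2) * (1 / real q) + 9 * ((1 / real q) * (1 / real q))"
    by (simp add: algebra_simps add_divide_distrib)
  also have "\<dots> \<le> 4 * h1 * h2 + (6 * h1 + 6 * h2) * real q powr (-1/2) + 9 * real q powr (-1/2)"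
    using q assms by (intro add_mono mult_left_mono) auto
  finally show ?thesis by (simp add: algebra_simps)
qed

lemma box_count_sum_le:
  assumes "h1 \<ge> 0" "h2 \<ge> 0"
  shows "(\<Sum>q=1..n. (2 * h1 + 3 / real q) * (2 * h2 + 3 / real q))
    \<le> 4 * h1 * h2 * n + (6 * h1 + 6 * h2 + 9) * (2 * sqrt n)"
proof -
  have "(\<Sum>q=1..n. (2 * h1 + 3 / real q) * (2 * h2 + 3 / real q))
    \<le> (\<Sum>q=1..n. 4 * h1 * h2 + (6 * h1 + 6 * h2 + 9) * real q powr (-1/2))"
    using assms by (intro sum_mono box_count_factor_le) auto
  also have "\<dots> = 4 * h1 * h2 * n + (6 * h1 + 6 * h2 + 9) * (\<Sum>q=1..n. real q powr (-1/2))"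
    by (simp add: sum.distrib sum_distrib_left)
  also have "\<dots> \<le> 4 * h1 * h2 * n + (6 * h1 + 6 * h2 + 9) * (2 * sqrt n)"
    using sum_powr_le[of "1/2" n] assms by (intro add_mono mult_left_mono) (auto simp: powr_half_sqrt)
  finally show ?thesis .
qed

text \<open>The exponent t may exceed 1; lowering it to s < 1 keeps the bound a pure power of n. In
  the application s lies strictly between \<sigma>i and \<tau>i.\<close>

lemma box_count_weighted_sum_le:
  assumes "h1 \<ge> 0" "h2 \<ge> 0" "0 \<le> s" "s < 1" "s \<le> t"
  shows "(\<Sum>q=1..n. (2 * h1 + 3 / real q) * (2 * h2 + 3 / real q) * real q powr (-t))
    \<le> (4 * h1 * h2 + 6 * h1 + 6 * h2 + 9) * (real n powr (1 - s) / (1 - s))"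
proof -
  let ?K = "4 * h1 * h2 + 6 * h1 + 6 * h2 + 9"
  have "(\<Sum>q=1..n. (2 * h1 + 3 / real q) * (2 * h2 + 3 / real q) * real q powr (-t))
    \<le> (\<Sum>q=1..n. ?K * real q powr (-s))"
  proof (intro sum_mono mult_mono)
    fix q assume q: "q \<in> {1..n}"
    have "real q powr (-1/2) \<le> real q powr 0" using q by (intro powr_mono) auto
    then have "(6 * h1 + 6 * h2 + 9) * real q powr (-1/2) \<le> (6 * h1 + 6 * h2 + 9) * 1"
      using assms q by (intro mult_left_mono) auto
    then show "(2 * h1 + 3 / real q) * (2 * h2 + 3 / real q) \<le> ?K"
      using box_count_factor_le[OF assms(1,2), of q] q by (simp add: algebra_simps)
    show "real q powr - t \<le> real q powr - s" using assms q by (intro powr_mono) auto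
  qed (use assms in auto)
  also have "\<dots> = ?K * (\<Sum>q=1..n. real q powr (-s))" by (simp add: sum_distrib_left)
  also have "\<dots> \<le> ?K * (real n powr (1 - s) / (1 - s))"
    using assms by (intro mult_left_mono sum_powr_le) auto
  finally show ?thesis .
qed

text \<open>Fractions attached to the scale \<open>Q\<close> have denominators in \<open>(q_ratio * Q, Q]\<close>; \<open>sep_const\<close> is
  the separation constant of rounded fractions. They only have to be small enough for the volume
  count in \<open>step_at\<close>.\<close>

definition q_ratio :: real where "q_ratio = 1 / 1024"
definition sep_const :: real where "sep_const = q_ratio / 20"

text \<open>The weights \<open>\<sigma>i\<close> are rational, so that with \<open>Q = m ^ (a1 + a2)\<close> both \<open>Q powr \<sigma>i\<close> are integers
  and Dirichlet's theorem applies without loss of constants.\<close>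

locale weighted_setup =
  fixes \<tau>1 \<tau>2 \<sigma>1 \<sigma>2 c :: real and a1 a2 :: nat
  assumes tau: "\<tau>1 > 0" "\<tau>2 > 0" "\<tau>1 + \<tau>2 > 1" "\<tau>2 \<le> \<tau>1"
    and sigma: "\<sigma>1 > 0" "\<sigma>2 > 0" "\<sigma>1 + \<sigma>2 = 1" "\<sigma>2 \<le> \<sigma>1" "\<sigma>1 < \<tau>1" "\<sigma>2 < \<tau>2"
    and a: "a1 > 0" "a2 > 0" "\<sigma>1 = a1 / (a1 + a2)" "\<sigma>2 = a2 / (a1 + a2)"
    and c: "0 < c" "c \<le> 1/4" "\<And>n. 6400 * c\<^sup>2 * (\<Sum>j=1..n. real j powr (- \<tau>1 - \<tau>2)) \<le> 1"
begin

text \<open>For q >= 1 this forces q, p1, p2 to have no common factor: a reduced denominator q' < q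
  would make both distances 0.\<close>

definition rounded :: "nat \<Rightarrow> int \<Rightarrow> int \<Rightarrow> bool" where
  "rounded q p1 p2 \<longleftrightarrow> (\<forall>q' p1' p2'. 0 < q' \<and> q' < q \<longrightarrow>
     sep_const * q powr (-\<sigma>1) \<le> \<bar>real q' * (p1 / q) - of_int p1'\<bar> \<or>
     sep_const * q powr (-\<sigma>2) \<le> \<bar>real q' * (p2 / q) - of_int p2'\<bar>)"

text \<open>The extra Q^(-\<sigma>i) is a margin that allows the same denominators to be excluded on
  a whole box around p/q. Denominators below H are dealt with elsewhere: on the box of the parent
  or, at the first level, as a finite exceptional set.\<close>

definition avoids :: "nat \<Rightarrow> nat \<Rightarrow> nat \<Rightarrow> int \<Rightarrow> int \<Rightarrow> bool" where
  "avoids H Q q p1 p2 \<longleftrightarrow> (\<forall>q' p1' p2'. H \<le> q' \<and> real q' \<le> q_ratio * Q \<longrightarrow>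
     c * q' powr (-\<tau>1) + Q powr (-\<sigma>1) \<le> \<bar>real q' * (p1 / q) - of_int p1'\<bar> \<or>
     c * q' powr (-\<tau>2) + Q powr (-\<sigma>2) \<le> \<bar>real q' * (p2 / q) - of_int p2'\<bar>)"

lemma Q_powr: 
  assumes "m > 0"
  shows "real (m ^ (a1 + a2)) powr (-\<sigma>1) = 1 / real (m ^ a1)"
    "real (m ^ (a1 + a2)) powr (-\<sigma>2) = 1 / real (m ^ a2)"
proof -
  have *: "real (m ^ (a1 + a2)) powr (- (real b / (a1 + a2))) = 1 / real (m ^ b)" for b
  proof -
    have "real (m ^ (a1 + a2)) = real m powr (a1 + a2)" using assms powr_realpow[of "real m" "a1 + a2"] by simp
    then have "real (m ^ (a1 + a2)) powr (- (real b / (a1 + a2))) = real m powr ((a1 + a2) * - (real b / (a1 + a2)))"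
      by (simp only: powr_powr)
    also have "(a1 + a2) * - (real b / (a1 + a2)) = - real b" using a by (simp add: field_simps)
    finally show ?thesis using assms by (simp add: powr_minus_divide powr_realpow)
  qed
  show "real (m ^ (a1 + a2)) powr (-\<sigma>1) = 1 / real (m ^ a1)"
    "real (m ^ (a1 + a2)) powr (-\<sigma>2) = 1 / real (m ^ a2)"
    using *[of a1] *[of a2] a by (simp_all)
qed

text \<open>Since s < 1, passing from q to Q loses at most the factor 1 / \<open>q_ratio\<close>,
  which \<open>sep_const\<close> contains in order to cancel it. The remaining 1/20 is the excess of
  11/20 over 1/2 in \<open>node_exists\<close>.\<close>

lemma sep_const_powr_le:
  assumes "q_ratio * Q < q" "Q > 0" "0 < s" "s < 1"
  shows "sep_const * q powr (-s) \<le> Q powr (-s) / 20"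
proof -
  have k: "q_ratio > 0" "q_ratio < 1" by (auto simp: q_ratio_def)
  have "q powr (-s) \<le> (q_ratio * Q) powr (-s)" using assms k by (intro powr_mono2') auto
  also have "\<dots> = q_ratio powr (-s) * Q powr (-s)" using assms k by (simp add: powr_mult)
  also have "\<dots> \<le> q_ratio powr (-1) * Q powr (-s)" using k assms by (intro mult_right_mono powr_mono') auto
  finally have "sep_const * q powr (-s) \<le> sep_const * (q_ratio powr (-1) * Q powr (-s))" by (intro mult_left_mono) (auto simp: sep_const_def q_ratio_def)
  then show ?thesis by (simp add: sep_const_def q_ratio_def powr_minus_divide)
qed

text \<open>Dirichlet's theorem supplies p/q, and \<open>B2\<close> rules out small q.
  \<open>B1\<close> gives roundedness; it stops at Q/2 because replacing q' by q - q' only changes a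
  sign modulo Z^2. Without this symmetry the bound for the excluded area would exceed the area of
  the box. \<open>B2\<close> to \<open>B5\<close> give \<open>avoids\<close>: a distance below c
  q'^(-\<tau>i) + 2 Q^(-\<sigma>i) is below twice the larger summand, in each coordinate, hence four
  combinations.\<close>

lemma node_exists:
  fixes x1 x2 :: real
  assumes m: "m > 0" and Q: "Q = m ^ (a1 + a2)"
    and B1: "\<And>q p1 p2. 1 \<le> q \<Longrightarrow> q \<le> Q div 2 \<Longrightarrow>
      \<not> (\<bar>real q * x1 - of_int p1\<bar> \<le> 11/20 * Q powr (-\<sigma>1) \<and> \<bar>real q * x2 - of_int p2\<bar> \<le> 11/20 * Q powr (-\<sigma>2))"
    and B2: "\<And>q p1 p2. 1 \<le> q \<Longrightarrow> real q \<le> q_ratio * Q \<Longrightarrow>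
      \<not> (\<bar>real q * x1 - of_int p1\<bar> \<le> 4 * Q powr (-\<sigma>1) \<and> \<bar>real q * x2 - of_int p2\<bar> \<le> 4 * Q powr (-\<sigma>2))"
    and B3: "\<And>q p1 p2. H \<le> q \<Longrightarrow> real q \<le> q_ratio * Q \<Longrightarrow>
      \<not> (\<bar>real q * x1 - of_int p1\<bar> \<le> 2 * c * q powr (-\<tau>1) \<and> \<bar>real q * x2 - of_int p2\<bar> \<le> 2 * c * q powr (-\<tau>2))"
    and B4: "\<And>q p1 p2. 1 \<le> q \<Longrightarrow> real q \<le> q_ratio * Q \<Longrightarrow>
      \<not> (\<bar>real q * x1 - of_int p1\<bar> \<le> 2 * c * q powr (-\<tau>1) \<and> \<bar>real q * x2 - of_int p2\<bar> \<le> 4 * Q powr (-\<sigma>2))"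
    and B5: "\<And>q p1 p2. 1 \<le> q \<Longrightarrow> real q \<le> q_ratio * Q \<Longrightarrow>
      \<not> (\<bar>real q * x1 - of_int p1\<bar> \<le> 4 * Q powr (-\<sigma>1) \<and> \<bar>real q * x2 - of_int p2\<bar> \<le> 2 * c * q powr (-\<tau>2))"
    and H: "1 \<le> H"
  shows "\<exists>q p1 p2. q_ratio * Q < real q \<and> q \<le> Q \<and> \<bar>real q * x1 - of_int p1\<bar> \<le> Q powr (-\<sigma>1) \<and>
    \<bar>real q * x2 - of_int p2\<bar> \<le> Q powr (-\<sigma>2) \<and> rounded q p1 p2 \<and> avoids H Q q p1 p2"
proof -
  have Q0: "Q > 0" using m Q by simp
  have s1: "\<sigma>1 < 1" "\<sigma>2 < 1" using sigma by auto
  have NQ: "m ^ a1 * m ^ a2 = Q" by (simp add: Q power_add)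
  obtain q p1 p2 where q: "0 < q" "q \<le> Q" and d1: "\<bar>real q * x1 - of_int p1\<bar> \<le> Q powr (-\<sigma>1)"
    and d2: "\<bar>real q * x2 - of_int p2\<bar> \<le> Q powr (-\<sigma>2)"
    using weighted_Dirichlet[of "m ^ a1" "m ^ a2" x1 x2] m NQ Q_powr[OF m] unfolding Q by auto
  have big: "q_ratio * Q < real q"
  proof (rule ccontr)
    assume "\<not> ?thesis"
    moreover have "0 \<le> Q powr (-\<sigma>1)" "0 \<le> Q powr (-\<sigma>2)" by auto
    ultimately show False using B2[of q p1 p2] q d1 d2 by auto
  qed
  have move: "\<bar>real q' * x - y\<bar> \<le> \<bar>real q' * (p / q) - y\<bar> + real q' / q * E"
    if "\<bar>real q * x - p\<bar> \<le> E" for q' x y p E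
  proof -
    have "real q' * x - y = (real q' * (p / q) - y) + real q' / q * (real q * x - p)"
      using q by (simp add: field_simps)
    then have "\<bar>real q' * x - y\<bar> \<le> \<bar>real q' * (p / q) - y\<bar> + \<bar>real q' / q * (real q * x - p)\<bar>"
      by (metis abs_triangle_ineq)
    also have "\<bar>real q' / q * (real q * x - p)\<bar> = real q' / q * \<bar>real q * x - p\<bar>" by (simp add: abs_mult)
    also have "\<dots> \<le> real q' / q * E" using that by (intro mult_left_mono) auto
    finally show ?thesis by simp
  qed
  \<comment> \<open>For 2 q' <= q the shift from p/q to x is at most 1/2 Q^(-\<sigma>i); together
    with the 1/20 from \<open>sep_const\<close> it stays within the 11/20 excluded by
    \<open>B1\<close>.\<close>
  have half: "sep_const * q powr (-\<sigma>1) \<le> \<bar>real q' * (p1 / q) - of_int p1'\<bar> \<or>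
     sep_const * q powr (-\<sigma>2) \<le> \<bar>real q' * (p2 / q) - of_int p2'\<bar>" if "0 < q'" "2 * q' \<le> q" for q' p1' p2'
  proof (rule ccontr)
    assume neg: "\<not> ?thesis"
    have r: "real q' / q \<le> 1/2" using that q by (simp add: field_simps)
    have "real q' / q * Q powr (-\<sigma>1) \<le> 1/2 * Q powr (-\<sigma>1)" "real q' / q * Q powr (-\<sigma>2) \<le> 1/2 * Q powr (-\<sigma>2)"
      using r by (intro mult_right_mono; simp)+
    then have "\<bar>real q' * x1 - of_int p1'\<bar> \<le> 11/20 * Q powr (-\<sigma>1)"
      "\<bar>real q' * x2 - of_int p2'\<bar> \<le> 11/20 * Q powr (-\<sigma>2)"
      using move[OF d1, of q' "of_int p1'"] move[OF d2, of q' "of_int p2'"] neg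
        sep_const_powr_le[OF big _ sigma(1) s1(1)] sep_const_powr_le[OF big _ sigma(2) s1(2)] Q0 by auto
    moreover have "q' \<le> Q div 2" using that q by auto
    ultimately show False using B1[of q' p1' p2'] that by auto
  qed
  have "rounded q p1 p2"
    unfolding rounded_def
  proof (intro allI impI)
    fix q' p1' p2' assume q': "0 < q' \<and> q' < q"
    show "sep_const * q powr (-\<sigma>1) \<le> \<bar>real q' * (p1 / q) - of_int p1'\<bar> \<or>
     sep_const * q powr (-\<sigma>2) \<le> \<bar>real q' * (p2 / q) - of_int p2'\<bar>"
    proof (cases "2 * q' \<le> q")
      case False
      have *: "\<bar>real (q - q') * (p / q) - of_int (p - p')\<bar> = \<bar>real q' * (p / q) - of_int p'\<bar>" for p p' :: int
      proof -
        have "real (q - q') * (p / q) - of_int (p - p') = - (real q' * (p / q) - of_int p')"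
          using q' by (simp add: of_nat_diff field_simps)
        then show ?thesis by (metis abs_minus_cancel)
      qed
      show ?thesis using half[of "q - q'" "p1 - p1'" "p2 - p2'"] False q' unfolding * by auto
    qed (use half q' in auto)
  qed
  moreover have "avoids H Q q p1 p2"
    unfolding avoids_def
  proof (intro allI impI, rule ccontr)
    fix q' p1' p2' assume q': "H \<le> q' \<and> real q' \<le> q_ratio * Q"
      and neg: "\<not> (c * q' powr (-\<tau>1) + Q powr (-\<sigma>1) \<le> \<bar>real q' * (p1 / q) - of_int p1'\<bar> \<or>
     c * q' powr (-\<tau>2) + Q powr (-\<sigma>2) \<le> \<bar>real q' * (p2 / q) - of_int p2'\<bar>)"
    have r: "real q' / q \<le> 1" using q' big q by (simp add: field_simps)
    have "real q' / q * Q powr (-\<sigma>1) \<le> 1 * Q powr (-\<sigma>1)" "real q' / q * Q powr (-\<sigma>2) \<le> 1 * Q powr (-\<sigma>2)"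
      using r by (intro mult_right_mono; simp)+
    then have "\<bar>real q' * x1 - of_int p1'\<bar> \<le> c * q' powr (-\<tau>1) + 2 * Q powr (-\<sigma>1)"
      "\<bar>real q' * x2 - of_int p2'\<bar> \<le> c * q' powr (-\<tau>2) + 2 * Q powr (-\<sigma>2)"
      using move[OF d1, of q' "of_int p1'"] move[OF d2, of q' "of_int p2'"] neg by auto
    then have "\<bar>real q' * x1 - of_int p1'\<bar> \<le> 2 * c * q' powr (-\<tau>1) \<or> \<bar>real q' * x1 - of_int p1'\<bar> \<le> 4 * Q powr (-\<sigma>1)"
      "\<bar>real q' * x2 - of_int p2'\<bar> \<le> 2 * c * q' powr (-\<tau>2) \<or> \<bar>real q' * x2 - of_int p2'\<bar> \<le> 4 * Q powr (-\<sigma>2)"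
      by linarith+
    then show False using B2[of q' p1' p2'] B3[of q' p1' p2'] B4[of q' p1' p2'] B5[of q' p1' p2'] q' H by auto
  qed
  ultimately show ?thesis using q big d1 d2 by blast
qed

end

section \<open>Area of the sets of too well approximated points\<close>

definition near_union :: "(nat \<Rightarrow> real) \<Rightarrow> (nat \<Rightarrow> real) \<Rightarrow> real \<Rightarrow> real \<Rightarrow> real \<Rightarrow> real \<Rightarrow> nat set \<Rightarrow> (real ^ 2) set" where
  "near_union w1 w2 z1 z2 h1 h2 A =
     (\<Union>(q, p1, p2)\<in>near_set w1 w2 z1 z2 h1 h2 A. sbox (of_int p1 / q) (of_int p2 / q) (w1 q / q) (w2 q / q))"

lemma sbox_fmeasurable: "sbox a b c d \<in> fmeasurable lborel" "sbox a b c d \<in> sets lborel"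
  by (simp_all add: sbox_eq_cbox)

lemma near_union_measure:
  assumes "h1 \<ge> 0" "h2 \<ge> 0" "finite A" "\<And>q. q \<in> A \<Longrightarrow> 0 \<le> w1 q \<and> w1 q \<le> 1 \<and> 0 \<le> w2 q \<and> w2 q \<le> 1"
  shows "near_union w1 w2 z1 z2 h1 h2 A \<in> sets lborel"
    "measure lborel (near_union w1 w2 z1 z2 h1 h2 A) \<le> near_vol w1 w2 z1 z2 h1 h2 A"
proof -
  let ?S = "near_set w1 w2 z1 z2 h1 h2 A"
  let ?b = "\<lambda>s::nat \<times> int \<times> int. sbox (of_int (fst (snd s)) / fst s) (of_int (snd (snd s)) / fst s) (w1 (fst s) / fst s) (w2 (fst s) / fst s)"
  have U: "near_union w1 w2 z1 z2 h1 h2 A = (\<Union>s\<in>?S. ?b s)" by (auto simp: near_union_def)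
  have fin: "finite ?S" using near_set_finite[OF assms] .
  show "near_union w1 w2 z1 z2 h1 h2 A \<in> sets lborel"
    unfolding U using fin sbox_fmeasurable by (intro sets.finite_UN) auto
  have "measure lborel (near_union w1 w2 z1 z2 h1 h2 A) \<le> (\<Sum>s\<in>?S. measure lborel (?b s))"
    unfolding U using sbox_fmeasurable by (intro measure_UNION_le fin)
  also have "\<dots> = (\<Sum>s\<in>?S. 4 * (w1 (fst s) / fst s) * (w2 (fst s) / fst s))"
    using assms by (intro sum.cong refl measure_sbox) (auto simp: near_set_def)
  also have "\<dots> = near_vol w1 w2 z1 z2 h1 h2 A"
    unfolding near_vol_def by (intro sum.cong) auto
  finally show "measure lborel (near_union w1 w2 z1 z2 h1 h2 A) \<le> near_vol w1 w2 z1 z2 h1 h2 A" .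
qed

lemma in_near_union:
  assumes "x \<in> sbox z1 z2 h1 h2" "q \<in> A" "q > 0"
    and "\<bar>real q * x $ 1 - of_int p1\<bar> \<le> w1 q" "\<bar>real q * x $ 2 - of_int p2\<bar> \<le> w2 q"
  shows "x \<in> near_union w1 w2 z1 z2 h1 h2 A"
proof -
  have 1: "\<bar>of_int p - real q * z\<bar> \<le> real q * h + w" if "\<bar>y - z\<bar> \<le> h" "\<bar>real q * y - of_int p\<bar> \<le> w" for y z h w and p :: int
  proof -
    have "\<bar>real q * (y - z)\<bar> \<le> real q * h" using that by (simp add: abs_mult mult_left_mono)
    then show ?thesis using that(2) by (simp add: algebra_simps abs_le_iff)
  qed
  have 2: "\<bar>y - of_int p / q\<bar> \<le> w / q" if "\<bar>real q * y - of_int p\<bar> \<le> w" for y w and p :: int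
  proof -
    have "real q * y - of_int p = real q * (y - of_int p / q)" using assms(3) by (simp add: field_simps)
    then have "real q * \<bar>y - of_int p / q\<bar> \<le> w" using that by (simp add: abs_mult)
    then show ?thesis using assms(3) by (simp add: field_simps)
  qed
  have "(q, p1, p2) \<in> near_set w1 w2 z1 z2 h1 h2 A"
    using 1 assms by (auto simp: near_set_def mem_sbox)
  moreover have "x \<in> sbox (of_int p1 / q) (of_int p2 / q) (w1 q / q) (w2 q / q)"
    using 2 assms by (auto simp: mem_sbox)
  ultimately show ?thesis unfolding near_union_def by force
qed

section \<open>The refinement step by counting area\<close>

context weighted_setup
begin

lemma two_c_powr: "q \<ge> 1 \<Longrightarrow> t \<ge> 0 \<Longrightarrow> 0 \<le> 2 * c * real q powr (-t) \<and> 2 * c * real q powr (-t) \<le> 1"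
proof -
  assume "q \<ge> 1" "t \<ge> 0"
  then have "real q powr (-t) \<le> real q powr 0" by (intro powr_mono) auto
  then have "2 * c * real q powr (-t) \<le> 2 * c * 1" using \<open>q \<ge> 1\<close> c by (intro mult_left_mono) auto
  moreover have "2 * c * 1 \<le> 1" using c(2) by simp
  ultimately have "2 * c * real q powr (-t) \<le> 1" by linarith
  then show ?thesis using c(1) by simp
qed

text \<open>Because \<sigma>1 + \<sigma>2 = 1, each denominator takes the proportion 4 w^2 / Q of
  the box up to boundary effects, so \<theta> Q denominators take 4 w^2 \<theta> with an error of
  order Q^(-1/2).\<close>

lemma const_family_vol:
  fixes Q m n :: nat and w \<theta> h1 h2 z1 z2 :: real
  assumes h: "h1 \<ge> 0" "h2 \<ge> 0" and m: "m > 0" and Q: "Q = m ^ (a1 + a2)"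
    and w: "0 \<le> w" "w * Q powr (-\<sigma>1) \<le> 1" "w * Q powr (-\<sigma>2) \<le> 1"
    and n: "real n \<le> \<theta> * Q" "0 \<le> \<theta>" "\<theta> \<le> 1"
  shows "near_vol (\<lambda>_. w * Q powr (-\<sigma>1)) (\<lambda>_. w * Q powr (-\<sigma>2)) z1 z2 h1 h2 {1..n}
    \<le> 4 * w\<^sup>2 * (4 * h1 * h2 * \<theta> + 2 * (6 * h1 + 6 * h2 + 9) * Q powr (-1/2))"
proof -
  have Q0: "real Q > 0" using m Q by simp
  have PP: "Q powr (-\<sigma>1) * Q powr (-\<sigma>2) = 1 / Q"
  proof -
    have "Q powr (-\<sigma>1) * Q powr (-\<sigma>2) = Q powr (- \<sigma>1 - \<sigma>2)" using Q0 by (simp flip: powr_add)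
    also have "- \<sigma>1 - \<sigma>2 = -1" using sigma by simp
    finally show ?thesis using Q0 by (simp add: powr_minus_divide)
  qed
  have "near_vol (\<lambda>_. w * Q powr (-\<sigma>1)) (\<lambda>_. w * Q powr (-\<sigma>2)) z1 z2 h1 h2 {1..n}
    \<le> (\<Sum>q=1..n. (2 * h1 + 3 / real q) * (2 * h2 + 3 / real q) * (4 * (w * Q powr (-\<sigma>1)) * (w * Q powr (-\<sigma>2))))"
    using w h by (intro near_vol_le) auto
  also have "4 * (w * Q powr (-\<sigma>1)) * (w * Q powr (-\<sigma>2)) = 4 * w\<^sup>2 / Q"
    using PP by (simp add: power2_eq_square ac_simps) 
  also have "(\<Sum>q=1..n. (2 * h1 + 3 / real q) * (2 * h2 + 3 / real q) * (4 * w\<^sup>2 / Q))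
    = 4 * w\<^sup>2 / Q * (\<Sum>q=1..n. (2 * h1 + 3 / real q) * (2 * h2 + 3 / real q))"
    by (simp add: sum_distrib_left ac_simps)
  also have "\<dots> \<le> 4 * w\<^sup>2 / Q * (4 * h1 * h2 * n + (6 * h1 + 6 * h2 + 9) * (2 * sqrt n))"
    using box_count_sum_le[OF h] by (intro mult_left_mono) auto
  also have "\<dots> \<le> 4 * w\<^sup>2 / Q * (4 * h1 * h2 * (\<theta> * Q) + (6 * h1 + 6 * h2 + 9) * (2 * sqrt Q))"
  proof -
    have "real n \<le> 1 * Q" using n Q0 by (intro order.trans[OF n(1)] mult_right_mono) auto
    then show ?thesis using h n by (intro mult_left_mono add_mono) auto
  qed
  also have "\<dots> = 4 * w\<^sup>2 * (4 * h1 * h2 * \<theta> + 2 * (6 * h1 + 6 * h2 + 9) * (sqrt Q / Q))"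
    using Q0 by (simp add: field_simps)
  also have "sqrt Q / Q = Q powr (-1/2)"
  proof -
    have "Q powr (-1/2) = Q powr (1/2 - 1)" by simp
    also have "\<dots> = sqrt Q / Q" using Q0 by (subst powr_diff) (simp add: powr_half_sqrt)
    finally show ?thesis by simp
  qed
  finally show ?thesis .
qed

text \<open>The exponent 1 - \<sigma>' - s is negative as soon as s exceeds 1 - \<sigma>', the
  weight of the other coordinate. That such an s exists below t is the assumption \<sigma>i <
  \<tau>i.\<close>

lemma mixed_family_vol:
  fixes Q n :: nat and h1 h2 s t \<sigma>' :: real
  assumes h: "h1 \<ge> 0" "h2 \<ge> 0" and Q0: "Q > 0"
    and w: "4 * real Q powr (-\<sigma>') \<le> 1" and n: "n \<le> Q" and s: "0 \<le> s" "s < 1" "s \<le> t"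
  shows "(\<Sum>q=1..n. (2 * h1 + 3 / real q) * (2 * h2 + 3 / real q) * (4 * (2 * c * q powr (-t)) * (4 * Q powr (-\<sigma>'))))
    \<le> 32 * c * (4 * h1 * h2 + 6 * h1 + 6 * h2 + 9) / (1 - s) * Q powr (1 - \<sigma>' - s)"
proof -
  let ?K = "4 * h1 * h2 + 6 * h1 + 6 * h2 + 9"
  have "(\<Sum>q=1..n. (2 * h1 + 3 / real q) * (2 * h2 + 3 / real q) * (4 * (2 * c * q powr (-t)) * (4 * Q powr (-\<sigma>'))))
     = 32 * c * Q powr (-\<sigma>') * (\<Sum>q=1..n. (2 * h1 + 3 / real q) * (2 * h2 + 3 / real q) * real q powr (-t))"
    by (simp add: sum_distrib_left ac_simps)
  also have "\<dots> \<le> 32 * c * Q powr (-\<sigma>') * (?K * (real n powr (1 - s) / (1 - s)))"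
    using box_count_weighted_sum_le[OF h s] c by (intro mult_left_mono) auto
  also have "\<dots> \<le> 32 * c * Q powr (-\<sigma>') * (?K * (real Q powr (1 - s) / (1 - s)))"
    using c h s n by (intro mult_left_mono divide_right_mono powr_mono2) auto
  also have "\<dots> = 32 * c * ?K / (1 - s) * (Q powr (-\<sigma>') * Q powr (1 - s))" by simp
  also have "Q powr (-\<sigma>') * Q powr (1 - s) = Q powr (1 - \<sigma>' - s)"
    using Q0 by (simp add: algebra_simps flip: powr_add)
  finally show ?thesis .
qed

lemma power_at_top: "filterlim (\<lambda>m::nat. m ^ (a1 + a2)) at_top sequentially"
proof -
  have "m \<le> m ^ (a1 + a2)" for m :: nat using a by (cases "m = 0") (auto intro: self_le_power)
  then show ?thesis by (intro filterlim_at_top_mono[OF filterlim_ident] always_eventually allI)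
qed

lemma eventually_Q:
  assumes "\<forall>\<^sub>F x in at_top. P (x::real)"
  shows "\<forall>\<^sub>F m in sequentially. P (real (m ^ (a1 + a2)))"
  using eventually_compose_filterlim[OF eventually_compose_filterlim[OF assms filterlim_real_sequentially] power_at_top] by simp

text \<open>The slack \<open>1 / (q_ratio * Q)\<close> is there because the fraction is attached to
  a point of the box and may itself lie just outside.\<close>

definition refines :: "nat \<Rightarrow> real \<Rightarrow> real \<Rightarrow> real \<Rightarrow> real \<Rightarrow> nat \<Rightarrow> (nat \<times> int \<times> int) set \<Rightarrow> bool" where
  "refines H z1 z2 h1 h2 Q C \<longleftrightarrow> (\<forall>(q, p1, p2)\<in>C. q_ratio * Q < real q \<and> q \<le> Q \<and> rounded q p1 p2 \<and> avoids H Q q p1 p2 \<and>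
     \<bar>of_int p1 / real q - z1\<bar> \<le> h1 + 1 / (q_ratio * Q) \<and> \<bar>of_int p2 / real q - z2\<bar> \<le> h2 + 1 / (q_ratio * Q))"

text \<open>Area budget in units of h1 h2, where the box has 4: \<open>U1\<close> takes 2.42,
  \<open>U2\<close> and \<open>U3\<close> take 0.25 each, and 0.08 covers \<open>U4\<close>,
  \<open>U5\<close> and the boundary errors of \<open>U1\<close> and \<open>U2\<close> (66 is 2 +
  64). The remaining 1 is covered by boxes of area 4 / (\<open>q_ratio\<close>^2 Q^3) around the
  fractions in C, which bounds their number from below.\<close>

lemma step_at:
  fixes Q m :: nat
  assumes h: "h1 > 0" "h2 > 0" and H: "H \<ge> 1" and m: "m > 0" and Q: "Q = m ^ (a1 + a2)"
    and stage: "\<And>X. near_vol (\<lambda>q. 2 * c * q powr (-\<tau>1)) (\<lambda>q. 2 * c * q powr (-\<tau>2)) z1 z2 h1 h2 {H..X} \<le> h1 * h2 / 4"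
    and s: "0 \<le> s1" "s1 < 1" "s1 \<le> \<tau>1" "0 \<le> s2" "s2 < 1" "s2 \<le> \<tau>2"
    and w: "4 * Q powr (-\<sigma>1) \<le> 1" "4 * Q powr (-\<sigma>2) \<le> 1"
    and small: "66 * (2 * (6 * h1 + 6 * h2 + 9) * Q powr (-1/2))
       + 32 * c * (4 * h1 * h2 + 6 * h1 + 6 * h2 + 9) / (1 - s1) * Q powr (1 - \<sigma>2 - s1)
       + 32 * c * (4 * h1 * h2 + 6 * h1 + 6 * h2 + 9) / (1 - s2) * Q powr (1 - \<sigma>1 - s2) \<le> 8/100 * h1 * h2"
  shows "\<exists>C. finite C \<and> h1 * h2 * q_ratio\<^sup>2 * real Q ^ 3 / 4 \<le> real (card C) \<and> refines H z1 z2 h1 h2 Q C"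
proof -
  have Q0: "real Q > 0" using m Q by simp
  have kpos: "q_ratio > 0" "q_ratio \<le> 1" by (auto simp: q_ratio_def)
  have h0: "h1 \<ge> 0" "h2 \<ge> 0" using h by auto
  define n where "n = nat \<lfloor>q_ratio * Q\<rfloor>"
  have n_iff: "q \<le> n \<longleftrightarrow> real q \<le> q_ratio * Q" for q :: nat
    using kpos Q0 by (simp add: n_def le_nat_iff le_floor_iff)
  have nQ: "real n \<le> q_ratio * Q" "n \<le> Q"
  proof -
    show "real n \<le> q_ratio * Q" using n_iff[of n] by simp
    also have "\<dots> \<le> 1 * real Q" using kpos Q0 by (intro mult_right_mono) auto
    finally show "n \<le> Q" by simp
  qed
  let ?t1 = "\<lambda>q::nat. 2 * c * q powr (-\<tau>1)" and ?t2 = "\<lambda>q::nat. 2 * c * q powr (-\<tau>2)"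
  let ?q1 = "\<lambda>w (_::nat). w * Q powr (-\<sigma>1)" and ?q2 = "\<lambda>w (_::nat). w * Q powr (-\<sigma>2)"
  let ?K = "6 * h1 + 6 * h2 + 9" and ?K' = "4 * h1 * h2 + 6 * h1 + 6 * h2 + 9"
  define U where "U = (\<lambda>w1 w2 A. near_union w1 w2 z1 z2 h1 h2 A)"
  define U1 where "U1 = U (?q1 (11/20)) (?q2 (11/20)) {1..Q div 2}"
  define U2 where "U2 = U (?q1 4) (?q2 4) {1..n}"
  define U3 where "U3 = U ?t1 ?t2 {H..n}"
  define U4 where "U4 = U ?t1 (?q2 4) {1..n}"
  define U5 where "U5 = U (?q1 4) ?t2 {1..n}"
  have w': "11/20 * Q powr (-\<sigma>1) \<le> 1" "11/20 * Q powr (-\<sigma>2) \<le> 1" using w powr_ge_zero[of Q "-\<sigma>1"] powr_ge_zero[of Q "-\<sigma>2"] by linarith+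
  have tb: "0 \<le> ?t1 q \<and> ?t1 q \<le> 1" "0 \<le> ?t2 q \<and> ?t2 q \<le> 1" if "q \<ge> 1" for q
    using two_c_powr[OF that, of \<tau>1] two_c_powr[OF that, of \<tau>2] tau by auto
  have Um: "U w1 w2 A \<in> sets lborel" "measure lborel (U w1 w2 A) \<le> near_vol w1 w2 z1 z2 h1 h2 A"
    if "finite A" "\<And>q. q \<in> A \<Longrightarrow> 0 \<le> w1 q \<and> w1 q \<le> 1 \<and> 0 \<le> w2 q \<and> w2 q \<le> 1" for w1 w2 A
    using near_union_measure[OF h0 that] by (auto simp: U_def)
  have M1: "U1 \<in> sets lborel" "measure lborel U1 \<le> 2 * (2 * (6 * h1 + 6 * h2 + 9) * Q powr (-1/2)) + 242/100 * h1 * h2"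
  proof -
    show "U1 \<in> sets lborel" unfolding U1_def using w' by (intro Um) auto
    have "measure lborel U1 \<le> near_vol (?q1 (11/20)) (?q2 (11/20)) z1 z2 h1 h2 {1..Q div 2}"
      unfolding U1_def using w' by (intro Um) auto
    also have "\<dots> \<le> 4 * (11/20)\<^sup>2 * (4 * h1 * h2 * (1/2) + 2 * ?K * Q powr (-1/2))"
      by (rule const_family_vol[OF h0 m Q]) (use w' in auto)
    also have "\<dots> = 121/100 * (2 * ?K * Q powr (-1/2)) + 242/100 * h1 * h2" by (simp add: power2_eq_square algebra_simps)
    also have "\<dots> \<le> 2 * (2 * ?K * Q powr (-1/2)) + 242/100 * h1 * h2"
      using h0 by (intro add_mono mult_right_mono) auto
    finally show "measure lborel U1 \<le> 2 * (2 * ?K * Q powr (-1/2)) + 242/100 * h1 * h2" .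
  qed
  have M2: "U2 \<in> sets lborel" "measure lborel U2 \<le> 64 * (2 * (6 * h1 + 6 * h2 + 9) * Q powr (-1/2)) + 25/100 * h1 * h2"
  proof -
    show "U2 \<in> sets lborel" unfolding U2_def using w by (intro Um) auto
    have "measure lborel U2 \<le> near_vol (?q1 4) (?q2 4) z1 z2 h1 h2 {1..n}"
      unfolding U2_def using w by (intro Um) auto
    also have "\<dots> \<le> 4 * 4\<^sup>2 * (4 * h1 * h2 * q_ratio + 2 * ?K * Q powr (-1/2))"
      by (rule const_family_vol[OF h0 m Q]) (use w nQ kpos in auto)
    also have "\<dots> = 64 * (2 * ?K * Q powr (-1/2)) + 25/100 * h1 * h2" by (simp add: q_ratio_def algebra_simps)
    finally show "measure lborel U2 \<le> 64 * (2 * ?K * Q powr (-1/2)) + 25/100 * h1 * h2" .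
  qed
  have M3: "U3 \<in> sets lborel" "measure lborel U3 \<le> 25/100 * h1 * h2"
  proof -
    show "U3 \<in> sets lborel" unfolding U3_def using tb H by (intro Um) auto
    have "measure lborel U3 \<le> near_vol ?t1 ?t2 z1 z2 h1 h2 {H..n}"
      unfolding U3_def using tb H by (intro Um) auto
    also have "\<dots> \<le> h1 * h2 / 4" by (rule stage)
    finally show "measure lborel U3 \<le> 25/100 * h1 * h2" by simp
  qed
  have M4: "U4 \<in> sets lborel" "measure lborel U4 \<le> 32 * c * ?K' / (1 - s1) * Q powr (1 - \<sigma>2 - s1)"
  proof -
    show "U4 \<in> sets lborel" unfolding U4_def using tb w by (intro Um) auto
    have "measure lborel U4 \<le> near_vol ?t1 (?q2 4) z1 z2 h1 h2 {1..n}"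
      unfolding U4_def using tb w by (intro Um) auto
    also have "\<dots> \<le> (\<Sum>q=1..n. (2 * h1 + 3 / real q) * (2 * h2 + 3 / real q) * (4 * ?t1 q * (4 * Q powr (-\<sigma>2))))"
      using tb w by (intro near_vol_le h0) auto
    also have "\<dots> \<le> 32 * c * ?K' / (1 - s1) * Q powr (1 - \<sigma>2 - s1)"
      using Q0 s nQ w by (intro mixed_family_vol h0) auto
    finally show "measure lborel U4 \<le> 32 * c * ?K' / (1 - s1) * Q powr (1 - \<sigma>2 - s1)" .
  qed
  have M5: "U5 \<in> sets lborel" "measure lborel U5 \<le> 32 * c * ?K' / (1 - s2) * Q powr (1 - \<sigma>1 - s2)"
  proof -
    show "U5 \<in> sets lborel" unfolding U5_def using tb w by (intro Um) auto
    have "measure lborel U5 \<le> near_vol (?q1 4) ?t2 z1 z2 h1 h2 {1..n}"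
      unfolding U5_def using tb w by (intro Um) auto
    also have "\<dots> \<le> (\<Sum>q=1..n. (2 * h1 + 3 / real q) * (2 * h2 + 3 / real q) * (4 * (4 * Q powr (-\<sigma>1)) * ?t2 q))"
      using tb w by (intro near_vol_le h0) auto
    also have "\<dots> = (\<Sum>q=1..n. (2 * h1 + 3 / real q) * (2 * h2 + 3 / real q) * (4 * ?t2 q * (4 * Q powr (-\<sigma>1))))"
      by (intro sum.cong refl) simp
    also have "\<dots> \<le> 32 * c * ?K' / (1 - s2) * Q powr (1 - \<sigma>1 - s2)"
      using Q0 s nQ w by (intro mixed_family_vol h0) auto
    finally show "measure lborel U5 \<le> 32 * c * ?K' / (1 - s2) * Q powr (1 - \<sigma>1 - s2)" .
  qed
  define C where "C = {(q::nat, p1::int, p2::int). q_ratio * Q < real q \<and> q \<le> Q \<and> rounded q p1 p2 \<and> avoids H Q q p1 p2 \<and>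
     \<bar>of_int p1 / real q - z1\<bar> \<le> h1 + 1 / (q_ratio * Q) \<and> \<bar>of_int p2 / real q - z2\<bar> \<le> h2 + 1 / (q_ratio * Q)}"
  have kQ0: "q_ratio * Q > 0" using kpos Q0 by simp
  have finC: "finite C"
  proof (rule finite_subset)
    show "finite (near_set (\<lambda>_. 0) (\<lambda>_. 0) z1 z2 (h1 + 1 / (q_ratio * Q)) (h2 + 1 / (q_ratio * Q)) {1..Q})"
      using h0 kQ0 by (intro near_set_finite) auto
    have "\<bar>of_int p - real q * z\<bar> \<le> real q * g" if "\<bar>of_int p / real q - z\<bar> \<le> g" "q_ratio * Q < real q" for p :: int and q z g
    proof -
      have q: "real q > 0" using that kQ0 by linarith
      have "\<bar>of_int p - real q * z\<bar> = real q * \<bar>of_int p / real q - z\<bar>"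
      proof -
        have "of_int p - real q * z = real q * (of_int p / real q - z)" using q by (simp add: field_simps)
        then show ?thesis by (simp add: abs_mult)
      qed
      then show ?thesis using that q by (simp add: mult_left_mono)
    qed
    moreover have "1 \<le> q" if "q_ratio * Q < real q" for q :: nat using that kQ0 by (cases q) auto
    ultimately show "C \<subseteq> near_set (\<lambda>_. 0) (\<lambda>_. 0) z1 z2 (h1 + 1 / (q_ratio * Q)) (h2 + 1 / (q_ratio * Q)) {1..Q}"
      by (auto simp: C_def near_set_def)
  qed
  let ?b = "\<lambda>s::nat \<times> int \<times> int. sbox (of_int (fst (snd s)) / fst s) (of_int (snd (snd s)) / fst s) (Q powr (-\<sigma>1) / (q_ratio * Q)) (Q powr (-\<sigma>2) / (q_ratio * Q))"
  define V where "V = (\<Union>s\<in>C. ?b s)"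
  have MV: "V \<in> sets lborel" "measure lborel V \<le> real (card C) * (4 / (q_ratio\<^sup>2 * real Q ^ 3))"
  proof -
    show "V \<in> sets lborel" unfolding V_def using finC sbox_fmeasurable by (intro sets.finite_UN) auto
    have "measure lborel V \<le> (\<Sum>s\<in>C. measure lborel (?b s))"
      unfolding V_def using sbox_fmeasurable by (intro measure_UNION_le finC)
    also have "\<dots> = (\<Sum>s\<in>C. 4 * (Q powr (-\<sigma>1) / (q_ratio * Q)) * (Q powr (-\<sigma>2) / (q_ratio * Q)))"
      using kQ0 by (intro sum.cong refl measure_sbox) auto
    also have "4 * (Q powr (-\<sigma>1) / (q_ratio * Q)) * (Q powr (-\<sigma>2) / (q_ratio * Q)) = 4 * (Q powr (-\<sigma>1) * Q powr (-\<sigma>2)) / (q_ratio\<^sup>2 * real Q ^ 2)"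
      by (simp add: power2_eq_square field_simps)
    also have "Q powr (-\<sigma>1) * Q powr (-\<sigma>2) = 1 / Q"
    proof -
      have "Q powr (-\<sigma>1) * Q powr (-\<sigma>2) = Q powr (- \<sigma>1 - \<sigma>2)" using Q0 by (simp flip: powr_add)
      also have "- \<sigma>1 - \<sigma>2 = -1" using sigma by simp
      finally show ?thesis using Q0 by (simp add: powr_minus_divide)
    qed
    finally show "measure lborel V \<le> real (card C) * (4 / (q_ratio\<^sup>2 * real Q ^ 3))" by (simp add: power2_eq_square power3_eq_cube ac_simps)
  qed
  have cov: "sbox z1 z2 h1 h2 \<subseteq> U1 \<union> (U2 \<union> (U3 \<union> (U4 \<union> (U5 \<union> V))))"
  proof
    fix x assume x: "x \<in> sbox z1 z2 h1 h2"
    show "x \<in> U1 \<union> (U2 \<union> (U3 \<union> (U4 \<union> (U5 \<union> V))))"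
    proof (rule ccontr)
      assume nx: "x \<notin> U1 \<union> (U2 \<union> (U3 \<union> (U4 \<union> (U5 \<union> V))))"
      note ne = in_near_union[OF x]
      have "\<exists>q p1 p2. q_ratio * Q < real q \<and> q \<le> Q \<and> \<bar>real q * x $ 1 - of_int p1\<bar> \<le> Q powr (-\<sigma>1) \<and>
        \<bar>real q * x $ 2 - of_int p2\<bar> \<le> Q powr (-\<sigma>2) \<and> rounded q p1 p2 \<and> avoids H Q q p1 p2"
      proof (rule node_exists[OF m Q _ _ _ _ _ H])
        fix q :: nat and p1 p2 :: int
        { assume "1 \<le> q" "q \<le> Q div 2"
          then show "\<not> (\<bar>real q * x $ 1 - of_int p1\<bar> \<le> 11/20 * Q powr (-\<sigma>1) \<and> \<bar>real q * x $ 2 - of_int p2\<bar> \<le> 11/20 * Q powr (-\<sigma>2))"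
            using nx ne[of q "{1..Q div 2}" p1 "?q1 (11/20)" p2 "?q2 (11/20)"] unfolding U1_def U_def by auto }
        { assume "1 \<le> q" "real q \<le> q_ratio * Q"
          then show "\<not> (\<bar>real q * x $ 1 - of_int p1\<bar> \<le> 4 * Q powr (-\<sigma>1) \<and> \<bar>real q * x $ 2 - of_int p2\<bar> \<le> 4 * Q powr (-\<sigma>2))"
            using nx ne[of q "{1..n}" p1 "?q1 4" p2 "?q2 4"] n_iff[of q] unfolding U2_def U_def by auto }
        { assume "H \<le> q" "real q \<le> q_ratio * Q"
          then show "\<not> (\<bar>real q * x $ 1 - of_int p1\<bar> \<le> ?t1 q \<and> \<bar>real q * x $ 2 - of_int p2\<bar> \<le> ?t2 q)"
            using nx ne[of q "{H..n}" p1 ?t1 p2 ?t2] n_iff[of q] H unfolding U3_def U_def by auto }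
        { assume "1 \<le> q" "real q \<le> q_ratio * Q"
          then show "\<not> (\<bar>real q * x $ 1 - of_int p1\<bar> \<le> ?t1 q \<and> \<bar>real q * x $ 2 - of_int p2\<bar> \<le> 4 * Q powr (-\<sigma>2))"
            using nx ne[of q "{1..n}" p1 ?t1 p2 "?q2 4"] n_iff[of q] unfolding U4_def U_def by auto }
        { assume "1 \<le> q" "real q \<le> q_ratio * Q"
          then show "\<not> (\<bar>real q * x $ 1 - of_int p1\<bar> \<le> 4 * Q powr (-\<sigma>1) \<and> \<bar>real q * x $ 2 - of_int p2\<bar> \<le> ?t2 q)"
            using nx ne[of q "{1..n}" p1 "?q1 4" p2 ?t2] n_iff[of q] unfolding U5_def U_def by auto }
      qed
      then obtain q p1 p2 where q: "q_ratio * Q < real q" "q \<le> Q" and d: "\<bar>real q * x $ 1 - of_int p1\<bar> \<le> Q powr (-\<sigma>1)"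
        "\<bar>real q * x $ 2 - of_int p2\<bar> \<le> Q powr (-\<sigma>2)" and ra: "rounded q p1 p2" "avoids H Q q p1 p2" by blast
      have q0: "real q > 0" using q kQ0 by linarith
      have dv: "\<bar>y - of_int p / q\<bar> \<le> w / (q_ratio * Q)" if "\<bar>real q * y - of_int p\<bar> \<le> w" for y w and p :: int
      proof -
        have "real q * y - of_int p = real q * (y - of_int p / q)" using q0 by (simp add: field_simps)
        then have "real q * \<bar>y - of_int p / q\<bar> \<le> w" using that by (simp add: abs_mult)
        moreover have "q_ratio * Q * \<bar>y - of_int p / q\<bar> \<le> real q * \<bar>y - of_int p / q\<bar>" using q by (intro mult_right_mono) auto
        ultimately show ?thesis using kQ0 by (simp add: pos_le_divide_eq mult.commute)
      qed
      have le1: "Q powr (-s) / (q_ratio * Q) \<le> 1 / (q_ratio * Q)" if "s > 0" for s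
      proof -
        have "Q powr (-s) \<le> Q powr 0" using Q0 that by (intro powr_mono) auto
        then show ?thesis using kQ0 Q0 by (intro divide_right_mono) auto
      qed
      have "(q, p1, p2) \<in> C"
        using q ra dv[OF d(1)] dv[OF d(2)] le1[OF sigma(1)] le1[OF sigma(2)] x by (auto simp: C_def mem_sbox)
      moreover have "x \<in> ?b (q, p1, p2)" using dv[OF d(1)] dv[OF d(2)] by (auto simp: mem_sbox)
      ultimately have "x \<in> V" unfolding V_def by blast
      then show False using nx by auto
    qed
  qed
  have un: "measure lborel (A \<union> B) \<le> measure lborel A + measure lborel B" if "A \<in> sets lborel" "B \<in> sets lborel" for A B :: "(real^2) set"
    using that by (rule measure_Un_le)
  have fm: "U w1 w2 A \<in> fmeasurable lborel" if "finite A" "\<And>q. q \<in> A \<Longrightarrow> 0 \<le> w1 q \<and> w1 q \<le> 1 \<and> 0 \<le> w2 q \<and> w2 q \<le> 1" for w1 w2 A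
  proof -
    have "near_union w1 w2 z1 z2 h1 h2 A \<in> fmeasurable lborel"
      unfolding near_union_def using near_set_finite[OF h0 that] sbox_fmeasurable
      by (intro fmeasurable.finite_UN) (auto split: prod.splits)
    then show ?thesis by (simp add: U_def)
  qed
  have fmall: "U1 \<union> (U2 \<union> (U3 \<union> (U4 \<union> (U5 \<union> V)))) \<in> fmeasurable lborel"
  proof -
    have "U1 \<in> fmeasurable lborel" "U2 \<in> fmeasurable lborel" "U3 \<in> fmeasurable lborel" "U4 \<in> fmeasurable lborel" "U5 \<in> fmeasurable lborel"
      unfolding U1_def U2_def U3_def U4_def U5_def using w w' tb H by (intro fm; force)+
    moreover have "V \<in> fmeasurable lborel" unfolding V_def using finC sbox_fmeasurable by (intro fmeasurable.finite_UN) auto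
    ultimately show ?thesis by (intro fmeasurable.Un)
  qed
  have "4 * h1 * h2 = measure lborel (sbox z1 z2 h1 h2)" using h0 by (simp add: measure_sbox)
  also have "\<dots> \<le> measure lborel (U1 \<union> (U2 \<union> (U3 \<union> (U4 \<union> (U5 \<union> V)))))"
    by (intro measure_mono_fmeasurable cov fmall sbox_fmeasurable)
  also have "\<dots> \<le> measure lborel U1 + (measure lborel U2 + (measure lborel U3 + (measure lborel U4 + (measure lborel U5 + measure lborel V))))"
    using M1(1) M2(1) M3(1) M4(1) M5(1) MV(1)
    by (intro order.trans[OF un] add_left_mono sets.Un order.refl) auto
  also have "\<dots> \<le> 3 * h1 * h2 + real (card C) * (4 / (q_ratio\<^sup>2 * real Q ^ 3))"
    using M1(2) M2(2) M3(2) M4(2) M5(2) MV(2) small by linarith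
  finally have "h1 * h2 \<le> real (card C) * (4 / (q_ratio\<^sup>2 * real Q ^ 3))" by linarith
  moreover have "q_ratio\<^sup>2 * real Q ^ 3 > 0" using kpos Q0 by simp
  ultimately have "h1 * h2 * q_ratio\<^sup>2 * real Q ^ 3 / 4 \<le> real (card C)" by (simp add: field_simps)
  then show ?thesis using finC by (intro exI[of _ C]) (auto simp: C_def refines_def)
qed

lemma step:
  assumes h: "h1 > 0" "h2 > 0" and H: "H \<ge> 1"
    and stage: "\<And>X. near_vol (\<lambda>q. 2 * c * q powr (-\<tau>1)) (\<lambda>q. 2 * c * q powr (-\<tau>2)) z1 z2 h1 h2 {H..X} \<le> h1 * h2 / 4"
  shows "\<forall>\<^sub>F m in sequentially. \<exists>C. finite C \<and> h1 * h2 * q_ratio\<^sup>2 * real (m ^ (a1 + a2)) ^ 3 / 4 \<le> real (card C) \<and>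
    refines H z1 z2 h1 h2 (m ^ (a1 + a2)) C"
proof -
  \<comment> \<open>The midpoint lies above \<sigma>1, which makes the exponent 1 - \<sigma>2 - s1
    negative, and below both 1 and \<tau>1.\<close>
  define s1 where "s1 = (\<sigma>1 + min 1 \<tau>1) / 2"
  define s2 where "s2 = (\<sigma>2 + min 1 \<tau>2) / 2"
  have s1: "0 \<le> s1" "s1 < 1" "s1 \<le> \<tau>1" "1 - \<sigma>2 - s1 < 0" using tau sigma by (auto simp: s1_def min_def)
  have s2: "0 \<le> s2" "s2 < 1" "s2 \<le> \<tau>2" "1 - \<sigma>1 - s2 < 0" using tau sigma by (auto simp: s2_def min_def)
  have lim: "((\<lambda>x::real. K * x powr t) \<longlongrightarrow> 0) at_top" if "t < 0" for K t
    using tendsto_mult[OF tendsto_const tendsto_neg_powr[OF that filterlim_ident], of K] by simp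
  let ?L = "\<lambda>x::real. 66 * (2 * (6 * h1 + 6 * h2 + 9) * x powr (-1/2))
       + 32 * c * (4 * h1 * h2 + 6 * h1 + 6 * h2 + 9) / (1 - s1) * x powr (1 - \<sigma>2 - s1)
       + 32 * c * (4 * h1 * h2 + 6 * h1 + 6 * h2 + 9) / (1 - s2) * x powr (1 - \<sigma>1 - s2)"
  have "(?L \<longlongrightarrow> 66 * 0 + 0 + 0) at_top"
    using s1(4) s2(4) by (intro tendsto_add tendsto_mult[OF tendsto_const] lim) auto
  then have "\<forall>\<^sub>F x in at_top. ?L x < 8/100 * h1 * h2" using h by (intro order_tendstoD(2)) auto
  moreover have "\<forall>\<^sub>F x in at_top. 4 * x powr (-\<sigma>1) < (1::real)" "\<forall>\<^sub>F x in at_top. 4 * x powr (-\<sigma>2) < (1::real)"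
    using sigma by (intro order_tendstoD(2)[OF lim]; simp)+
  ultimately have "\<forall>\<^sub>F x in at_top. ?L x < 8/100 * h1 * h2 \<and> 4 * x powr (-\<sigma>1) < 1 \<and> 4 * x powr (-\<sigma>2) < 1"
    by eventually_elim auto
  from eventually_Q[OF this] show ?thesis
    using eventually_gt_at_top[of 0]
  proof eventually_elim
    case (elim m)
    show ?case
      by (rule step_at[OF h H elim(2) refl stage s1(1-3) s2(1-3)]) (use elim(1) in linarith)+
  qed
qed

end

section \<open>Rounded fractions\<close>

context weighted_setup
begin

lemma q_ratio_pos: "0 < q_ratio" "q_ratio < 1" and sep_const_pos: "0 < sep_const" "sep_const < 1"
  by (auto simp: q_ratio_def sep_const_def)

text \<open>The two vectors differ, modulo Z^2 and up to sign, by the multiple of p/q with index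
  |q'' - q'| < q, to which roundedness applies. For q' = q'' a nonzero integer vector is
  left.\<close>

lemma rounded_sep:
  fixes q q' q'' :: nat and p1' p1'' p2' p2'' :: int
  assumes r: "rounded q p1 p2" and q: "q \<ge> 1" and ne: "(q', p1', p2') \<noteq> (q'', p1'', p2'')"
    and close: "q' < q'' + q" "q'' < q' + q"
  shows "sep_const * q powr (-\<sigma>1) \<le> \<bar>(of_int p1' - q' * (p1 / q)) - (of_int p1'' - q'' * (p1 / q))\<bar> \<or>
    sep_const * q powr (-\<sigma>2) \<le> \<bar>(of_int p2' - q' * (p2 / q)) - (of_int p2'' - q'' * (p2 / q))\<bar>"
proof -
  have less: "sep_const * q powr (-\<sigma>1) \<le> \<bar>(of_int p1' - q' * (p1 / q)) - (of_int p1'' - q'' * (p1 / q))\<bar> \<or>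
    sep_const * q powr (-\<sigma>2) \<le> \<bar>(of_int p2' - q' * (p2 / q)) - (of_int p2'' - q'' * (p2 / q))\<bar>"
    if "q' < q''" "q'' < q' + q" for q' q'' :: nat and p1' p1'' p2' p2'' :: int
  proof -
    have *: "\<bar>real (q'' - q') * (p / q) - of_int (p'' - p')\<bar> = \<bar>(of_int p' - q' * (p / q)) - (of_int p'' - q'' * (p / q))\<bar>"
      for p p' p'' :: int
      using that by (simp add: of_nat_diff algebra_simps diff_divide_distrib)
    have "0 < q'' - q'" "q'' - q' < q" using that by auto
    then show ?thesis using r[unfolded rounded_def, rule_format, of "q'' - q'" "p1'' - p1'" "p2'' - p2'"]
      unfolding * by auto
  qed
  have d1: "sep_const * q powr (-s) \<le> 1" if "s > 0" for s
  proof -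
    have "q powr (-s) \<le> real q powr 0" using q that by (intro powr_mono) auto
    then have "sep_const * q powr (-s) \<le> 1 * 1" using sep_const_pos q by (intro mult_mono) auto
    then show ?thesis by simp
  qed
  have int1: "1 \<le> \<bar>real_of_int a - real_of_int b\<bar>" if "a \<noteq> b" for a b
    using that by (simp flip: of_int_diff of_int_abs)
  consider "q' < q''" | "q'' < q'" | "q' = q''" by linarith
  then show ?thesis
  proof cases
    case 1
    then show ?thesis using less[of q' q''] close by blast
  next
    case 2
    then show ?thesis using less[of q'' q' p1'' p1' p2'' p2'] close by (simp add: abs_minus_commute)
  next
    case 3
    then have "p1' \<noteq> p1'' \<or> p2' \<noteq> p2''" using ne by auto
    then show ?thesis using 3 int1 d1 sigma by (metis (no_types, opaque_lifting) diff_diff_eq2 diff_add_cancel order_trans)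
  qed
qed

text \<open>With q the larger denominator, p' - q' p/q is a nonzero vector of the group of p/q.
  Dividing its size by q' <= Q turns the exponent -\<sigma>i into -1-\<sigma>i. For q' = q some
  numerators differ, which gives 1/q.\<close>

lemma node_sep:
  fixes q q' Q :: nat and p1 p2 p1' p2' :: int
  assumes r: "rounded q p1 p2" "rounded q' p1' p2'" and q: "1 \<le> q" "q \<le> Q" "1 \<le> q'" "q' \<le> Q"
    and ne: "(q, p1, p2) \<noteq> (q', p1', p2')"
  shows "sep_const * Q powr (-1 - \<sigma>1) \<le> \<bar>p1 / q - p1' / q'\<bar> \<or> sep_const * Q powr (-1 - \<sigma>2) \<le> \<bar>p2 / q - p2' / q'\<bar>"
proof -
  have main: "sep_const * Q powr (-1 - \<sigma>1) \<le> \<bar>p1 / q - p1' / q'\<bar> \<or> sep_const * Q powr (-1 - \<sigma>2) \<le> \<bar>p2 / q - p2' / q'\<bar>"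
    if r: "rounded q p1 p2" and q: "1 \<le> q" "q \<le> Q" "1 \<le> q'" "q' \<le> q" and ne: "(q, p1, p2) \<noteq> (q', p1', p2')"
    for q q' :: nat and p1 p2 p1' p2' :: int
  proof -
    \<comment> \<open>The difference with the zero triple is written out to match
      \<open>rounded_sep\<close> at q'' = 0.\<close>
    have conv: "sep_const * Q powr (-1 - s) \<le> \<bar>p / q - p' / q'\<bar>"
      if s: "s > 0" and le: "sep_const * q powr (-s) \<le> \<bar>(of_int p' - q' * (p / q)) - (of_int 0 - (0::nat) * (p / q))\<bar>" for s and p p' :: int
    proof -
      have "sep_const * Q powr (-1 - s) = sep_const * Q powr (-s) / Q" using q by (simp add: powr_diff powr_minus_divide)
      also have "\<dots> \<le> sep_const * q powr (-s) / q'" using q s sep_const_pos by (intro frac_le mult_left_mono powr_mono2') auto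
      also have "\<dots> \<le> \<bar>of_int p' - q' * (p / q)\<bar> / q'" using le q by (intro divide_right_mono) auto
      also have "\<dots> = \<bar>(of_int p' - q' * (p / q)) / q'\<bar>" by simp
      also have "(of_int p' - q' * (p / q)) / q' = - (p / q - p' / q')" using q by (simp add: field_simps)
      finally show ?thesis by simp
    qed
    show ?thesis
    proof (cases "q' < q")
      case True
      then show ?thesis
        using rounded_sep[OF r _, of q' p1' p2' 0 0 0] conv[OF sigma(1), where p=p1 and p'=p1'] conv[OF sigma(2), where p=p2 and p'=p2'] q by auto
    next
      case False
      then have qq: "q' = q" using q by auto
      have "sep_const * Q powr (-1 - s) \<le> \<bar>p / q - p' / q'\<bar>" if "s > 0" "p \<noteq> p'" for s and p p' :: int
      proof -
        have "sep_const * Q powr (-1 - s) \<le> 1 * Q powr (-1)" using sep_const_pos q that by (intro mult_mono powr_mono) auto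
        also have "\<dots> \<le> 1 / q" using q by (simp add: powr_minus_divide frac_le)
        also have "\<dots> \<le> \<bar>real_of_int p - real_of_int p'\<bar> / q"
          using that q by (intro divide_right_mono) (simp_all flip: of_int_diff of_int_abs)
        also have "\<dots> = \<bar>p / q - p' / q'\<bar>" using qq by (simp flip: diff_divide_distrib)
        finally show ?thesis .
      qed
      then show ?thesis using ne qq sigma by auto
    qed
  qed
  show ?thesis
  proof (cases "q' \<le> q")
    case True
    then show ?thesis using main[OF r(1)] q ne by auto
  next
    case False
    then show ?thesis using main[OF r(2), of q p1 p2] q ne by (auto simp: abs_minus_commute)
  qed
qed

text \<open>Denominators are grouped by \<open>j = q' div q\<close>: within one group the vectors \<open>p' - q' p / q\<close> are
  distinct and separated, so that there are only \<open>O(j\<^sup>2)\<close> of them close to the box.\<close>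

lemma node_stage:
  fixes q X :: nat
  assumes r: "rounded q p1 p2" and q: "q \<ge> 1"
    and b: "q powr (-\<tau>1) \<le> sep_const * q powr (-\<sigma>1)" "q powr (-\<tau>2) \<le> sep_const * q powr (-\<sigma>2)"
    and h: "h1 = q powr (-1 - \<tau>1) / 2" "h2 = q powr (-1 - \<tau>2) / 2"
  shows "near_vol (\<lambda>q. 2 * c * q powr (-\<tau>1)) (\<lambda>q. 2 * c * q powr (-\<tau>2)) (p1 / q) (p2 / q) h1 h2 {q..X} \<le> h1 * h2 / 4"
proof -
  let ?t1 = "\<lambda>q::nat. 2 * c * q powr (-\<tau>1)" and ?t2 = "\<lambda>q::nat. 2 * c * q powr (-\<tau>2)"
  let ?S = "near_set ?t1 ?t2 (p1 / q) (p2 / q) h1 h2 {q..X}"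
  define S where "S = (\<lambda>j. {s \<in> ?S. fst s div q = j})"
  have h0: "h1 \<ge> 0" "h2 \<ge> 0" unfolding h by auto
  have fin: "finite ?S"
    using two_c_powr[of _ \<tau>1] two_c_powr[of _ \<tau>2] tau q by (intro near_set_finite h0) auto
  have part: "?S = (\<Union>j\<in>{1..X}. S j)"
  proof -
    have "1 \<le> fst s div q" "fst s div q \<le> X" if "s \<in> ?S" for s
    proof -
      have s: "q \<le> fst s" "fst s \<le> X" using that by (auto simp: near_set_def)
      then show "1 \<le> fst s div q" using q div_greater_zero_iff[of "fst s" q] by linarith
      show "fst s div q \<le> X" using s div_le_dividend[of "fst s" q] by linarith
    qed
    then show ?thesis by (auto simp: S_def)
  qed
  \<comment> \<open>Block j lies in a box of half-sides 2 j q^(-\<tau>i), and q^(-\<tau>i) is at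
    most the separation, so each packing factor is at most 1 + 4 j <= 5 j.\<close>
  have card: "real (card (S j)) \<le> 25 * real j ^ 2" if j: "j \<ge> 1" for j
  proof -
    let ?f = "\<lambda>s::nat \<times> int \<times> int. real_of_int (fst (snd s)) - fst s * (p1 / q)"
    let ?g = "\<lambda>s::nat \<times> int \<times> int. real_of_int (snd (snd s)) - fst s * (p2 / q)"
    have fs: "j * q \<le> fst s \<and> fst s < (j + 1) * q" if "s \<in> S j" for s
      using that q by (auto simp: S_def dividend_less_div_times) 
    have bound: "real q' * (q powr (-1 - t) / 2) + 2 * c * q' powr (-t) \<le> 2 * j * q powr (-t)"
      if q': "j * q \<le> q'" "q' < (j + 1) * q" and t: "t > 0" for q' :: nat and t
    proof -
      have "real q' \<le> 2 * j * q"
      proof -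
        have "q' \<le> (j + 1) * q" using q' by simp
        also have "\<dots> \<le> (2 * j) * q" using j by (intro mult_right_mono) auto
        finally show ?thesis by (metis of_nat_le_iff of_nat_mult of_nat_numeral)
      qed
      then have "real q' * (q powr (-1 - t) / 2) \<le> (2 * j * q) * (q powr (-1 - t) / 2)" by (intro mult_right_mono) auto
      also have "\<dots> = j * q powr (-t)" using q by (simp add: powr_diff powr_minus_divide)
      finally have 1: "real q' * (q powr (-1 - t) / 2) \<le> j * q powr (-t)" .
      have "q \<le> j * q" using j by simp
      then have "q \<le> q'" using q'(1) by linarith
      then have "q' powr (-t) \<le> q powr (-t)" using q q' t by (intro powr_mono2') auto
      then have "2 * c * q' powr (-t) \<le> 1 * q powr (-t)" using c by (intro mult_mono) auto
      also have "\<dots> \<le> j * q powr (-t)" using j by (intro mult_right_mono) auto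
      finally show ?thesis using 1 by simp
    qed
    have nf: "\<bar>?f s - 0\<bar> \<le> 2 * j * q powr (-\<tau>1) \<and> \<bar>?g s - 0\<bar> \<le> 2 * j * q powr (-\<tau>2)" if s: "s \<in> S j" for s
    proof -
      have "\<bar>?f s\<bar> \<le> fst s * h1 + ?t1 (fst s)" "\<bar>?g s\<bar> \<le> fst s * h2 + ?t2 (fst s)"
        using s by (auto simp: S_def near_set_def)
      then show ?thesis using bound[of "fst s" \<tau>1] bound[of "fst s" \<tau>2] fs[OF s] tau h by auto
    qed
    have sep: "\<bar>?f s - ?f s'\<bar> \<ge> sep_const * q powr (-\<sigma>1) \<or> \<bar>?g s - ?g s'\<bar> \<ge> sep_const * q powr (-\<sigma>2)"
      if "s \<in> S j" "s' \<in> S j" "s \<noteq> s'" for s s'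
    proof -
      have "fst s < fst s' + q" "fst s' < fst s + q" using fs[OF that(1)] fs[OF that(2)] by auto
      then show ?thesis using rounded_sep[OF r q, of "fst s" "fst (snd s)" "snd (snd s)" "fst s'" "fst (snd s')" "snd (snd s')"] that(3)
        by (auto simp: prod_eq_iff)
    qed
    have D0: "sep_const * q powr (-\<sigma>1) > 0" "sep_const * q powr (-\<sigma>2) > 0" using sep_const_pos q by auto
    have "real (card (S j)) \<le> (1 + 2 * (2 * j * q powr (-\<tau>1)) / (sep_const * q powr (-\<sigma>1))) * (1 + 2 * (2 * j * q powr (-\<tau>2)) / (sep_const * q powr (-\<sigma>2)))"
      by (rule packing(2)[OF D0 _ _ nf sep]) auto
    also have "\<dots> \<le> (5 * real j) * (5 * real j)"
    proof -
      have "1 + 2 * (2 * j * A) / B \<le> 5 * real j" if "A \<le> B" "B > 0" "A \<ge> 0" for A B :: real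
      proof -
        have "real j * (A / B) \<le> real j * 1" using that by (intro mult_left_mono) auto
        then have "1 + 4 * (j * (A / B)) \<le> 5 * j" using j by simp
        then show ?thesis by simp
      qed
      then show ?thesis using b D0 by (intro mult_mono) auto
    qed
    finally show ?thesis by (simp add: power2_eq_square)
  qed
  have summand: "4 * (?t1 (fst s) / fst s) * (?t2 (fst s) / fst s) \<le> 16 * c\<^sup>2 * (real j * q) powr (-2 - \<tau>1 - \<tau>2)"
    if s: "s \<in> S j" and j: "j \<ge> 1" for s j
  proof -
    have "j * q \<le> fst s" using s by (auto simp: S_def)
    then have le: "real j * real q \<le> fst s" by (metis of_nat_le_iff of_nat_mult)
    have pos: "0 < real j * real q" using j q by simp
    then have q0: "real (fst s) > 0" using le by linarith
    have "4 * (?t1 (fst s) / fst s) * (?t2 (fst s) / fst s) = 16 * c\<^sup>2 * (fst s) powr (-2 - \<tau>1 - \<tau>2)"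
    proof -
      have "(fst s) powr (-2 - \<tau>1 - \<tau>2) = (fst s) powr (-\<tau>1) * (fst s) powr (-\<tau>2) * (fst s) powr (-2)"
        unfolding powr_add[symmetric] by (rule arg_cong[where f="\<lambda>e. real (fst s) powr e"]) simp
      also have "(fst s) powr (-2) = 1 / (fst s)^2" using q0 by (simp add: powr_minus_divide)
      finally show ?thesis by (simp add: power2_eq_square)
    qed
    also have "\<dots> \<le> 16 * c\<^sup>2 * (real j * q) powr (-2 - \<tau>1 - \<tau>2)"
      using le pos tau by (intro mult_left_mono powr_mono2') auto
    finally show ?thesis .
  qed
  have "near_vol ?t1 ?t2 (p1 / q) (p2 / q) h1 h2 {q..X} = (\<Sum>s\<in>?S. 4 * (?t1 (fst s) / fst s) * (?t2 (fst s) / fst s))"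
    unfolding near_vol_def by (intro sum.cong) auto
  also have "\<dots> = (\<Sum>j=1..X. \<Sum>s\<in>S j. 4 * (?t1 (fst s) / fst s) * (?t2 (fst s) / fst s))"
    unfolding part using fin by (intro sum.UNION_disjoint) (auto simp: S_def)
  also have "\<dots> \<le> (\<Sum>j=1..X. 25 * real j ^ 2 * (16 * c\<^sup>2 * (real j * q) powr (-2 - \<tau>1 - \<tau>2)))"
  proof (rule sum_mono)
    fix j assume j: "j \<in> {1..X}"
    have "(\<Sum>s\<in>S j. 4 * (?t1 (fst s) / fst s) * (?t2 (fst s) / fst s)) \<le> (\<Sum>s\<in>S j. 16 * c\<^sup>2 * (real j * q) powr (-2 - \<tau>1 - \<tau>2))"
      using summand j by (intro sum_mono) auto
    also have "\<dots> = card (S j) * (16 * c\<^sup>2 * (real j * q) powr (-2 - \<tau>1 - \<tau>2))" by simp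
    also have "\<dots> \<le> 25 * real j ^ 2 * (16 * c\<^sup>2 * (real j * q) powr (-2 - \<tau>1 - \<tau>2))"
      using card j by (intro mult_right_mono) auto
    finally show "(\<Sum>s\<in>S j. 4 * (?t1 (fst s) / fst s) * (?t2 (fst s) / fst s)) \<le> 25 * real j ^ 2 * (16 * c\<^sup>2 * (real j * q) powr (-2 - \<tau>1 - \<tau>2))" .
  qed
  also have "\<dots> = (\<Sum>j=1..X. 400 * c\<^sup>2 * q powr (-2 - \<tau>1 - \<tau>2) * real j powr (-\<tau>1 - \<tau>2))"
  proof (intro sum.cong refl)
    fix j assume j: "j \<in> {1..X}"
    have "(real j * q) powr (-2 - \<tau>1 - \<tau>2) = real j powr (-2 - \<tau>1 - \<tau>2) * q powr (-2 - \<tau>1 - \<tau>2)" by (simp add: powr_mult)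
    also have "real j powr (-2 - \<tau>1 - \<tau>2) = real j powr (-2) * real j powr (-\<tau>1 - \<tau>2)"
      unfolding powr_add[symmetric] by (rule arg_cong[where f="\<lambda>e. real j powr e"]) simp
    also have "real j powr (-2) = 1 / real j ^ 2" using j by (simp add: powr_minus_divide)
    finally show "25 * real j ^ 2 * (16 * c\<^sup>2 * (real j * q) powr (-2 - \<tau>1 - \<tau>2)) = 400 * c\<^sup>2 * q powr (-2 - \<tau>1 - \<tau>2) * real j powr (-\<tau>1 - \<tau>2)"
      using j by simp
  qed
  \<comment> \<open>The target h1 h2 / 4 is q^(-2-\<tau>1-\<tau>2) / 16, and 6400 = 16 * 25 * 16 is
    the origin of the smallness condition on c. The j^2 triples of block j cancel two powers of j,
    so the series converges because \<tau>1 + \<tau>2 > 1.\<close>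
  also have "\<dots> = q powr (-2 - \<tau>1 - \<tau>2) / 16 * (6400 * c\<^sup>2 * (\<Sum>j=1..X. real j powr (-\<tau>1 - \<tau>2)))"
    by (simp add: sum_distrib_left ac_simps)
  also have "\<dots> \<le> q powr (-2 - \<tau>1 - \<tau>2) / 16 * 1" by (intro mult_left_mono c(3)) auto
  also have "\<dots> = h1 * h2 / 4"
  proof -
    have "q powr (-2 - \<tau>1 - \<tau>2) = q powr (-1 - \<tau>1) * q powr (-1 - \<tau>2)" by (simp add: algebra_simps flip: powr_add)
    then show ?thesis unfolding h by simp
  qed
  finally show ?thesis .
qed

text \<open>The starting box has no rounded fraction at its centre, so the bound comes from the tail
  of a convergent series, with H depending on the box. This does no harm, as finitely many
  denominators do not affect bad approximability.\<close>

lemma initial_stage: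
  assumes h: "h1 > 0" "h2 > 0"
  shows "\<exists>H\<ge>1. \<forall>X. near_vol (\<lambda>q. 2 * c * q powr (-\<tau>1)) (\<lambda>q. 2 * c * q powr (-\<tau>2)) z1 z2 h1 h2 {H..X} \<le> h1 * h2 / 4"
proof -
  let ?K = "16 * c\<^sup>2 * (4 * h1 * h2 + 6 * h1 + 6 * h2 + 9)"
  have K: "?K > 0" using c h by (intro mult_pos_pos) (auto intro!: add_pos_pos)
  have "summable (\<lambda>n. real n powr (-\<tau>1 - \<tau>2))" using tau by (simp add: summable_real_powr_iff)
  then obtain N where N: "\<And>m n. m \<ge> N \<Longrightarrow> norm (\<Sum>q=m..<n. real q powr (-\<tau>1 - \<tau>2)) < h1 * h2 / 4 / ?K"
    unfolding summable_Cauchy using h K by (metis divide_pos_pos mult_pos_pos zero_less_numeral)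
  define H where "H = max 1 N"
  have "near_vol (\<lambda>q. 2 * c * q powr (-\<tau>1)) (\<lambda>q. 2 * c * q powr (-\<tau>2)) z1 z2 h1 h2 {H..X} \<le> h1 * h2 / 4" for X
  proof -
    have "near_vol (\<lambda>q. 2 * c * q powr (-\<tau>1)) (\<lambda>q. 2 * c * q powr (-\<tau>2)) z1 z2 h1 h2 {H..X}
      \<le> (\<Sum>q=H..X. (2 * h1 + 3 / q) * (2 * h2 + 3 / q) * (4 * (2 * c * q powr (-\<tau>1)) * (2 * c * q powr (-\<tau>2))))"
      using two_c_powr[of _ \<tau>1] two_c_powr[of _ \<tau>2] tau h by (intro near_vol_le) (auto simp: H_def)
    also have "\<dots> \<le> (\<Sum>q=H..X. ?K * real q powr (-\<tau>1 - \<tau>2))"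
    proof (rule sum_mono)
      fix q assume "q \<in> {H..X}"
      then have q: "q \<ge> 1" by (auto simp: H_def)
      have "real q powr (-1/2) \<le> real q powr 0" using q by (intro powr_mono) auto
      then have "(6 * h1 + 6 * h2 + 9) * real q powr (-1/2) \<le> (6 * h1 + 6 * h2 + 9) * 1"
        using h q by (intro mult_left_mono) auto
      then have "(2 * h1 + 3 / real q) * (2 * h2 + 3 / real q) \<le> 4 * h1 * h2 + 6 * h1 + 6 * h2 + 9"
        using box_count_factor_le[of h1 h2 q] q h by (simp add: algebra_simps)
      then have "(2 * h1 + 3 / q) * (2 * h2 + 3 / q) * (4 * (2 * c * q powr (-\<tau>1)) * (2 * c * q powr (-\<tau>2)))
        \<le> (4 * h1 * h2 + 6 * h1 + 6 * h2 + 9) * (4 * (2 * c * q powr (-\<tau>1)) * (2 * c * q powr (-\<tau>2)))"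
        using c by (intro mult_right_mono) auto
      also have "\<dots> = ?K * (real q powr (-\<tau>1) * real q powr (-\<tau>2))" by (simp add: power2_eq_square)
      also have "real q powr (-\<tau>1) * real q powr (-\<tau>2) = real q powr (-\<tau>1 - \<tau>2)" by (simp flip: powr_add)
      finally show "(2 * h1 + 3 / q) * (2 * h2 + 3 / q) * (4 * (2 * c * q powr (-\<tau>1)) * (2 * c * q powr (-\<tau>2)))
        \<le> ?K * real q powr (-\<tau>1 - \<tau>2)" .
    qed
    also have "\<dots> = ?K * (\<Sum>q=H..<Suc X. real q powr (-\<tau>1 - \<tau>2))" by (simp add: sum_distrib_left atLeastLessThanSuc_atLeastAtMost)
    also have "\<dots> \<le> ?K * (h1 * h2 / 4 / ?K)"
      using N[of H "Suc X"] K by (intro mult_left_mono) (auto simp: H_def)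
    also have "\<dots> = h1 * h2 / 4"
    proof -
      have "k * (x / k) = x" if "k > 0" for k x :: real using that by simp
      then show ?thesis using K by blast
    qed
    finally show ?thesis .
  qed
  then show ?thesis by (intro exI[of _ H]) (auto simp: H_def)
qed

section \<open>Boxes around nodes free of better approximations\<close>

definition well_approx_free :: "nat \<Rightarrow> real ^ 2 \<Rightarrow> bool" where
  "well_approx_free q y \<longleftrightarrow> (\<forall>p1 p2. c * q powr (-\<tau>1) \<le> \<bar>real q * y $ 1 - of_int p1\<bar> \<or>
     c * q powr (-\<tau>2) \<le> \<bar>real q * y $ 2 - of_int p2\<bar>)"

definition cx :: "nat \<times> int \<times> int \<Rightarrow> real" where "cx u = of_int (fst (snd u)) / real (fst u)"
definition cy :: "nat \<times> int \<times> int \<Rightarrow> real" where "cy u = of_int (snd (snd u)) / real (fst u)"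
text \<open>The factor 3/4 lies between 1/2, the half-sides within which children are sought, and 1,
  the precision to be beaten: child boxes fit inside, and every point is approximated with strict
  inequality.\<close>

definition jbox :: "nat \<times> int \<times> int \<Rightarrow> (real ^ 2) set" where
  "jbox u = sbox (cx u) (cy u) (3/4 * real (fst u) powr (-1 - \<tau>1)) (3/4 * real (fst u) powr (-1 - \<tau>2))"

text \<open>Up to \<open>q_ratio\<close> Q the margin in \<open>avoids\<close> is used, from there
  to q roundedness. Moving from p/q to y shifts q' y by at most q^(-\<tau>i), which is small against
  Q^(-\<sigma>i) beyond \<open>X0\<close>.\<close>

lemma free_range:
  fixes q Q H :: nat
  assumes r: "rounded q p1 p2" "avoids H Q q p1 p2" and q: "q_ratio * Q < q" "q \<le> Q"
    and X0: "X0 > 0" "X0 \<le> q_ratio * Q" "\<And>x. x \<ge> X0 \<Longrightarrow> (1 + q_ratio powr (-\<tau>1)) * x powr (-\<tau>1) \<le> sep_const * x powr (-\<sigma>1)"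
      "\<And>x. x \<ge> X0 \<Longrightarrow> (1 + q_ratio powr (-\<tau>2)) * x powr (-\<tau>2) \<le> sep_const * x powr (-\<sigma>2)"
    and y: "y \<in> jbox (q, p1, p2)" and q': "H \<le> q'" "q' < q" "H \<ge> 1"
  shows "well_approx_free q' y"
proof -
  have Q0: "0 < q_ratio * Q" "0 < real q" using X0 q by auto
  have Qpos: "real Q > 0" using q Q0 by linarith
  have move: "\<bar>real q' * (p / q) - p'\<bar> - q powr (-t) \<le> \<bar>real q' * x - p'\<bar>"
    if "\<bar>x - p / q\<bar> \<le> 3/4 * q powr (-1 - t)" for x t p p'
  proof -
    have "\<bar>real q' * (p / q) - p'\<bar> \<le> \<bar>real q' * x - p'\<bar> + real q' * \<bar>x - p / q\<bar>"
    proof -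
      have "real q' * (p / q) - p' = (real q' * x - p') - real q' * (x - p / q)" by (simp add: algebra_simps)
      then show ?thesis by (metis abs_mult abs_of_nat abs_triangle_ineq4)
    qed
    moreover have "real q' * \<bar>x - p / q\<bar> \<le> q * (1 * q powr (-1 - t))"
      using that q' by (intro mult_mono order.trans[OF that]) auto
    moreover have "q * (1 * q powr (-1 - t)) = q powr (-t)" using Q0 by (simp add: powr_diff powr_minus_divide)
    ultimately show ?thesis by linarith
  qed
  have y': "\<bar>y $ 1 - p1 / q\<bar> \<le> 3/4 * q powr (-1 - \<tau>1)" "\<bar>y $ 2 - p2 / q\<bar> \<le> 3/4 * q powr (-1 - \<tau>2)"
    using y by (auto simp: jbox_def cx_def cy_def mem_sbox)
  \<comment> \<open>Here q' > \<open>q_ratio\<close> q, so q'^(-t) is at most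
    \<open>q_ratio\<close>^(-t) q^(-t); the summand 1 in the constant pays for moving the
    point.\<close>
  have low: "c * q' powr (-t) \<le> A - q powr (-t)" if A: "q_ratio * Q < q'" "sep_const * q powr (-s) \<le> A"
    and X: "\<And>x. x \<ge> X0 \<Longrightarrow> (1 + q_ratio powr (-t)) * x powr (-t) \<le> sep_const * x powr (-s)" and t: "t > 0" for A s t
  proof -
    have "q' powr (-t) \<le> (q_ratio * q) powr (-t)"
    proof -
      have "q_ratio * q \<le> q_ratio * Q" using q q_ratio_pos by (intro mult_left_mono) auto
      then have "q_ratio * q \<le> q'" using A(1) by linarith
      then show ?thesis using Q0 q_ratio_pos t by (intro powr_mono2') auto
    qed
    then have "c * q' powr (-t) \<le> 1 * (q_ratio powr (-t) * q powr (-t))"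
      using c q_ratio_pos Q0 by (intro mult_mono) (auto simp: powr_mult)
    moreover have "(1 + q_ratio powr (-t)) * q powr (-t) \<le> sep_const * q powr (-s)" using X0 q by (intro X) auto
    ultimately show ?thesis using A by (simp add: algebra_simps)
  qed
  have high: "c * q' powr (-t) \<le> A - q powr (-t)" if A: "c * q' powr (-t) + Q powr (-s) \<le> A"
    and X: "\<And>x. x \<ge> X0 \<Longrightarrow> (1 + q_ratio powr (-t)) * x powr (-t) \<le> sep_const * x powr (-s)" and t: "t > 0" for A s t
  proof -
    have "q powr (-t) \<le> (q_ratio * Q) powr (-t)" using q Q0 t by (intro powr_mono2') auto
    also have "\<dots> = q_ratio powr (-t) * Q powr (-t)" using q_ratio_pos Qpos by (simp add: powr_mult)
    also have "\<dots> \<le> (1 + q_ratio powr (-t)) * Q powr (-t)" by (intro mult_right_mono) auto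
    also have "\<dots> \<le> sep_const * Q powr (-s)" 
    proof -
      have "q_ratio * Q \<le> 1 * real Q" using q_ratio_pos Qpos by (intro mult_right_mono) auto
      then show ?thesis using X0(2) by (intro X) auto
    qed
    also have "\<dots> \<le> 1 * Q powr (-s)" using sep_const_pos by (intro mult_right_mono) auto
    finally show ?thesis using A by simp
  qed
  show ?thesis
    unfolding well_approx_free_def
  proof (intro allI)
    fix p1' p2' :: int
    show "c * q' powr (-\<tau>1) \<le> \<bar>real q' * y $ 1 - of_int p1'\<bar> \<or> c * q' powr (-\<tau>2) \<le> \<bar>real q' * y $ 2 - of_int p2'\<bar>"
    proof (cases "real q' \<le> q_ratio * Q")
      case True
      then show ?thesis
        using r(2)[unfolded avoids_def, rule_format, of q' p1' p2'] q' high[of \<tau>1 \<sigma>1, OF _ X0(3) tau(1)] high[of \<tau>2 \<sigma>2, OF _ X0(4) tau(2)]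
          move[OF y'(1), of p1'] move[OF y'(2), of p2'] by fastforce
    next
      case False
      then have "q_ratio * Q < q'" by simp
      then show ?thesis
        using r(1)[unfolded rounded_def, rule_format, of q' p1' p2'] q' low[of \<sigma>1 _ \<tau>1, OF _ _ X0(3) tau(1)] low[of \<sigma>2 _ \<tau>2, OF _ _ X0(4) tau(2)]
          move[OF y'(1), of p1'] move[OF y'(2), of p2'] by fastforce
    qed
  qed
qed

end

section \<open>Growth estimates\<close>

text \<open>\<open>T\<close> is the dimension to be reached, \<open>e\<close> and \<open>g\<close> share the slack in the exponents, and \<open>X0\<close> is
  a scale beyond which all constants are absorbed.\<close>

locale cantor_setup = weighted_setup +
  fixes X0 e g T :: real
  assumes X0: "X0 \<ge> 1"
    "\<And>x. x \<ge> X0 \<Longrightarrow> (1 + q_ratio powr (-\<tau>1)) * x powr (-\<tau>1) \<le> sep_const * x powr (-\<sigma>1)"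
    "\<And>x. x \<ge> X0 \<Longrightarrow> (1 + q_ratio powr (-\<tau>2)) * x powr (-\<tau>2) \<le> sep_const * x powr (-\<sigma>2)"
    "\<And>x. x \<ge> X0 \<Longrightarrow> 24000 * (q_ratio powr (-1 - \<tau>1)) ^ 6 / (sep_const ^ 3 * q_ratio ^ 2) * x powr (-g) \<le> 1"
    "\<And>x. x \<ge> X0 \<Longrightarrow> 4 * q_ratio powr (-1 - \<tau>1) * x powr (-1 - \<tau>1) < sep_const * x powr (-1 - \<sigma>1)"
    "\<And>x. x \<ge> X0 \<Longrightarrow> 4 * q_ratio powr (-1 - \<tau>1) * x powr (-1 - \<tau>2) < sep_const * x powr (-1 - \<sigma>2)"
    and e: "e > 0" "T \<ge> 0" "g > 0"
    and slack: "T * (1 + \<tau>1) + e + g \<le> 3 + \<tau>1 - \<tau>2" "T * (1 + \<tau>2) + e + g \<le> 3"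
      "T * (1 + \<tau>2) + e + g \<le> 2 + \<tau>2 + \<sigma>2" "T + e + g \<le> 2"
begin

text \<open>Bounds (q/Q)^(-1-t) for all q > \<open>q_ratio\<close> Q and 0 < t <= \<tau>1, so that
  one constant serves both coordinates.\<close>

definition K0 :: real where "K0 = q_ratio powr (-1 - \<tau>1)"

lemma K0_ge1: "K0 \<ge> 1"
proof -
  have "1 powr (-1 - \<tau>1) \<le> q_ratio powr (-1 - \<tau>1)" using q_ratio_pos tau by (intro powr_mono2') auto
  then show ?thesis by (simp add: K0_def)
qed

definition K1 :: real where "K1 = 6000 * K0 ^ 2 / (sep_const ^ 3 * q_ratio ^ 2)"

lemma K1_pos: "K1 > 0" using K0_ge1 q_ratio_pos sep_const_pos by (auto simp: K1_def)

lemma big_const: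
  assumes "x \<ge> X0"
  shows "4 * K0 ^ 4 * K1 * x powr (-g) \<le> 1"
proof -
  have "4 * K0 ^ 4 * K1 = 24000 * K0 ^ 6 / (sep_const ^ 3 * q_ratio ^ 2)"
    by (simp add: K1_def flip: power_add mult.assoc)
  then show ?thesis using X0(4)[OF assms] by (simp add: K0_def)
qed

text \<open>Comparing r^w with r^T uses the upper end of the range of r if w >= T and the lower end
  (\<open>monomial_lower\<close>) if w <= T. After that only exponents of x remain to be
  compared.\<close>

lemma monomial_upper:
  fixes r x K u w :: real
  assumes "0 < r" "r \<le> K * x powr (-u)" "K \<ge> 1" "x > 0" "T \<le> w" "w - T \<le> 2"
  shows "r powr w \<le> r powr T * (K ^ 2 * x powr (-u * (w - T)))"
proof -
  have "r powr w = r powr T * r powr (w - T)" using assms by (simp flip: powr_add)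
  also have "r powr (w - T) \<le> (K * x powr (-u)) powr (w - T)" using assms by (intro powr_mono2) auto
  also have "(K * x powr (-u)) powr (w - T) = K powr (w - T) * x powr (-u * (w - T))"
    using assms by (simp add: powr_mult powr_powr)
  also have "K powr (w - T) \<le> K powr 2" using assms by (intro powr_mono) auto
  also have "K powr 2 = K ^ 2" using assms by simp
  finally show ?thesis by (simp add: mult_left_mono mult_right_mono)
qed

lemma monomial_lower:
  fixes r x u w :: real
  assumes "x powr (-u) \<le> r" "x > 0" "w \<le> T"
  shows "r powr w \<le> r powr T * x powr (u * (T - w))"
proof -
  have r: "r > 0" using assms powr_gt_zero[of x "-u"] by linarith
  have "(x powr (-u)) powr (T - w) \<le> r powr (T - w)" using assms by (intro powr_mono2) auto
  then have "x powr (-u * (T - w)) * x powr (u * (T - w)) \<le> r powr (T - w) * x powr (u * (T - w))"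
    unfolding powr_powr by (rule mult_right_mono) auto
  moreover have "x powr (-u * (T - w)) * x powr (u * (T - w)) = 1"
    using assms by (simp flip: powr_add)
  ultimately have "1 \<le> r powr (T - w) * x powr (u * (T - w))" by simp
  then have "r powr w * 1 \<le> r powr w * (r powr (T - w) * x powr (u * (T - w)))" by (intro mult_left_mono) auto
  also have "\<dots> = r powr T * x powr (u * (T - w))" using r by (simp flip: powr_add)
  finally show ?thesis by simp
qed

text \<open>The gap g between the exponents pays for the constant; the quarter leaves room for
  adding several monomials.\<close>

lemma absorb:
  fixes x p s C :: real
  assumes "x \<ge> X0" "0 \<le> C" "4 * C \<le> 4 * K0 ^ 4 * K1" "p \<le> s - g"
  shows "C * x powr p \<le> x powr s / 4"
proof -
  have x: "x \<ge> 1" using assms X0 by linarith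
  have "C * x powr p \<le> C * (x powr (-g) * x powr s)"
    using assms x by (intro mult_left_mono) (auto simp: simp flip: powr_add intro!: powr_mono)
  also have "\<dots> = (4 * C * x powr (-g)) * (x powr s / 4)" by simp
  also have "\<dots> \<le> (4 * K0 ^ 4 * K1 * x powr (-g)) * (x powr s / 4)" using assms by (intro mult_right_mono) auto
  also have "\<dots> \<le> 1 * (x powr s / 4)" using big_const[OF assms(1)] by (intro mult_right_mono) auto
  finally show ?thesis by simp
qed

text \<open>Here x is the scale of the level whose nodes are counted. The monomials are 1, r
  x^(1+\<sigma>1), the smaller r x^(1+\<sigma>2), and r^2 x^3. Up to e + g, the first needs T
  (1+\<tau>2) <= 3, the second T (1+\<tau>2) <= 2 + \<tau>2 + \<sigma>2 (if T >= 1), and the last T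
  <= 2.\<close>

lemma growth_I:
  fixes r x :: real
  assumes x: "x \<ge> X0" and r: "K0 * x powr (-1 - \<tau>2) \<le> r" "r \<le> 1 / x"
  shows "(1 + 4 * r * x powr (1 + \<sigma>1) / sep_const) * (1 + 4 * r * x powr (1 + \<sigma>2) / sep_const) \<le> r powr T * x powr (3 - e)"
proof -
  have x1: "x \<ge> 1" using x X0 by linarith
  have r0: "r > 0" using r x1 K0_ge1 by (intro order.strict_trans2[OF _ r(1)]) auto
  have lo: "x powr (-(1 + \<tau>2)) \<le> r"
  proof -
    have "1 * x powr (-1 - \<tau>2) \<le> K0 * x powr (-1 - \<tau>2)" using K0_ge1 by (intro mult_right_mono) auto
    then show ?thesis using r by simp
  qed
  have up: "r \<le> 1 * x powr (-1)" using r x1 by (simp add: powr_minus_divide)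
  have cst: "4 * (32 / sep_const ^ 2) \<le> 4 * K0 ^ 4 * K1"
  proof -
    have "32 / sep_const ^ 2 \<le> 6000 / (sep_const ^ 3 * q_ratio ^ 2)"
      by (simp add: sep_const_def q_ratio_def divide_simps)
    also have "\<dots> \<le> (K0 ^ 4 * K0 ^ 2) * (6000 / (sep_const ^ 3 * q_ratio ^ 2))"
    proof -
      have "1 \<le> K0 ^ 4 * K0 ^ 2" using K0_ge1 by (metis power_add one_le_power)
      then have "1 * (6000 / (sep_const ^ 3 * q_ratio ^ 2)) \<le> (K0 ^ 4 * K0 ^ 2) * (6000 / (sep_const ^ 3 * q_ratio ^ 2))"
        using sep_const_pos q_ratio_pos by (intro mult_right_mono) auto
      then show ?thesis by simp
    qed
    also have "\<dots> = K0 ^ 4 * K1" by (simp add: K1_def)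
    finally show ?thesis by simp
  qed
  have "16 / sep_const ^ 2 \<le> 32 / sep_const ^ 2" by (intro divide_right_mono) auto
  then have cst': "4 * (16 / sep_const ^ 2) \<le> 4 * K0 ^ 4 * K1" using cst by linarith
  have t1: "16 / sep_const ^ 2 * 1 \<le> r powr T * (x powr (3 - e) / 4)"
  proof -
    have "1 \<le> r powr T * x powr ((1 + \<tau>2) * T)" using monomial_lower[OF lo, of 0] x1 e r0 by simp
    then have "16 / sep_const ^ 2 * 1 \<le> 16 / sep_const ^ 2 * (r powr T * x powr ((1 + \<tau>2) * T))" by (intro mult_left_mono) auto
    also have "\<dots> = r powr T * (16 / sep_const ^ 2 * x powr ((1 + \<tau>2) * T))" by simp
    also have "\<dots> \<le> r powr T * (x powr (3 - e) / 4)"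
      using slack cst' by (intro mult_left_mono absorb x) (auto simp: algebra_simps)
    finally show ?thesis .
  qed
  have t2: "32 / sep_const ^ 2 * (r * x powr (1 + \<sigma>1)) \<le> r powr T * (x powr (3 - e) / 4)"
  proof -
    have "\<exists>p. r \<le> r powr T * x powr p \<and> 1 + \<sigma>1 + p \<le> 3 - e - g"
    proof (cases "T \<ge> 1")
      case True
      have "r \<le> r powr T * x powr ((1 + \<tau>2) * (T - 1))" using monomial_lower[OF lo, of 1] x1 True r0 by simp
      then show ?thesis using slack sigma by (intro exI[of _ "(1 + \<tau>2) * (T - 1)"]) (auto simp: algebra_simps)
    next
      case False
      have "r \<le> r powr T * x powr (-1 * (1 - T))" using monomial_upper[OF r0 up, of 1] x1 False r0 e by simp
      then show ?thesis using slack sigma by (intro exI[of _ "-1 * (1 - T)"]) (auto simp: algebra_simps)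
    qed
    then obtain p where p: "r \<le> r powr T * x powr p" "1 + \<sigma>1 + p \<le> 3 - e - g" by blast
    have "32 / sep_const ^ 2 * (r * x powr (1 + \<sigma>1)) \<le> 32 / sep_const ^ 2 * ((r powr T * x powr p) * x powr (1 + \<sigma>1))"
      using p by (intro mult_left_mono mult_right_mono) auto
    also have "\<dots> = r powr T * (32 / sep_const ^ 2 * x powr (1 + \<sigma>1 + p))" by (simp add: powr_add)
    also have "\<dots> \<le> r powr T * (x powr (3 - e) / 4)"
      using p cst by (intro mult_left_mono absorb x) auto
    finally show ?thesis .
  qed
  have t3: "16 / sep_const ^ 2 * (r ^ 2 * x powr 3) \<le> r powr T * (x powr (3 - e) / 4)"
  proof -
    have "r ^ 2 \<le> r powr T * x powr (-1 * (2 - T))" using monomial_upper[OF r0 up, of 2] x1 r0 e slack by simp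
    then have "16 / sep_const ^ 2 * (r ^ 2 * x powr 3) \<le> 16 / sep_const ^ 2 * ((r powr T * x powr (-1 * (2 - T))) * x powr 3)"
      by (intro mult_left_mono mult_right_mono) auto
    also have "\<dots> = r powr T * (16 / sep_const ^ 2 * (x powr (-1 * (2 - T)) * x powr 3))" by simp
    also have "x powr (-1 * (2 - T)) * x powr 3 = x powr (1 + T)" unfolding powr_add[symmetric] by (rule arg_cong[where f="\<lambda>e. x powr e"]) simp
    also have "r powr T * (16 / sep_const ^ 2 * x powr (1 + T)) \<le> r powr T * (x powr (3 - e) / 4)"
      using slack cst' by (intro mult_left_mono absorb x) (auto simp: algebra_simps)
    finally show ?thesis .
  qed
  have one: "1 + 4 * r * y / sep_const \<le> 4 / sep_const * (1 + r * y)" if "y \<ge> 0" for y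
    using sep_const_pos by (simp add: field_simps)
  have "(1 + 4 * r * x powr (1 + \<sigma>1) / sep_const) * (1 + 4 * r * x powr (1 + \<sigma>2) / sep_const)
    \<le> (4 / sep_const * (1 + r * x powr (1 + \<sigma>1))) * (4 / sep_const * (1 + r * x powr (1 + \<sigma>2)))"
    using r0 sep_const_pos by (intro mult_mono one) auto
  also have "\<dots> = 16 / sep_const ^ 2 * (1 + r * x powr (1 + \<sigma>1) + r * x powr (1 + \<sigma>2) + r ^ 2 * (x powr (1 + \<sigma>1) * x powr (1 + \<sigma>2)))"
    by (simp add: power2_eq_square algebra_simps)
  also have "x powr (1 + \<sigma>1) * x powr (1 + \<sigma>2) = x powr 3"
    unfolding powr_add[symmetric] by (rule arg_cong[where f="\<lambda>e. x powr e"]) (use sigma in simp)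
  also have "16 / sep_const ^ 2 * (1 + r * x powr (1 + \<sigma>1) + r * x powr (1 + \<sigma>2) + r ^ 2 * x powr 3)
    \<le> 16 / sep_const ^ 2 * (1 + r * x powr (1 + \<sigma>1) + r * x powr (1 + \<sigma>1) + r ^ 2 * x powr 3)"
    using r0 x1 sigma by (intro mult_left_mono add_mono powr_mono) auto
  also have "\<dots> = 16 / sep_const ^ 2 * 1 + 32 / sep_const ^ 2 * (r * x powr (1 + \<sigma>1)) + 16 / sep_const ^ 2 * (r ^ 2 * x powr 3)"
    by (simp add: algebra_simps add_divide_distrib)
  also have "\<dots> \<le> r powr T * (x powr (3 - e) / 4) + r powr T * (x powr (3 - e) / 4) + r powr T * (x powr (3 - e) / 4)"
    by (intro add_mono t1 t2 t3)
  also have "\<dots> \<le> r powr T * x powr (3 - e)" by simp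
  finally show ?thesis .
qed

text \<open>Here x is the scale of the parents. The factor 1 + r x^(1+\<sigma>1) counts the parents
  met, \<open>min r (K0 * x powr (-1 - \<tau>1)) * r\<close> is the area open to the children of one
  parent, and the last power divides by x^(3-e) parents and by the area x^(-2-\<tau>1-\<tau>2) of a
  parent box.\<close>

lemma growth_II:
  fixes r x :: real
  assumes x: "x \<ge> X0" and r: "0 < r" "r \<le> K0 * x powr (-1 - \<tau>2)"
  shows "K1 * (1 + r * x powr (1 + \<sigma>1)) * min r (K0 * x powr (-1 - \<tau>1)) * r * x powr (-1 + \<tau>1 + \<tau>2 + e) \<le> r powr T"
proof -
  let ?A = "K0 * x powr (-1 - \<tau>1)"
  have x1: "x \<ge> 1" using x X0 by linarith
  note pos = K1_pos K0_ge1
  have K0p: "K0 ^ a \<le> K0 ^ b" if "a \<le> b" for a b :: nat using that K0_ge1 by (rule power_increasing)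
  show ?thesis
  proof (cases "r \<le> ?A")
    case True
    \<comment> \<open>A square narrower than a parent box meets boundedly many parents, since
      \<sigma>1 < \<tau>1.\<close>
    have "r * x powr (1 + \<sigma>1) \<le> K0"
    proof -
      have "r * x powr (1 + \<sigma>1) \<le> ?A * x powr (1 + \<sigma>1)" using True by (intro mult_right_mono) auto
      also have "\<dots> = K0 * (x powr (-1 - \<tau>1) * x powr (1 + \<sigma>1))" by simp
      also have "x powr (-1 - \<tau>1) * x powr (1 + \<sigma>1) = x powr (\<sigma>1 - \<tau>1)" by (simp flip: powr_add)
      also have "x powr (\<sigma>1 - \<tau>1) \<le> x powr 0" using x1 sigma by (intro powr_mono) auto
      finally show ?thesis using x1 pos by simp
    qed
    then have f: "1 + r * x powr (1 + \<sigma>1) \<le> 2 * K0" using pos by linarith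
    have r2: "r ^ 2 \<le> r powr T * (K0 ^ 2 * x powr (-(1 + \<tau>1) * (2 - T)))"
      using monomial_upper[of r K0 x "1 + \<tau>1" 2] True r x1 pos slack e by simp
    have "K1 * (1 + r * x powr (1 + \<sigma>1)) * min r ?A * r * x powr (-1 + \<tau>1 + \<tau>2 + e)
      \<le> K1 * (2 * K0) * r * r * x powr (-1 + \<tau>1 + \<tau>2 + e)"
      using f r pos by (intro mult_mono mult_right_mono mult_left_mono) auto
    also have "\<dots> = (2 * K0 * K1) * r ^ 2 * x powr (-1 + \<tau>1 + \<tau>2 + e)" by (simp add: power2_eq_square)
    also have "\<dots> \<le> (2 * K0 * K1) * (r powr T * (K0 ^ 2 * x powr (-(1 + \<tau>1) * (2 - T)))) * x powr (-1 + \<tau>1 + \<tau>2 + e)"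
      using r2 pos by (intro mult_right_mono mult_left_mono) auto
    also have "\<dots> = r powr T * (2 * K0 ^ 3 * K1 * (x powr (-(1 + \<tau>1) * (2 - T)) * x powr (-1 + \<tau>1 + \<tau>2 + e)))"
      by (simp add: power2_eq_square power3_eq_cube)
    also have "x powr (-(1 + \<tau>1) * (2 - T)) * x powr (-1 + \<tau>1 + \<tau>2 + e) = x powr (-(1 + \<tau>1) * (2 - T) + (-1 + \<tau>1 + \<tau>2 + e))"
      by (simp only: powr_add)
    \<comment> \<open>Only one monomial is left in this case, so all four quarters of
      \<open>absorb\<close> are available.\<close>
    also have "r powr T * (2 * K0 ^ 3 * K1 * x powr (-(1 + \<tau>1) * (2 - T) + (-1 + \<tau>1 + \<tau>2 + e))) \<le> r powr T * (4 * (x powr 0 / 4))"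
    proof -
      have "K0 ^ 3 / 2 * K1 * x powr (-(1 + \<tau>1) * (2 - T) + (-1 + \<tau>1 + \<tau>2 + e)) \<le> x powr 0 / 4"
      proof (rule absorb[OF x])
        have "K0 ^ 3 / 2 \<le> K0 ^ 4" using K0p[of 3 4] zero_le_power[of K0 3] pos by linarith
        then have "K0 ^ 3 / 2 * K1 \<le> K0 ^ 4 * K1" using pos by (intro mult_right_mono) auto
        then show "4 * (K0 ^ 3 / 2 * K1) \<le> 4 * K0 ^ 4 * K1" by (simp add: ac_simps)
        show "-(1 + \<tau>1) * (2 - T) + (-1 + \<tau>1 + \<tau>2 + e) \<le> 0 - g" using slack by (simp add: algebra_simps)
      qed (use pos in auto)
      then show ?thesis by (intro mult_left_mono) (auto simp: ac_simps)
    qed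
    finally show ?thesis using x1 by simp
  next
    case False
    have lo: "x powr (-(1 + \<tau>1)) \<le> r"
    proof -
      have "1 * x powr (-1 - \<tau>1) \<le> ?A" using pos by (intro mult_right_mono) auto
      then show ?thesis using False by simp
    qed
    have up: "r \<le> K0 * x powr (-(1 + \<tau>2))" using r by simp
    \<comment> \<open>Of the two monomials left, this one needs the first or the second slack
      inequality, according to T >= 1 or T < 1; the other one needs the third.\<close>
    have t1: "K1 * K0 * (r * x powr (-2 + \<tau>2 + e)) \<le> r powr T * (x powr 0 / 4)"
    proof -
      have "\<exists>p. r \<le> r powr T * (K0 ^ 2 * x powr p) \<and> p + (-2 + \<tau>2 + e) \<le> 0 - g"
      proof (cases "T \<ge> 1")
        case True
        have "r \<le> r powr T * (1 * x powr ((1 + \<tau>1) * (T - 1)))" using monomial_lower[OF lo, of 1] x1 True r by simp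
        also have "\<dots> \<le> r powr T * (K0 ^ 2 * x powr ((1 + \<tau>1) * (T - 1)))"
          using pos by (intro mult_left_mono mult_right_mono) auto
        finally show ?thesis using slack sigma by (intro exI[of _ "(1 + \<tau>1) * (T - 1)"]) (auto simp: algebra_simps)
      next
        case False
        have "r \<le> r powr T * (K0 ^ 2 * x powr (-(1 + \<tau>2) * (1 - T)))" using monomial_upper[OF r(1) up, of 1] x1 False r e pos by simp
        then show ?thesis using slack sigma by (intro exI[of _ "-(1 + \<tau>2) * (1 - T)"]) (auto simp: algebra_simps)
      qed
      then obtain p where p: "r \<le> r powr T * (K0 ^ 2 * x powr p)" "p + (-2 + \<tau>2 + e) \<le> 0 - g" by blast
      have "K1 * K0 * (r * x powr (-2 + \<tau>2 + e)) \<le> K1 * K0 * ((r powr T * (K0 ^ 2 * x powr p)) * x powr (-2 + \<tau>2 + e))"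
        using p pos by (intro mult_left_mono mult_right_mono) auto
      also have "\<dots> = r powr T * (K0 ^ 3 * K1 * x powr (p + (-2 + \<tau>2 + e)))" unfolding powr_add[of x p] by (simp add: power2_eq_square power3_eq_cube)
      also have "\<dots> \<le> r powr T * (x powr 0 / 4)"
      proof -
        have "K0 ^ 3 * K1 \<le> K0 ^ 4 * K1" using K0p[of 3 4] pos by (intro mult_right_mono) auto
        then show ?thesis using p pos by (intro mult_left_mono absorb x) auto
      qed
      finally show ?thesis .
    qed
    have t2: "K1 * K0 * (r ^ 2 * x powr (1 + \<sigma>1) * x powr (-2 + \<tau>2 + e)) \<le> r powr T * (x powr 0 / 4)"
    proof -
      have "r ^ 2 \<le> r powr T * (K0 ^ 2 * x powr (-(1 + \<tau>2) * (2 - T)))" using monomial_upper[OF r(1) up, of 2] x1 r e pos slack by simp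
      then have "K1 * K0 * (r ^ 2 * x powr (1 + \<sigma>1) * x powr (-2 + \<tau>2 + e))
        \<le> K1 * K0 * ((r powr T * (K0 ^ 2 * x powr (-(1 + \<tau>2) * (2 - T)))) * x powr (1 + \<sigma>1) * x powr (-2 + \<tau>2 + e))"
        using pos by (intro mult_left_mono mult_right_mono) auto
      also have "\<dots> = r powr T * (K0 ^ 3 * K1 * (x powr (-(1 + \<tau>2) * (2 - T)) * x powr (1 + \<sigma>1) * x powr (-2 + \<tau>2 + e)))"
        by (simp add: power2_eq_square power3_eq_cube)
      also have "x powr (-(1 + \<tau>2) * (2 - T)) * x powr (1 + \<sigma>1) * x powr (-2 + \<tau>2 + e) = x powr (-(1 + \<tau>2) * (2 - T) + (1 + \<sigma>1) + (-2 + \<tau>2 + e))"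
        by (simp only: powr_add)
      also have "r powr T * (K0 ^ 3 * K1 * x powr (-(1 + \<tau>2) * (2 - T) + (1 + \<sigma>1) + (-2 + \<tau>2 + e))) \<le> r powr T * (x powr 0 / 4)"
      proof -
        have "K0 ^ 3 * K1 \<le> K0 ^ 4 * K1" using K0p[of 3 4] pos by (intro mult_right_mono) auto
        then show ?thesis using slack sigma pos by (intro mult_left_mono absorb x) (auto simp: algebra_simps)
      qed
      finally show ?thesis .
    qed
    have "K1 * (1 + r * x powr (1 + \<sigma>1)) * min r ?A * r * x powr (-1 + \<tau>1 + \<tau>2 + e)
      \<le> K1 * (1 + r * x powr (1 + \<sigma>1)) * ?A * r * x powr (-1 + \<tau>1 + \<tau>2 + e)"
      using r pos by (intro mult_right_mono mult_left_mono) auto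
    also have "\<dots> = K1 * K0 * (1 + r * x powr (1 + \<sigma>1)) * r * (x powr (-1 - \<tau>1) * x powr (-1 + \<tau>1 + \<tau>2 + e))" by simp
    also have "x powr (-1 - \<tau>1) * x powr (-1 + \<tau>1 + \<tau>2 + e) = x powr (-2 + \<tau>2 + e)"
      unfolding powr_add[symmetric] by (rule arg_cong[where f="\<lambda>e. x powr e"]) simp
    also have "K1 * K0 * (1 + r * x powr (1 + \<sigma>1)) * r * x powr (-2 + \<tau>2 + e)
      = K1 * K0 * (r * x powr (-2 + \<tau>2 + e)) + K1 * K0 * (r ^ 2 * x powr (1 + \<sigma>1) * x powr (-2 + \<tau>2 + e))"
      by (simp add: power2_eq_square algebra_simps)
    also have "\<dots> \<le> r powr T * (x powr 0 / 4) + r powr T * (x powr 0 / 4)" by (intro add_mono t1 t2)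
    also have "\<dots> \<le> r powr T" using x1 by simp
    finally show ?thesis .
  qed
qed

end

section \<open>Levels of the Cantor set\<close>

context cantor_setup
begin

text \<open>The quotient of \<open>meets L S\<close> by \<open>card L\<close> plays the role of the
  mass of S.\<close>

definition meets :: "(nat \<times> int \<times> int) set \<Rightarrow> (real ^ 2) set \<Rightarrow> nat" where
  "meets L S = card {u \<in> L. jbox u \<inter> S \<noteq> {}}"

text \<open>A node is a triple \<open>(q, p1, p2)\<close> standing for the fraction \<open>(p1 / q, p2 / q)\<close>.\<close>

definition good_level :: "nat \<Rightarrow> (real ^ 2) set \<Rightarrow> nat \<Rightarrow> (nat \<times> int \<times> int) set \<Rightarrow> bool" where
  "good_level H0 B0 Q L \<longleftrightarrow> finite L \<and> X0 \<le> q_ratio * Q \<and> real Q powr (3 - e) \<le> card L \<and>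
     (\<forall>u\<in>L. q_ratio * Q < real (fst u) \<and> fst u \<le> Q \<and> rounded (fst u) (fst (snd u)) (snd (snd u)) \<and> jbox u \<subseteq> B0 \<and>
       (\<forall>y\<in>jbox u. \<forall>q. H0 \<le> q \<and> q < fst u \<longrightarrow> well_approx_free q y))"

text \<open>N is the same for all v, so that the proportion of nodes meeting a given set cannot grow
  at the next level. Its lower bound uses the smallest possible parent box. The last inequality
  makes child boxes and the slack of \<open>refines\<close> fit into the gap between 1/2 and
  3/4.\<close>

definition child_level :: "nat \<Rightarrow> (nat \<times> int \<times> int) set \<Rightarrow> nat \<Rightarrow> (nat \<times> int \<times> int) set \<Rightarrow> bool" where
  "child_level Q L Q' L' \<longleftrightarrow> (\<exists>ch N. L' = (\<Union>v\<in>L. ch v) \<and>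
     (\<forall>v\<in>L. finite (ch v) \<and> card (ch v) = N \<and> (\<forall>u\<in>ch v. jbox u \<subseteq> jbox v)) \<and>
     q_ratio\<^sup>2 / 16 * Q powr (-2 - \<tau>1 - \<tau>2) * real Q' ^ 3 \<le> real N \<and> 8 * Q powr (1 + \<tau>1) \<le> q_ratio * Q')"

section \<open>Construction of the levels\<close>

lemma Q_large:
  assumes "X0 \<le> q_ratio * real Q"
  shows "X0 \<le> Q" "1 \<le> real Q" "0 < q_ratio * real Q"
proof -
  have "q_ratio * Q \<le> 1 * real Q" using q_ratio_pos by (intro mult_right_mono) auto
  then show "X0 \<le> Q" "1 \<le> real Q" "0 < q_ratio * real Q" using assms X0(1) by linarith+
qed

lemma radius_small:
  fixes q Q :: nat
  assumes "X0 \<le> q_ratio * Q" "q_ratio * Q < q" "t > 0"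
  shows "q powr (-1 - t) \<le> 1 / (q_ratio * Q)"
proof -
  have Q: "0 < q_ratio * real Q" using Q_large assms by blast
  have q: "real q \<ge> 1" using assms X0 by linarith
  have "q powr (-1 - t) \<le> q powr (-1)" using q assms by (intro powr_mono) auto
  also have "\<dots> = 1 / q" using q by (simp add: powr_minus_divide)
  also have "\<dots> \<le> 1 / (q_ratio * Q)" using assms Q by (intro frac_le) auto
  finally show ?thesis .
qed

lemma jbox_radius_le:
  fixes q Q :: nat
  assumes "X0 \<le> q_ratio * Q" "q_ratio * Q < q" "0 < t" "t \<le> \<tau>1"
  shows "q powr (-1 - t) \<le> K0 * Q powr (-1 - t)"
proof -
  have Q: "0 < q_ratio * real Q" "real Q \<ge> 1" using Q_large assms by blast+
  have "q powr (-1 - t) \<le> (q_ratio * Q) powr (-1 - t)" using assms Q by (intro powr_mono2') auto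
  also have "\<dots> = q_ratio powr (-1 - t) * Q powr (-1 - t)" using q_ratio_pos Q by (simp add: powr_mult)
  also have "\<dots> \<le> K0 * Q powr (-1 - t)"
    unfolding K0_def using q_ratio_pos assms by (intro mult_right_mono powr_mono') auto
  finally show ?thesis .
qed

lemma jbox_subset:
  fixes u :: "nat \<times> int \<times> int" and Q' :: nat
  assumes Q': "X0 \<le> q_ratio * real Q'" "q_ratio * Q' < real (fst u)"
    and c: "\<bar>cx u - z1\<bar> \<le> h1 + 1 / (q_ratio * Q')" "\<bar>cy u - z2\<bar> \<le> h2 + 1 / (q_ratio * Q')"
    and g: "h1 + 2 / (q_ratio * Q') \<le> g1" "h2 + 2 / (q_ratio * Q') \<le> g2"
  shows "jbox u \<subseteq> sbox z1 z2 g1 g2"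
proof
  fix y assume y: "y \<in> jbox u"
  have "real (fst u) powr (-1 - \<tau>1) \<le> 1 / (q_ratio * Q')" "real (fst u) powr (-1 - \<tau>2) \<le> 1 / (q_ratio * Q')"
    using radius_small[OF Q'] tau by auto
  moreover have "0 \<le> real (fst u) powr (-1 - \<tau>1)" "0 \<le> real (fst u) powr (-1 - \<tau>2)" by auto
  moreover have "2 / (q_ratio * Q') = 1 / (q_ratio * Q') + 1 / (q_ratio * Q')" by simp
  ultimately show "y \<in> sbox z1 z2 g1 g2" using y c g unfolding jbox_def mem_sbox by linarith
qed

lemma node_free:
  fixes u :: "nat \<times> int \<times> int" and Q H q :: nat
  assumes Q: "X0 \<le> q_ratio * real Q" and u: "q_ratio * Q < real (fst u)" "fst u \<le> Q" "rounded (fst u) (fst (snd u)) (snd (snd u))"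
    "avoids H Q (fst u) (fst (snd u)) (snd (snd u))" and y: "y \<in> jbox u" and q: "H \<le> q" "q < fst u" "H \<ge> 1"
  shows "well_approx_free q y"
proof -
  obtain a b1 b2 where ab: "u = (a, b1, b2)" by (metis prod.exhaust)
  show ?thesis
    by (rule free_range[of a b1 b2 H Q X0 y q]) (use assms X0 ab in auto)
qed

text \<open>The factor of order h^2 in the area count is beaten by Q^e for large Q, which is why a
  level is only asked to have Q^(3-e) nodes. Doubling h leaves room for boxes near the
  boundary.\<close>

lemma initial_level:
  assumes h: "h > 0"
  shows "\<exists>H0\<ge>1. \<exists>Q L. good_level H0 (sbox z1 z2 (2 * h) (2 * h)) Q L"
proof -
  obtain H0 where H0: "H0 \<ge> 1" "\<And>X. near_vol (\<lambda>q. 2 * c * q powr (-\<tau>1)) (\<lambda>q. 2 * c * q powr (-\<tau>2)) z1 z2 h h {H0..X} \<le> h * h / 4"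
    using initial_stage[OF h h] by blast
  have "((\<lambda>x::real. x powr (-e)) \<longlongrightarrow> 0) at_top" using e by (intro tendsto_neg_powr filterlim_ident) auto
  moreover have "h * h * q_ratio\<^sup>2 / 4 > 0" using h q_ratio_pos by simp
  ultimately have "\<forall>\<^sub>F x in at_top. x powr (-e) < h * h * q_ratio\<^sup>2 / 4" by (rule order_tendstoD(2))
  then have "\<forall>\<^sub>F x in at_top. x powr (-e) < h * h * q_ratio\<^sup>2 / 4 \<and> x \<ge> X0 / q_ratio \<and> x \<ge> 2 / (q_ratio * h) \<and> x > 0"
    using eventually_ge_at_top[of "X0 / q_ratio"] eventually_ge_at_top[of "2 / (q_ratio * h)"] eventually_gt_at_top[of 0]
    by eventually_elim auto
  from eventually_Q[OF this] step[OF h h H0]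
  have "\<forall>\<^sub>F m in sequentially. \<exists>Q C. finite C \<and> h * h * q_ratio\<^sup>2 * real Q ^ 3 / 4 \<le> real (card C) \<and> refines H0 z1 z2 h h Q C \<and>
    Q powr (-e) < h * h * q_ratio\<^sup>2 / 4 \<and> Q \<ge> X0 / q_ratio \<and> Q \<ge> 2 / (q_ratio * h) \<and> real Q > 0"
    by eventually_elim blast
  then obtain Q C where Q: "finite C" "h * h * q_ratio\<^sup>2 * real Q ^ 3 / 4 \<le> real (card C)" "refines H0 z1 z2 h h Q C"
    "Q powr (-e) < h * h * q_ratio\<^sup>2 / 4" "Q \<ge> X0 / q_ratio" "Q \<ge> 2 / (q_ratio * h)" "real Q > 0"
    using eventually_happens'[OF sequentially_bot] by blast
  have X: "X0 \<le> q_ratio * Q" "2 / (q_ratio * Q) \<le> h" using Q q_ratio_pos h by (simp_all add: field_simps)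
  have "real Q powr (3 - e) \<le> card C"
  proof -
    have "real Q powr (3 - e) = Q powr (-e) * real Q powr 3"
      unfolding powr_add[symmetric] by (rule arg_cong[where f="\<lambda>e. real Q powr e"]) simp
    also have "real Q powr 3 = real Q ^ 3" using Q by simp
    also have "Q powr (-e) * real Q ^ 3 \<le> (h * h * q_ratio\<^sup>2 / 4) * real Q ^ 3" using Q by (intro mult_right_mono) auto
    finally show ?thesis using Q by simp
  qed
  moreover have "q_ratio * Q < real (fst u) \<and> fst u \<le> Q \<and> rounded (fst u) (fst (snd u)) (snd (snd u)) \<and> jbox u \<subseteq> sbox z1 z2 (2 * h) (2 * h) \<and>
       (\<forall>y\<in>jbox u. \<forall>q. H0 \<le> q \<and> q < fst u \<longrightarrow> well_approx_free q y)" if u: "u \<in> C" for u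
  proof -
    have u': "q_ratio * Q < real (fst u)" "fst u \<le> Q" "rounded (fst u) (fst (snd u)) (snd (snd u))"
      "avoids H0 Q (fst u) (fst (snd u)) (snd (snd u))" "\<bar>cx u - z1\<bar> \<le> h + 1 / (q_ratio * Q)" "\<bar>cy u - z2\<bar> \<le> h + 1 / (q_ratio * Q)"
      using bspec[OF Q(3)[unfolded refines_def] u] by (auto simp: cx_def cy_def)
    have "jbox u \<subseteq> sbox z1 z2 (2 * h) (2 * h)" using X u' by (intro jbox_subset[of Q]) auto
    then show ?thesis using u' node_free[OF X(1) u'(1-4)] H0(1) by auto
  qed
  ultimately show ?thesis using X(1) Q(1) H0(1) unfolding good_level_def by blast
qed

text \<open>L is finite, so a single Q' works for all parents; surplus children are then discarded
  to make the numbers equal. Denominators below that of the parent are already excluded on the whole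
  parent box, so the child starts with H equal to the parent's denominator.\<close>

lemma next_level:
  assumes G: "good_level H0 B0 Q L"
  shows "\<exists>Q' L'. good_level H0 B0 Q' L' \<and> child_level Q L Q' L'"
proof -
  have finL: "finite L" and XQ: "X0 \<le> q_ratio * Q" and cardL: "real Q powr (3 - e) \<le> card L"
    and node: "\<And>u. u \<in> L \<Longrightarrow> q_ratio * Q < real (fst u) \<and> fst u \<le> Q \<and> rounded (fst u) (fst (snd u)) (snd (snd u)) \<and> jbox u \<subseteq> B0 \<and>
       (\<forall>y\<in>jbox u. \<forall>q. H0 \<le> q \<and> q < fst u \<longrightarrow> well_approx_free q y)"
    using G unfolding good_level_def by blast+
  note Q1 = Q_large[OF XQ]
  have "0 < real Q powr (3 - e)" using Q1 by simp
  then have "L \<noteq> {}" using cardL by auto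
  then obtain v0 where v0: "v0 \<in> L" by blast
  define hh where "hh = (\<lambda>t (v::nat\<times>int\<times>int). real (fst v) powr (-1 - t) / 2)"
  have ev: "\<forall>\<^sub>F m in sequentially. \<exists>C. finite C \<and> hh \<tau>1 v * hh \<tau>2 v * q_ratio\<^sup>2 * real (m ^ (a1 + a2)) ^ 3 / 4 \<le> real (card C) \<and>
    refines (fst v) (cx v) (cy v) (hh \<tau>1 v) (hh \<tau>2 v) (m ^ (a1 + a2)) C" if v: "v \<in> L" for v
  proof -
    have q: "real (fst v) \<ge> X0" "real (fst v) \<ge> 1" using node[OF v] XQ X0 by linarith+
    have b: "real (fst v) powr (-t) \<le> sep_const * real (fst v) powr (-s)"
      if "(1 + q_ratio powr (-t)) * real (fst v) powr (-t) \<le> sep_const * real (fst v) powr (-s)" for s t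
    proof -
      have "1 * real (fst v) powr (-t) \<le> (1 + q_ratio powr (-t)) * real (fst v) powr (-t)" by (intro mult_right_mono) auto
      then show ?thesis using that by linarith
    qed
    have "near_vol (\<lambda>q. 2 * c * q powr (-\<tau>1)) (\<lambda>q. 2 * c * q powr (-\<tau>2)) (cx v) (cy v) (hh \<tau>1 v) (hh \<tau>2 v) {fst v..X}
      \<le> hh \<tau>1 v * hh \<tau>2 v / 4" for X
      unfolding cx_def cy_def using node[OF v] q
      by (intro node_stage b X0(2,3)) (auto simp: hh_def)
    then show ?thesis using q by (intro step) (auto simp: hh_def)
  qed
  \<comment> \<open>This collects what depends on the old level. With Q'^(-e) below it, already the
    children of one parent number at least Q'^(3-e).\<close>
  define cc where "cc = q_ratio\<^sup>2 / 16 * Q powr (-2 - \<tau>1 - \<tau>2)"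
  have cc: "cc > 0" using Q1 q_ratio_pos by (simp add: cc_def)
  have "((\<lambda>x::real. x powr (-e)) \<longlongrightarrow> 0) at_top" using e by (intro tendsto_neg_powr filterlim_ident) auto
  then have "\<forall>\<^sub>F x in at_top. x powr (-e) < cc" using cc by (rule order_tendstoD(2))
  then have "\<forall>\<^sub>F x in at_top. x powr (-e) < cc \<and> x \<ge> X0 / q_ratio \<and> x \<ge> 8 * Q powr (1 + \<tau>1) / q_ratio \<and> x > 0"
    using eventually_ge_at_top[of "X0 / q_ratio"] eventually_ge_at_top[of "8 * Q powr (1 + \<tau>1) / q_ratio"] eventually_gt_at_top[of 0]
    by eventually_elim auto
  moreover have "\<forall>\<^sub>F m in sequentially. \<forall>v\<in>L. \<exists>C. finite C \<and> hh \<tau>1 v * hh \<tau>2 v * q_ratio\<^sup>2 * real (m ^ (a1 + a2)) ^ 3 / 4 \<le> real (card C) \<and>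
    refines (fst v) (cx v) (cy v) (hh \<tau>1 v) (hh \<tau>2 v) (m ^ (a1 + a2)) C"
    using ev by (intro eventually_ball_finite finL) blast
  from eventually_Q[OF calculation] this  have "\<forall>\<^sub>F m in sequentially. \<exists>Q'. (\<forall>v\<in>L. \<exists>C. finite C \<and> hh \<tau>1 v * hh \<tau>2 v * q_ratio\<^sup>2 * real Q' ^ 3 / 4 \<le> real (card C) \<and>
    refines (fst v) (cx v) (cy v) (hh \<tau>1 v) (hh \<tau>2 v) Q' C) \<and> Q' powr (-e) < cc \<and> Q' \<ge> X0 / q_ratio \<and> Q' \<ge> 8 * Q powr (1 + \<tau>1) / q_ratio \<and> real Q' > 0"
  proof eventually_elim
    case (elim m)
    show ?case by (rule exI[of _ "m ^ (a1 + a2)"]) (rule conjI[OF elim(2) elim(1)])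
  qed
  then obtain Q' where Q': "\<forall>v\<in>L. \<exists>C. finite C \<and> hh \<tau>1 v * hh \<tau>2 v * q_ratio\<^sup>2 * real Q' ^ 3 / 4 \<le> real (card C) \<and>
    refines (fst v) (cx v) (cy v) (hh \<tau>1 v) (hh \<tau>2 v) Q' C" "Q' powr (-e) < cc" "Q' \<ge> X0 / q_ratio" "Q' \<ge> 8 * Q powr (1 + \<tau>1) / q_ratio" "real Q' > 0"
    using eventually_happens'[OF sequentially_bot] by blast
  have XQ': "X0 \<le> q_ratio * Q'" and big: "8 * Q powr (1 + \<tau>1) \<le> q_ratio * Q'" using Q' q_ratio_pos by (simp_all add: field_simps)
  note Q1' = Q_large[OF XQ']
  define N where "N = nat \<lceil>cc * real Q' ^ 3\<rceil>"
  have N: "cc * real Q' ^ 3 \<le> real N" unfolding N_def by linarith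
  have "\<exists>C. finite C \<and> card C = N \<and> refines (fst v) (cx v) (cy v) (hh \<tau>1 v) (hh \<tau>2 v) Q' C" if v: "v \<in> L" for v
  proof -
    obtain C where C: "finite C" "hh \<tau>1 v * hh \<tau>2 v * q_ratio\<^sup>2 * real Q' ^ 3 / 4 \<le> real (card C)" "refines (fst v) (cx v) (cy v) (hh \<tau>1 v) (hh \<tau>2 v) Q' C"
      using Q'(1) v by blast
    have q: "real (fst v) \<ge> 1" "real (fst v) \<le> Q" using node[OF v] XQ X0 by linarith+
    have "Q powr (-2 - \<tau>1 - \<tau>2) \<le> real (fst v) powr (-2 - \<tau>1 - \<tau>2)" using q tau by (intro powr_mono2') auto
    also have "\<dots> = real (fst v) powr (-1 - \<tau>1) * real (fst v) powr (-1 - \<tau>2)"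
      unfolding powr_add[symmetric] by (rule arg_cong[where f="\<lambda>e. real (fst v) powr e"]) simp
    also have "\<dots> = 4 * (hh \<tau>1 v * hh \<tau>2 v)" by (simp add: hh_def)
    finally have "q_ratio\<^sup>2 / 16 * Q powr (-2 - \<tau>1 - \<tau>2) \<le> q_ratio\<^sup>2 / 16 * (4 * (hh \<tau>1 v * hh \<tau>2 v))" by (intro mult_left_mono) auto
    then have "cc \<le> hh \<tau>1 v * hh \<tau>2 v * q_ratio\<^sup>2 / 4" by (simp add: cc_def)
    then have "cc * real Q' ^ 3 \<le> hh \<tau>1 v * hh \<tau>2 v * q_ratio\<^sup>2 / 4 * real Q' ^ 3" by (intro mult_right_mono) auto
    then have "cc * real Q' ^ 3 \<le> real (card C)" using C(2) by simp
    then have "N \<le> card C" unfolding N_def by (simp add: nat_le_iff ceiling_le_iff)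
    then obtain D where "D \<subseteq> C" "card D = N" "finite D" using obtain_subset_with_card_n by blast
    then show ?thesis using C(3) unfolding refines_def by blast
  qed
  then obtain ch where ch: "\<And>v. v \<in> L \<Longrightarrow> finite (ch v) \<and> card (ch v) = N \<and> refines (fst v) (cx v) (cy v) (hh \<tau>1 v) (hh \<tau>2 v) Q' (ch v)"
    by metis
  have u': "q_ratio * Q' < real (fst u) \<and> fst u \<le> Q' \<and> rounded (fst u) (fst (snd u)) (snd (snd u)) \<and>
      avoids (fst v) Q' (fst u) (fst (snd u)) (snd (snd u)) \<and> jbox u \<subseteq> jbox v" if v: "v \<in> L" and u: "u \<in> ch v" for u v
  proof -
    have u1: "q_ratio * Q' < real (fst u)" "fst u \<le> Q'" "rounded (fst u) (fst (snd u)) (snd (snd u))"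
      "avoids (fst v) Q' (fst u) (fst (snd u)) (snd (snd u))" "\<bar>cx u - cx v\<bar> \<le> hh \<tau>1 v + 1 / (q_ratio * Q')" "\<bar>cy u - cy v\<bar> \<le> hh \<tau>2 v + 1 / (q_ratio * Q')"
      using bspec[OF conjunct2[OF conjunct2[OF ch[OF v]], unfolded refines_def] u] by (auto simp: cx_def cy_def)
    have q: "real (fst v) \<ge> 1" "real (fst v) \<le> Q" using node[OF v] XQ X0 by linarith+
    \<comment> \<open>As the denominator of v is at most Q and t <= \<tau>1, the slack 2 /
      (\<open>q_ratio\<close> Q') is at most a quarter of the scale of v, and 1/2 + 1/4 =
      3/4.\<close>
    have small: "hh t v + 2 / (q_ratio * Q') \<le> 3/4 * real (fst v) powr (-1 - t)" if "0 < t" "t \<le> \<tau>1" for t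
    proof -
      have "8 / (q_ratio * Q') \<le> Q powr (-(1 + \<tau>1))"
      proof -
        have "8 / (q_ratio * Q') \<le> 1 / P" if "P > 0" "8 * P \<le> q_ratio * Q'" for P :: real
          using that Q1' by (simp add: field_simps)
        moreover have "real Q powr (1 + \<tau>1) > 0" using Q1 by simp
        ultimately show ?thesis unfolding powr_minus_divide using big by blast
      qed
      also have "\<dots> \<le> Q powr (-1 - t)" using Q1 that by (intro powr_mono) auto
      also have "\<dots> \<le> real (fst v) powr (-1 - t)" using q that by (intro powr_mono2') auto
      finally show ?thesis by (simp add: hh_def)
    qed
    have "jbox u \<subseteq> jbox v"
      unfolding jbox_def[of v] using XQ' u1 small tau by (intro jbox_subset[of Q']) auto
    then show ?thesis using u1 by blast
  qed
  define L' where "L' = (\<Union>v\<in>L. ch v)"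
  have finL': "finite L'" unfolding L'_def using finL ch by auto
  have "child_level Q L Q' L'"
    unfolding child_level_def using ch u' N big by (intro exI[of _ ch] exI[of _ N]) (auto simp: L'_def cc_def)
  moreover have "good_level H0 B0 Q' L'"
    unfolding good_level_def
  proof (intro conjI ballI allI impI finL' XQ')
    have "real Q' powr (3 - e) = Q' powr (-e) * real Q' powr 3"
      unfolding powr_add[symmetric] by (rule arg_cong[where f="\<lambda>e. real Q' powr e"]) simp
    also have "real Q' powr 3 = real Q' ^ 3" using Q1' by simp
    also have "Q' powr (-e) * real Q' ^ 3 \<le> cc * real Q' ^ 3" using Q' by (intro mult_right_mono) auto
    also have "\<dots> \<le> real (card (ch v0))" using N ch[OF v0] by simp
    also have "\<dots> \<le> real (card L')" using v0 finL' by (simp add: L'_def card_mono UN_upper)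
    finally show "real Q' powr (3 - e) \<le> real (card L')" .
  next
    fix u assume "u \<in> L'"
    then obtain v where v: "v \<in> L" "u \<in> ch v" by (auto simp: L'_def)
    note u = u'[OF v]
    show "q_ratio * Q' < real (fst u)" "fst u \<le> Q'" "rounded (fst u) (fst (snd u)) (snd (snd u))" using u by auto
    show "jbox u \<subseteq> B0" using u node[OF v(1)] by blast
    fix y q assume y: "y \<in> jbox u" and q: "H0 \<le> q \<and> q < fst u"
    show "well_approx_free q y"
    proof (cases "q < fst v")
      case True
      then show ?thesis using node[OF v(1)] y u q by blast
    next
      case False
      have "fst v \<ge> 1" using node[OF v(1)] XQ X0 by linarith
      then show ?thesis using node_free[OF XQ', of u "fst v" y q] u y q False by auto
    qed
  qed
  ultimately show ?thesis by blast
qed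

section \<open>Counting the nodes that meet a square\<close>

lemma jbox_center: "vector [cx u, cy u] \<in> jbox u"
  by (auto simp: jbox_def mem_sbox vector_2)

lemma level_sep:
  assumes G: "good_level H0 B0 Q L" and u: "u \<in> L" "u' \<in> L" "u \<noteq> u'"
  shows "sep_const * Q powr (-1 - \<sigma>1) \<le> \<bar>cx u - cx u'\<bar> \<or> sep_const * Q powr (-1 - \<sigma>2) \<le> \<bar>cy u - cy u'\<bar>"
proof -
  have XQ: "X0 \<le> q_ratio * Q" using G by (auto simp: good_level_def)
  have n: "1 \<le> fst w" "fst w \<le> Q" "rounded (fst w) (fst (snd w)) (snd (snd w))" if "w \<in> L" for w
  proof -
    have "q_ratio * Q < real (fst w)" "fst w \<le> Q" "rounded (fst w) (fst (snd w)) (snd (snd w))" using G that by (auto simp: good_level_def)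
    then show "1 \<le> fst w" "fst w \<le> Q" "rounded (fst w) (fst (snd w)) (snd (snd w))" using XQ X0(1) by linarith+
  qed
  show ?thesis
    using node_sep[OF n(3)[OF u(1)] n(3)[OF u(2)] n(1,2)[OF u(1)] n(1,2)[OF u(2)]] u(3)
    by (auto simp: cx_def cy_def prod_eq_iff)
qed

lemma level_radius:
  assumes G: "good_level H0 B0 Q L" and u: "u \<in> L" and y: "y \<in> jbox u"
  shows "\<bar>y $ 1 - cx u\<bar> \<le> K0 * Q powr (-1 - \<tau>1)" "\<bar>y $ 2 - cy u\<bar> \<le> K0 * Q powr (-1 - \<tau>2)"
proof -
  have "X0 \<le> q_ratio * Q" "q_ratio * Q < real (fst u)" using G u by (auto simp: good_level_def)
  then have "real (fst u) powr (-1 - \<tau>1) \<le> K0 * Q powr (-1 - \<tau>1)" "real (fst u) powr (-1 - \<tau>2) \<le> K0 * Q powr (-1 - \<tau>2)"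
    using jbox_radius_le tau by auto
  moreover have "0 \<le> real (fst u) powr (-1 - \<tau>1)" "0 \<le> real (fst u) powr (-1 - \<tau>2)" by auto
  ultimately show "\<bar>y $ 1 - cx u\<bar> \<le> K0 * Q powr (-1 - \<tau>1)" "\<bar>y $ 2 - cy u\<bar> \<le> K0 * Q powr (-1 - \<tau>2)"
    using y unfolding jbox_def mem_sbox by linarith+
qed

lemma level_disjoint:
  assumes G: "good_level H0 B0 Q L" and u: "u \<in> L" "u' \<in> L" "u \<noteq> u'"
  shows "jbox u \<inter> jbox u' = {}"
proof (rule ccontr)
  assume "\<not> ?thesis"
  then obtain y where y: "y \<in> jbox u" "y \<in> jbox u'" by blast
  have "X0 \<le> q_ratio * Q" using G by (auto simp: good_level_def)
  note Q = Q_large[OF this]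
  have "0 \<le> K0 * Q powr (-1 - \<tau>1)" "0 \<le> K0 * Q powr (-1 - \<tau>2)" using K0_ge1 by auto
  moreover have "4 * K0 * Q powr (-1 - \<tau>1) < sep_const * Q powr (-1 - \<sigma>1)" "4 * K0 * Q powr (-1 - \<tau>2) < sep_const * Q powr (-1 - \<sigma>2)"
    using X0(5,6)[OF Q(1)] by (auto simp: K0_def)
  ultimately show False
    using level_sep[OF G u] level_radius[OF G u(1) y(1)] level_radius[OF G u(2) y(2)] by linarith
qed

lemma meets_le:
  assumes G: "good_level H0 B0 Q L" and r: "r > 0"
  shows "real (meets L (sbox x y r r)) \<le>
    (1 + 2 * (r + K0 * Q powr (-1 - \<tau>1)) / (sep_const * Q powr (-1 - \<sigma>1))) * (1 + 2 * (r + K0 * Q powr (-1 - \<tau>2)) / (sep_const * Q powr (-1 - \<sigma>2)))"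
  unfolding meets_def
proof (rule packing(2)[where f = cx and g = cy and u = x and v = y])
  have "X0 \<le> q_ratio * Q" using G by (auto simp: good_level_def)
  note Q = Q_large[OF this]
  show "0 < sep_const * Q powr (-1 - \<sigma>1)" "0 < sep_const * Q powr (-1 - \<sigma>2)" using sep_const_pos Q by auto
  show "0 \<le> r + K0 * Q powr (-1 - \<tau>1)" "0 \<le> r + K0 * Q powr (-1 - \<tau>2)" using r K0_ge1 by auto
next
  fix s assume s: "s \<in> {u \<in> L. jbox u \<inter> sbox x y r r \<noteq> {}}"
  then obtain w where w: "w \<in> jbox s" "w \<in> sbox x y r r" by auto
  then show "\<bar>cx s - x\<bar> \<le> r + K0 * Q powr (-1 - \<tau>1) \<and> \<bar>cy s - y\<bar> \<le> r + K0 * Q powr (-1 - \<tau>2)"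
    using level_radius[OF G _ w(1)] s unfolding mem_sbox by auto
next
  fix s s' assume "s \<in> {u \<in> L. jbox u \<inter> sbox x y r r \<noteq> {}}" "s' \<in> {u \<in> L. jbox u \<inter> sbox x y r r \<noteq> {}}" "s \<noteq> s'"
  then show "sep_const * Q powr (-1 - \<sigma>1) \<le> \<bar>cx s - cx s'\<bar> \<or> sep_const * Q powr (-1 - \<sigma>2) \<le> \<bar>cy s - cy s'\<bar>"
    using level_sep[OF G] by auto
qed

text \<open>Parent boxes are disjoint, so no child has two parents and \<open>card L'\<close> is
  exactly N times \<open>card L\<close>. In the last bound, child centres are confined horizontally
  both by the square and by the parent box, whence the \<open>min\<close>; 2 r instead of r allows
  for the radius of the child box.\<close>

lemma child_counts:
  assumes G: "good_level H0 B0 Q L" and G': "good_level H0 B0 Q' L'" and ch: "child_level Q L Q' L'"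
  shows "\<exists>N. card L' = N * card L \<and> q_ratio\<^sup>2 / 16 * Q powr (-2 - \<tau>1 - \<tau>2) * real Q' ^ 3 \<le> real N \<and>
    (\<forall>S. meets L' S \<le> N * meets L S) \<and>
    (\<forall>x y r. K0 * Q' powr (-1 - \<tau>2) \<le> r \<longrightarrow> real (meets L' (sbox x y r r)) \<le> real (meets L (sbox x y r r)) *
      ((1 + 2 * min (2 * r) (K0 * Q powr (-1 - \<tau>1)) / (sep_const * Q' powr (-1 - \<sigma>1))) * (1 + 2 * (2 * r) / (sep_const * Q' powr (-1 - \<sigma>2)))))"
proof -
  obtain ch N where L': "L' = (\<Union>v\<in>L. ch v)" and ch': "\<And>v. v \<in> L \<Longrightarrow> finite (ch v) \<and> card (ch v) = N \<and> (\<forall>u\<in>ch v. jbox u \<subseteq> jbox v)"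
    and N: "q_ratio\<^sup>2 / 16 * Q powr (-2 - \<tau>1 - \<tau>2) * real Q' ^ 3 \<le> real N"
    using ch unfolding child_level_def by blast
  have finL: "finite L" using G by (auto simp: good_level_def)
  have sub: "u \<in> L'" if "v \<in> L" "u \<in> ch v" for u v using that L' by auto
  have disj: "ch v \<inter> ch v' = {}" if "v \<in> L" "v' \<in> L" "v \<noteq> v'" for v v'
  proof (rule ccontr)
    assume "\<not> ?thesis"
    then obtain u where u: "u \<in> ch v" "u \<in> ch v'" by blast
    then have "jbox u \<subseteq> jbox v \<inter> jbox v'" using ch' that by blast
    then show False using jbox_center[of u] level_disjoint[OF G that] by blast
  qed
  have card': "card L' = N * card L"
  proof -
    have "card L' = (\<Sum>v\<in>L. card (ch v))" unfolding L' using finL ch' disj by (intro card_UN_disjoint) auto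
    then show ?thesis using ch' by simp
  qed
  have split: "meets L' S \<le> (\<Sum>v\<in>{v\<in>L. jbox v \<inter> S \<noteq> {}}. card {u \<in> ch v. jbox u \<inter> S \<noteq> {}})" for S
  proof -
    have "{u \<in> L'. jbox u \<inter> S \<noteq> {}} \<subseteq> (\<Union>v\<in>{v\<in>L. jbox v \<inter> S \<noteq> {}}. {u \<in> ch v. jbox u \<inter> S \<noteq> {}})"
    proof
      fix u assume u: "u \<in> {u \<in> L'. jbox u \<inter> S \<noteq> {}}"
      then obtain v where v: "v \<in> L" "u \<in> ch v" unfolding L' by blast
      then have "jbox u \<subseteq> jbox v" using ch' by blast
      then show "u \<in> (\<Union>v\<in>{v\<in>L. jbox v \<inter> S \<noteq> {}}. {u \<in> ch v. jbox u \<inter> S \<noteq> {}})" using u v by blast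
    qed
    then have "meets L' S \<le> card (\<Union>v\<in>{v\<in>L. jbox v \<inter> S \<noteq> {}}. {u \<in> ch v. jbox u \<inter> S \<noteq> {}})"
      unfolding meets_def using finL ch' by (intro card_mono) auto
    also have "\<dots> \<le> (\<Sum>v\<in>{v\<in>L. jbox v \<inter> S \<noteq> {}}. card {u \<in> ch v. jbox u \<inter> S \<noteq> {}})"
      using finL by (intro card_UN_le) auto
    finally show ?thesis .
  qed
  have "meets L' S \<le> N * meets L S" for S
  proof -
    have "(\<Sum>v\<in>{v\<in>L. jbox v \<inter> S \<noteq> {}}. card {u \<in> ch v. jbox u \<inter> S \<noteq> {}}) \<le> (\<Sum>v\<in>{v\<in>L. jbox v \<inter> S \<noteq> {}}. N)"
    proof (rule sum_mono)
      fix v assume v: "v \<in> {v\<in>L. jbox v \<inter> S \<noteq> {}}"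
      then have "card {u \<in> ch v. jbox u \<inter> S \<noteq> {}} \<le> card (ch v)" using ch' by (intro card_mono) auto
      then show "card {u \<in> ch v. jbox u \<inter> S \<noteq> {}} \<le> N" using ch' v by auto
    qed
    then show ?thesis using split[of S] by (simp add: meets_def mult.commute)
  qed
  moreover have "real (meets L' (sbox x y r r)) \<le> real (meets L (sbox x y r r)) *
      ((1 + 2 * min (2 * r) (K0 * Q powr (-1 - \<tau>1)) / (sep_const * Q' powr (-1 - \<sigma>1))) * (1 + 2 * (2 * r) / (sep_const * Q' powr (-1 - \<sigma>2))))"
    if r: "K0 * Q' powr (-1 - \<tau>2) \<le> r" for x y r
  proof -
    let ?S = "sbox x y r r"
    have XQ': "X0 \<le> q_ratio * Q'" using G' by (auto simp: good_level_def)
    note Q1' = Q_large[OF XQ']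
    have D: "0 < sep_const * Q' powr (-1 - \<sigma>1)" "0 < sep_const * Q' powr (-1 - \<sigma>2)" using sep_const_pos Q1' by auto
    have r0: "r > 0" using r K0_ge1 Q1' by (intro order.strict_trans2[OF _ r]) auto
    have A0: "0 \<le> K0 * Q powr (-1 - \<tau>1)" using K0_ge1 by auto
    have r1: "K0 * Q' powr (-1 - \<tau>1) \<le> r"
    proof -
      have "K0 * Q' powr (-1 - \<tau>1) \<le> K0 * Q' powr (-1 - \<tau>2)"
        using K0_ge1 Q1' tau by (intro mult_left_mono powr_mono) auto
      then show ?thesis using r by linarith
    qed
    have per: "real (card {u \<in> ch v. jbox u \<inter> ?S \<noteq> {}}) \<le> (1 + 2 * min (2 * r) (K0 * Q powr (-1 - \<tau>1)) / (sep_const * Q' powr (-1 - \<sigma>1))) * (1 + 2 * (2 * r) / (sep_const * Q' powr (-1 - \<sigma>2)))"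
      if v: "v \<in> L" for v
    proof -
      let ?T = "{u \<in> ch v. jbox u \<inter> ?S \<noteq> {}}"
      have near: "\<bar>cx s - x\<bar> \<le> 2 * r \<and> \<bar>cy s - y\<bar> \<le> 2 * r" if s: "s \<in> ?T" for s
      proof -
        obtain w where w: "w \<in> jbox s" "w \<in> ?S" using s by auto
        have "s \<in> L'" using s v sub by auto
        then have "\<bar>w $ 1 - cx s\<bar> \<le> r" "\<bar>w $ 2 - cy s\<bar> \<le> r"
          using level_radius[OF G' _ w(1)] r r1 by (blast intro: order.trans)+
        then show ?thesis using w(2) unfolding mem_sbox by linarith
      qed
      have par: "\<bar>cx s - cx v\<bar> \<le> K0 * Q powr (-1 - \<tau>1)" if s: "s \<in> ?T" for s
      proof -
        have "s \<in> L'" using s v sub by auto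
        then have "vector [cx s, cy s] \<in> jbox v" using jbox_center[of s] ch'[OF v] s by blast
        from level_radius(1)[OF G v this] show ?thesis by (simp add: vector_2)
      qed
      have sep: "sep_const * Q' powr (-1 - \<sigma>1) \<le> \<bar>cx s - cx s'\<bar> \<or> sep_const * Q' powr (-1 - \<sigma>2) \<le> \<bar>cy s - cy s'\<bar>"
        if "s \<in> ?T" "s' \<in> ?T" "s \<noteq> s'" for s s'
        using level_sep[OF G'] that sub[OF v] by auto
      have 1: "real (card ?T) \<le> (1 + 2 * (2 * r) / (sep_const * Q' powr (-1 - \<sigma>1))) * (1 + 2 * (2 * r) / (sep_const * Q' powr (-1 - \<sigma>2)))"
        by (rule packing(2)[where f = cx and g = cy, OF D _ _ near sep]) (use r0 in auto)
      have 2: "real (card ?T) \<le> (1 + 2 * (K0 * Q powr (-1 - \<tau>1)) / (sep_const * Q' powr (-1 - \<sigma>1))) * (1 + 2 * (2 * r) / (sep_const * Q' powr (-1 - \<sigma>2)))"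
        by (rule packing(2)[where f = cx and g = cy and u = "cx v" and v = y, OF D _ _ _ sep]) (use r0 A0 near par in auto)
      show ?thesis
      proof (cases "2 * r \<le> K0 * Q powr (-1 - \<tau>1)")
        case True
        then show ?thesis using 1 by (simp only: min_absorb1)
      next
        case False
        then have "min (2 * r) (K0 * Q powr (-1 - \<tau>1)) = K0 * Q powr (-1 - \<tau>1)" by simp
        then show ?thesis using 2 by (simp only:)
      qed
    qed
    have "real (meets L' ?S) \<le> (\<Sum>v\<in>{v\<in>L. jbox v \<inter> ?S \<noteq> {}}. real (card {u \<in> ch v. jbox u \<inter> ?S \<noteq> {}}))"
      unfolding of_nat_sum[symmetric] of_nat_le_iff by (rule split)
    also have "\<dots> \<le> (\<Sum>v\<in>{v\<in>L. jbox v \<inter> ?S \<noteq> {}}. (1 + 2 * min (2 * r) (K0 * Q powr (-1 - \<tau>1)) / (sep_const * Q' powr (-1 - \<sigma>1))) * (1 + 2 * (2 * r) / (sep_const * Q' powr (-1 - \<sigma>2))))"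
      by (intro sum_mono per) auto
    finally show ?thesis by (simp add: meets_def)
  qed
  ultimately show ?thesis using card' N by blast
qed

end

section \<open>Mass of squares and the dimension of the Cantor set\<close>

context cantor_setup
begin

lemma inv_powr: "y / (sep_const * x powr (-1 - s)) = y * x powr (1 + s) / sep_const" if "x > 0" for x y s :: real
proof -
  have "x powr (-1 - s) = 1 / x powr (1 + s)"
    using powr_minus_divide[of x "1 + s"] by simp
  then show ?thesis by simp
qed

text \<open>These are the radii between two successive levels. Up to 1/Q' the nodes of the new level
  are counted directly. Beyond 1/Q' the children of one parent that are met number at most a
  constant times area times Q'^3, and the count goes parent by parent.\<close>

lemma scale_bound:
  assumes G: "good_level H0 B0 Q L" and G': "good_level H0 B0 Q' L'" and ch: "child_level Q L Q' L'"
    and r: "K0 * Q' powr (-1 - \<tau>2) \<le> r" "r \<le> K0 * Q powr (-1 - \<tau>2)"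
  shows "real (meets L' (sbox x y r r)) \<le> r powr T * card L'"
proof -
  have XQ: "X0 \<le> q_ratio * Q" and XQ': "X0 \<le> q_ratio * Q'" using G G' by (auto simp: good_level_def)
  note Q1 = Q_large[OF XQ] and Q1' = Q_large[OF XQ']
  have Qp: "real Q > 0" "real Q' > 0" using Q1 Q1' by auto
  have cL: "real Q powr (3 - e) \<le> card L" "real Q' powr (3 - e) \<le> card L'" using G G' by (auto simp: good_level_def)
  have "K0 * Q' powr (-1 - \<tau>2) > 0" using K0_ge1 Qp by (intro mult_pos_pos) auto
  then have r0: "r > 0" using r by linarith
  let ?d1 = "sep_const * Q' powr (-1 - \<sigma>1)" and ?d2 = "sep_const * Q' powr (-1 - \<sigma>2)"
  have D': "?d1 > 0" "?d2 > 0" using sep_const_pos Qp by auto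
  have r1: "K0 * Q' powr (-1 - \<tau>1) \<le> r"
  proof -
    have "K0 * Q' powr (-1 - \<tau>1) \<le> K0 * Q' powr (-1 - \<tau>2)"
      using K0_ge1 Q1' tau by (intro mult_left_mono powr_mono) auto
    then show ?thesis using r by linarith
  qed
  show ?thesis
  proof (cases "r \<le> 1 / Q'")
    case True
    have "real (meets L' (sbox x y r r)) \<le> (1 + 2 * (r + K0 * Q' powr (-1 - \<tau>1)) / ?d1) * (1 + 2 * (r + K0 * Q' powr (-1 - \<tau>2)) / ?d2)"
      by (rule meets_le[OF G' r0])
    also have "\<dots> \<le> (1 + 4 * r / ?d1) * (1 + 4 * r / ?d2)"
    proof -
      have "1 + 2 * (x + y) / d \<le> 1 + 4 * x / d" if "y \<le> x" "d > 0" for x y d :: real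
      proof -
        have "2 * (x + y) \<le> 4 * x" using that by simp
        then have "2 * (x + y) / d \<le> 4 * x / d" using that(2) by (rule divide_right_mono[OF _ less_imp_le])
        then show ?thesis by simp
      qed
      note this[OF r1 D'(1)] this[OF r(1) D'(2)]
      then show ?thesis using r0 D' K0_ge1 by (intro mult_mono) auto
    qed
    also have "\<dots> = (1 + 4 * r * Q' powr (1 + \<sigma>1) / sep_const) * (1 + 4 * r * Q' powr (1 + \<sigma>2) / sep_const)"
      by (simp only: inv_powr[OF Qp(2)])
    also have "\<dots> \<le> r powr T * real Q' powr (3 - e)"
      by (rule growth_I[OF Q1'(1) r(1) True])
    also have "\<dots> \<le> r powr T * card L'" using cL by (intro mult_left_mono) auto
    finally show ?thesis .
  next
    case False
    then have rQ: "1 / Q' \<le> r" by simp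
    let ?A = "K0 * Q powr (-1 - \<tau>1)" and ?B = "K0 * Q powr (-1 - \<tau>2)"
    let ?m = "min r ?A" and ?w = "1 + r * Q powr (1 + \<sigma>1)"
    obtain N where N: "card L' = N * card L" "q_ratio\<^sup>2 / 16 * Q powr (-2 - \<tau>1 - \<tau>2) * real Q' ^ 3 \<le> real N"
      and cnt: "real (meets L' (sbox x y r r)) \<le> real (meets L (sbox x y r r)) * ((1 + 2 * min (2 * r) ?A / ?d1) * (1 + 2 * (2 * r) / ?d2))"
      using child_counts[OF G G' ch] r(1) by blast
    have A0: "?A > 0" using K0_ge1 Qp by (intro mult_pos_pos) auto
    have m0: "?m > 0" using A0 r0 by simp
    have w0: "?w > 0" using r0 by (simp add: add_pos_nonneg)
    have small: "4 * ?A < sep_const * Q powr (-1 - \<sigma>1)" "4 * ?B < sep_const * Q powr (-1 - \<sigma>2)"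
      using X0(5,6)[OF Q1(1)] by (auto simp: K0_def)
    have D: "sep_const * Q powr (-1 - \<sigma>1) > 0" "sep_const * Q powr (-1 - \<sigma>2) > 0" using sep_const_pos Qp by auto
    \<comment> \<open>The radius is at most K0 Q^(-1-\<tau>2), well below the vertical separation of
      the parents, so the vertical factor is at most 2 and only the horizontal one depends on
      r.\<close>
    have parent: "real (meets L (sbox x y r r)) \<le> 4 / sep_const * ?w"
    proof -
      have "1 + 2 * (r + ?A) / (sep_const * Q powr (-1 - \<sigma>1)) \<le> 2 / sep_const * ?w"
      proof -
        have "2 * ?A / (sep_const * Q powr (-1 - \<sigma>1)) \<le> 1" using small D by (simp add: divide_le_eq)
        then have "1 + 2 * (r + ?A) / (sep_const * Q powr (-1 - \<sigma>1)) \<le> 2 + 2 * r / (sep_const * Q powr (-1 - \<sigma>1))"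
          by (simp add: add_divide_distrib distrib_left)
        also have "\<dots> = 2 + 2 * r * Q powr (1 + \<sigma>1) / sep_const" by (simp only: inv_powr[OF Qp(1)])
        also have "\<dots> \<le> 2 / sep_const + 2 * r * Q powr (1 + \<sigma>1) / sep_const" using sep_const_pos by (simp add: field_simps)
        also have "\<dots> = 2 / sep_const * ?w" by (simp add: add_divide_distrib distrib_left)
        finally show ?thesis .
      qed
      moreover have "1 + 2 * (r + ?B) / (sep_const * Q powr (-1 - \<sigma>2)) \<le> 2"
      proof -
        have "2 * (r + ?B) \<le> sep_const * Q powr (-1 - \<sigma>2)" using small r(2) unfolding distrib_left by linarith
        then show ?thesis using D by (simp add: divide_le_eq)
      qed
      ultimately have "(1 + 2 * (r + ?A) / (sep_const * Q powr (-1 - \<sigma>1))) * (1 + 2 * (r + ?B) / (sep_const * Q powr (-1 - \<sigma>2))) \<le> (2 / sep_const * ?w) * 2"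
        using r0 K0_ge1 D sep_const_pos w0 by (intro mult_mono) auto
      then show ?thesis using meets_le[OF G r0, of x y] by simp
    qed
    let ?Y1 = "Q' powr (1 + \<sigma>1)" and ?Y2 = "Q' powr (1 + \<sigma>2)"
    have one: "1 \<le> b * Q' powr (1 + s)" if "1 / Q' \<le> b" "s > 0" for b s
    proof -
      have "1 = 1 / Q' * real Q' powr 1" using Qp by simp
      also have "\<dots> \<le> b * Q' powr (1 + s)" using that Q1' order.trans[OF _ that(1)] by (intro mult_mono powr_mono) auto
      finally show ?thesis .
    qed
    have AQ: "1 / Q' \<le> ?A"
    proof -
      have big: "8 * Q powr (1 + \<tau>1) \<le> q_ratio * Q'" using ch by (auto simp: child_level_def)
      have "1 * real Q powr (1 + \<tau>1) \<le> 8 * Q powr (1 + \<tau>1)" by (intro mult_right_mono) auto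
      also note big
      also have "q_ratio * Q' \<le> 1 * real Q'" using q_ratio_pos by (intro mult_right_mono) auto
      finally have "1 / Q' \<le> 1 / Q powr (1 + \<tau>1)" using Qp by (intro divide_left_mono) auto
      also have "\<dots> = 1 * Q powr (-1 - \<tau>1)" using powr_minus_divide[of "real Q" "1 + \<tau>1"] by simp
      also have "\<dots> \<le> ?A" using K0_ge1 by (intro mult_right_mono) auto
      finally show ?thesis .
    qed
    \<comment> \<open>Both sides of the region are at least 1/Q', so the summands 1 in the packing
      bound are absorbed: side times Q'^(1+\<sigma>i) is at least 1.\<close>
    have child: "(1 + 2 * min (2 * r) ?A / ?d1) * (1 + 2 * (2 * r) / ?d2) \<le> 25 / sep_const ^ 2 * (?m * r * real Q' ^ 3)"
    proof -
      have "2 * min (2 * r) ?A \<le> 4 * ?m" using A0 r0 by (auto simp: min_def)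
      then have "1 + 2 * min (2 * r) ?A / ?d1 \<le> 1 + 4 * ?m / ?d1" using D' by (intro add_left_mono divide_right_mono) auto
      also have "\<dots> = 1 + 4 * ?m * ?Y1 / sep_const" by (simp only: inv_powr[OF Qp(2)])
      also have "\<dots> \<le> ?m * ?Y1 / sep_const + 4 * ?m * ?Y1 / sep_const"
      proof -
        have "1 \<le> ?m * ?Y1" using one[of ?m \<sigma>1] rQ AQ sigma by auto
        then have "1 \<le> ?m * ?Y1 / sep_const" using sep_const_pos by (simp add: pos_le_divide_eq)
        then show ?thesis by (rule add_right_mono)
      qed
      also have "\<dots> = 5 / sep_const * (?m * ?Y1)" by (simp add: field_simps)
      finally have 1: "1 + 2 * min (2 * r) ?A / ?d1 \<le> 5 / sep_const * (?m * ?Y1)" .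
      have "1 + 2 * (2 * r) / ?d2 = 1 + 2 * (2 * r) * ?Y2 / sep_const" by (simp only: inv_powr[OF Qp(2)])
      also have "\<dots> \<le> r * ?Y2 / sep_const + 2 * (2 * r) * ?Y2 / sep_const"
      proof -
        have "1 \<le> r * ?Y2" using one[of r \<sigma>2] rQ sigma by auto
        then have "1 \<le> r * ?Y2 / sep_const" using sep_const_pos by (simp add: pos_le_divide_eq)
        then show ?thesis by (rule add_right_mono)
      qed
      also have "\<dots> = 5 / sep_const * (r * ?Y2)" by (simp add: field_simps)
      finally have 2: "1 + 2 * (2 * r) / ?d2 \<le> 5 / sep_const * (r * ?Y2)" .
      have "(1 + 2 * min (2 * r) ?A / ?d1) * (1 + 2 * (2 * r) / ?d2) \<le> (5 / sep_const * (?m * ?Y1)) * (5 / sep_const * (r * ?Y2))"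
        using 1 2 m0 r0 D' sep_const_pos by (intro mult_mono) auto
      also have "\<dots> = 25 / sep_const ^ 2 * (?m * r * (?Y1 * ?Y2))" by (simp add: power2_eq_square)
      also have "?Y1 * ?Y2 = real Q' ^ 3"
      proof -
        have "?Y1 * ?Y2 = real Q' powr 3"
          unfolding powr_add[symmetric] by (rule arg_cong[where f="\<lambda>e. real Q' powr e"]) (use sigma in simp)
        then show ?thesis using Qp by simp
      qed
      finally show ?thesis .
    qed
    have "real (meets L' (sbox x y r r)) \<le> (4 / sep_const * ?w) * (25 / sep_const ^ 2 * (?m * r * real Q' ^ 3))"
      using m0 r0 w0 sep_const_pos D' A0
      by (intro order.trans[OF cnt] mult_mono parent child) auto
    \<comment> \<open>1600 = 4 * 25 * 16, where 16 cancels the 1/16 in the lower bound for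
      N.\<close>
    also have "\<dots> = (1600 / (sep_const ^ 3 * q_ratio ^ 2) * (?w * ?m * r)) * (q_ratio\<^sup>2 / 16 * real Q' ^ 3)"
      using q_ratio_pos by (simp add: power2_eq_square power3_eq_cube)
    also have "\<dots> \<le> (K1 * (?w * ?m * r)) * (q_ratio\<^sup>2 / 16 * real Q' ^ 3)"
    proof -
      have "1600 * 1 \<le> 6000 * K0 ^ 2" using K0_ge1 one_le_power[of K0 2] by linarith
      then have "1600 / (sep_const ^ 3 * q_ratio ^ 2) \<le> K1" unfolding K1_def using sep_const_pos q_ratio_pos by (intro divide_right_mono) auto
      then show ?thesis using w0 m0 r0 by (intro mult_right_mono) auto
    qed
    \<comment> \<open>The inserted exponents add up to 0; regrouped, they complete
      \<open>growth_II\<close>, the lower bound for N and the one for \<open>card L\<close>.\<close>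
    also have "\<dots> = (K1 * ?w * ?m * r * (Q powr (-1 + \<tau>1 + \<tau>2 + e) * Q powr (-2 - \<tau>1 - \<tau>2) * Q powr (3 - e))) * (q_ratio\<^sup>2 / 16 * real Q' ^ 3)"
    proof -
      have "Q powr (-1 + \<tau>1 + \<tau>2 + e) * Q powr (-2 - \<tau>1 - \<tau>2) * Q powr (3 - e) = Q powr 0"
        unfolding powr_add[symmetric] by (rule arg_cong[where f="\<lambda>e. real Q powr e"]) simp
      then show ?thesis using Qp by (simp add: mult.assoc)
    qed
    also have "\<dots> = (K1 * ?w * ?m * r * Q powr (-1 + \<tau>1 + \<tau>2 + e)) * ((q_ratio\<^sup>2 / 16 * Q powr (-2 - \<tau>1 - \<tau>2) * real Q' ^ 3) * Q powr (3 - e))"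
      by (simp only: ac_simps)
    also have "\<dots> \<le> r powr T * (real N * real (card L))"
      using growth_II[OF Q1(1) r0 r(2)] N(2) cL(1) by (intro mult_mono) auto
    finally show ?thesis by (simp add: N(1))
  qed
qed

text \<open>The proportion of nodes meeting a square does not increase with the level, so a bound at
  one suitable level persists. Balls covering a late level meet all its nodes, which makes their sum
  of r^s at least 1 for every 0 <= s < T.\<close>

lemma cantor_set:
  fixes Qs :: "nat \<Rightarrow> nat"
  assumes G: "\<And>n. good_level H0 B0 (Qs n) (Ls n)" and ch: "\<And>n. child_level (Qs n) (Ls n) (Qs (Suc n)) (Ls (Suc n))"
  defines "D \<equiv> (\<Inter>n. \<Union>u\<in>Ls n. jbox u)"
  shows "D \<subseteq> B0" "ereal T \<le> hausdorff_dim D"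
    and "\<And>y. y \<in> D \<Longrightarrow> H0 \<le> q \<Longrightarrow> well_approx_free q y"
    and "\<And>y. y \<in> D \<Longrightarrow> \<exists>q'\<ge>q. \<exists>p1 p2. q' > 0 \<and> \<bar>real q' * y $ 1 - of_int p1\<bar> < q' powr (-\<tau>1) \<and> \<bar>real q' * y $ 2 - of_int p2\<bar> < q' powr (-\<tau>2)"
proof -
  have XQ: "X0 \<le> q_ratio * Qs n" for n using G[of n] by (auto simp: good_level_def)
  note Q1 = Q_large[OF XQ]
  have step: "Qs n < Qs (Suc n)" for n
  proof -
    have big: "8 * Qs n powr (1 + \<tau>1) \<le> q_ratio * Qs (Suc n)" using ch by (auto simp: child_level_def)
    have "2 * real (Qs n) powr 1 \<le> 8 * Qs n powr (1 + \<tau>1)" using Q1[of n] tau by (intro mult_mono powr_mono) auto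
    also note big
    also have "q_ratio * Qs (Suc n) \<le> 1 * real (Qs (Suc n))" using q_ratio_pos by (intro mult_right_mono) auto
    finally show ?thesis using Q1[of n] by simp
  qed
  have Qn: "n \<le> Qs n" for n
    by (induction n) (use step in \<open>auto simp: Suc_le_eq intro: le_less_trans\<close>)
  let ?D = "\<lambda>n. \<Union>u\<in>Ls n. jbox u"
  have fin: "finite (Ls n)" for n using G[of n] by (auto simp: good_level_def)
  have cpos: "card (Ls n) > 0" for n
  proof -
    have "0 < real (Qs n) powr (3 - e)" using Q1[of n] by simp
    also have "\<dots> \<le> card (Ls n)" using G[of n] by (auto simp: good_level_def)
    finally show ?thesis by simp
  qed
  have node: "q_ratio * Qs n < real (fst u)" "fst u \<le> Qs n" "jbox u \<subseteq> B0" "y \<in> jbox u \<Longrightarrow> H0 \<le> q \<Longrightarrow> q < fst u \<Longrightarrow> well_approx_free q y"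
    if "u \<in> Ls n" for n u y q
    using G[of n] that by (auto simp: good_level_def)
  have ex_large: "\<exists>n. q \<le> q_ratio * Qs n" for q :: real
  proof -
    obtain n :: nat where "q / q_ratio \<le> n" using real_arch_simple by blast
    then have "q / q_ratio \<le> Qs n" using Qn[of n] by linarith
    then show ?thesis using q_ratio_pos by (intro exI[of _ n]) (simp add: field_simps)
  qed
  have at: "\<exists>u\<in>Ls n. y \<in> jbox u" if "y \<in> D" for y n using that by (auto simp: D_def)
  show "D \<subseteq> B0" using at[of _ 0] node(3)[of _ 0] by blast
  show "well_approx_free q y" if y: "y \<in> D" "H0 \<le> q" for y
  proof -
    obtain n where n: "real q \<le> q_ratio * Qs n" using ex_large by blast
    obtain u where u: "u \<in> Ls n" "y \<in> jbox u" using at[OF y(1)] by blast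
    have "q < fst u" using node(1)[OF u(1)] n by linarith
    then show ?thesis using node(4)[OF u] y by blast
  qed
  show "\<exists>q'\<ge>q. \<exists>p1 p2. q' > 0 \<and> \<bar>real q' * y $ 1 - of_int p1\<bar> < q' powr (-\<tau>1) \<and> \<bar>real q' * y $ 2 - of_int p2\<bar> < q' powr (-\<tau>2)" if y: "y \<in> D" for y
  proof -
    obtain n where n: "real q \<le> q_ratio * Qs n" using ex_large by blast
    obtain u where u: "u \<in> Ls n" "y \<in> jbox u" using at[OF y(1)] by blast
    have a: "q < fst u" "0 < real (fst u)" using node(1)[OF u(1)] n by linarith+
    have "\<bar>fst u * x - of_int p\<bar> < fst u powr (-t)" if "\<bar>x - of_int p / fst u\<bar> \<le> 3/4 * real (fst u) powr (-1 - t)" for x t :: real and p :: int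
    proof -
      have "real (fst u) * x - of_int p = real (fst u) * (x - of_int p / fst u)" using a by (simp add: field_simps)
      then have "\<bar>fst u * x - of_int p\<bar> = real (fst u) * \<bar>x - of_int p / fst u\<bar>" by (simp add: abs_mult)
      also have "\<dots> \<le> real (fst u) * (3/4 * real (fst u) powr (-1 - t))" using that by (intro mult_left_mono) auto
      also have "\<dots> = 3/4 * fst u powr (-t)" using a by (simp add: powr_diff powr_minus_divide)
      also have "\<dots> < fst u powr (-t)" using a by simp
      finally show ?thesis .
    qed
    from this[of "y $ 1" "fst (snd u)" \<tau>1] this[of "y $ 2" "snd (snd u)" \<tau>2]
    have "\<bar>real (fst u) * y $ 1 - of_int (fst (snd u))\<bar> < fst u powr (-\<tau>1)" "\<bar>real (fst u) * y $ 2 - of_int (snd (snd u))\<bar> < fst u powr (-\<tau>2)"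
      using u(2) unfolding jbox_def mem_sbox cx_def cy_def by auto
    moreover have "q \<le> fst u" "fst u > 0" using a by auto
    ultimately show ?thesis by blast
  qed
  have dec: "?D (Suc n) \<subseteq> ?D n" for n
    using ch[of n] unfolding child_level_def by blast
  have comp: "compact (?D n)" for n using fin by (intro compact_UN) (auto simp: jbox_def compact_sbox)
  define b where "b = (\<lambda>n. K0 * Qs n powr (-1 - \<tau>2))"
  have b0: "b n > 0" for n using K0_ge1 Q1[of n] by (auto simp: b_def intro!: mult_pos_pos)
  have b_small: "\<exists>n. b n \<le> r" if "r > 0" for r
  proof -
    obtain n :: nat where n: "K0 / r \<le> n" using real_arch_simple by blast
    have "b n \<le> K0 * real (Qs n) powr (-1)" unfolding b_def using K0_ge1 Q1[of n] tau by (intro mult_left_mono powr_mono) auto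
    also have "\<dots> = K0 / Qs n" using Q1[of n] by (simp add: powr_minus_divide)
    also have "\<dots> \<le> r"
    proof -
      have "K0 / r \<le> Qs n" using n Qn[of n] by linarith
      then show ?thesis using that Q1[of n] by (simp add: field_simps)
    qed
    finally show ?thesis by blast
  qed
  have mono: "meets (Ls K) S * card (Ls n) \<le> meets (Ls n) S * card (Ls K)" if "n \<le> K" for n K S
    using that
  proof (induction K rule: dec_induct)
    case (step K)
    obtain N where N: "card (Ls (Suc K)) = N * card (Ls K)" "meets (Ls (Suc K)) S \<le> N * meets (Ls K) S"
      using child_counts[OF G G ch] by blast
    have "meets (Ls (Suc K)) S * card (Ls n) \<le> N * meets (Ls K) S * card (Ls n)" using N(2) by (rule mult_right_mono) simp
    also have "\<dots> \<le> N * (meets (Ls n) S * card (Ls K))" using step.IH by (simp add: mult.assoc)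
    finally show ?case using N(1) by (simp add: ac_simps)
  qed simp
  have ball_mass: "\<exists>n. \<forall>K\<ge>n. real (meets (Ls K) (sbox x y r r)) \<le> r powr T * card (Ls K)" if r: "0 < r" "r < b 0" for x y r
  proof -
    \<comment> \<open>This is the first level whose scale b is at most r. It is not level 0 because
      r < b 0, and the level before it gives the upper bound on r for
      \<open>scale_bound\<close>.\<close>
    define m where "m = (LEAST m. b m \<le> r)"
    have bm: "b m \<le> r" unfolding m_def using b_small[OF r(1)] by (rule LeastI_ex)
    then obtain n where mn: "m = Suc n" using r by (cases m) auto
    have nb: "\<not> b n \<le> r" using not_less_Least[of n "\<lambda>m. b m \<le> r"] mn m_def by auto
    have B: "real (meets (Ls m) (sbox x y r r)) \<le> r powr T * card (Ls m)"
      unfolding mn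
    proof (rule scale_bound[OF G[of n] G[of "Suc n"] ch[of n]])
      show "K0 * Qs (Suc n) powr (-1 - \<tau>2) \<le> r" using bm unfolding mn b_def .
      show "r \<le> K0 * Qs n powr (-1 - \<tau>2)" using nb unfolding b_def by (rule less_imp_le[OF not_le_imp_less])
    qed
    have "real (meets (Ls K) (sbox x y r r)) \<le> r powr T * card (Ls K)" if "m \<le> K" for K
    proof -
      have "real (meets (Ls K) (sbox x y r r)) * card (Ls m) \<le> real (meets (Ls m) (sbox x y r r)) * card (Ls K)"
        using mono[OF that] by (metis of_nat_le_iff of_nat_mult)
      also have "\<dots> \<le> (r powr T * card (Ls m)) * card (Ls K)" using B by (intro mult_right_mono) auto
      finally have "real (meets (Ls K) (sbox x y r r)) * card (Ls m) \<le> (r powr T * card (Ls K)) * card (Ls m)" by (simp add: ac_simps)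
      then show ?thesis using cpos[of m] by (simp add: mult_le_cancel_right)
    qed
    then show ?thesis by blast
  qed
  show "ereal T \<le> hausdorff_dim D"
    unfolding hausdorff_dim_def
  proof (rule INF_greatest, rule ccontr)
    fix s assume s: "s \<in> {s. 0 \<le> s \<and> hausdorff_measure s D = 0}" and "\<not> ereal T \<le> ereal s"
    then have sT: "0 \<le> s" "s < T" and H: "hausdorff_measure s D = 0" by auto
    have "hausdorff_measure s D \<noteq> 0"
      unfolding D_def
    \<comment> \<open>Radii below 1 give r^T <= r^s for s < T, and radii below b 0 lie in the range
      of the levels.\<close>
    proof (rule mass_distribution[where D = ?D and \<kappa> = 1 and ?r0.0 = "min 1 (b 0)", OF comp dec])
      show "0 < min 1 (b 0)" using b0 by simp
      fix I :: "nat set" and x :: "nat \<Rightarrow> real ^ 2" and r :: "nat \<Rightarrow> real"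
      assume I: "finite I" and r: "\<forall>i\<in>I. 0 < r i \<and> r i < min 1 (b 0)"
        and cov: "\<forall>\<^sub>F n in sequentially. ?D n \<subseteq> (\<Union>i\<in>I. ball (x i) (r i))"
      let ?S = "\<lambda>i. sbox (x i $ 1) (x i $ 2) (r i) (r i)"
      have "\<forall>\<^sub>F K in sequentially. \<forall>i\<in>I. real (meets (Ls K) (?S i)) \<le> r i powr T * card (Ls K)"
      proof (intro eventually_ball_finite I ballI)
        fix i assume "i \<in> I"
        then have "0 < r i" "r i < b 0" using r by auto
        then show "\<forall>\<^sub>F K in sequentially. real (meets (Ls K) (?S i)) \<le> r i powr T * card (Ls K)"
          unfolding eventually_sequentially by (rule ball_mass)
      qed
      then have "\<forall>\<^sub>F K in sequentially. (\<forall>i\<in>I. real (meets (Ls K) (?S i)) \<le> r i powr T * card (Ls K)) \<and> ?D K \<subseteq> (\<Union>i\<in>I. ball (x i) (r i))"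
        using cov by (rule eventually_conj)
      from eventually_happens'[OF sequentially_bot this]
      obtain K where K: "\<forall>i\<in>I. real (meets (Ls K) (?S i)) \<le> r i powr T * card (Ls K)" "?D K \<subseteq> (\<Union>i\<in>I. ball (x i) (r i))"
        by (elim exE conjE)
      have ball: "ball (x i) (r i) \<subseteq> ?S i" for i
      proof
        fix y assume "y \<in> ball (x i) (r i)"
        then have "dist (x i) y < r i" by simp
        then have "dist (x i $ 1) (y $ 1) \<le> r i" "dist (x i $ 2) (y $ 2) \<le> r i"
          using dist_vec_nth_le[of "x i" 1 y] dist_vec_nth_le[of "x i" 2 y] by linarith+
        then show "y \<in> ?S i" by (simp add: mem_sbox dist_real_def abs_minus_commute)
      qed
      have "Ls K \<subseteq> (\<Union>i\<in>I. {u \<in> Ls K. jbox u \<inter> ?S i \<noteq> {}})"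
      proof
        fix u assume u: "u \<in> Ls K"
        have c: "vector [cx u, cy u] \<in> jbox u" by (rule jbox_center)
        then obtain i where "i \<in> I" "vector [cx u, cy u] \<in> ball (x i) (r i)" using K(2) u by blast
        then show "u \<in> (\<Union>i\<in>I. {u \<in> Ls K. jbox u \<inter> ?S i \<noteq> {}})" using u c ball by blast
      qed
      then have "card (Ls K) \<le> card (\<Union>i\<in>I. {u \<in> Ls K. jbox u \<inter> ?S i \<noteq> {}})" using fin I by (intro card_mono) auto
      also have "\<dots> \<le> (\<Sum>i\<in>I. meets (Ls K) (?S i))" unfolding meets_def by (rule card_UN_le[OF I])
      finally have "real (card (Ls K)) \<le> (\<Sum>i\<in>I. real (meets (Ls K) (?S i)))" unfolding of_nat_sum[symmetric] of_nat_le_iff .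
      also have "\<dots> \<le> (\<Sum>i\<in>I. r i powr s * card (Ls K))"
      proof (rule sum_mono)
        fix i assume i: "i \<in> I"
        have "r i powr T \<le> r i powr s" using r i sT by (intro powr_mono') auto
        then show "real (meets (Ls K) (?S i)) \<le> r i powr s * card (Ls K)"
          by (intro order.trans[OF bspec[OF K(1) i]] mult_right_mono) auto
      qed
      also have "\<dots> = (\<Sum>i\<in>I. r i powr s) * card (Ls K)" by (simp add: sum_distrib_right)
      finally show "1 \<le> (\<Sum>i\<in>I. r i powr s)" using cpos[of K] by (simp add: mult_le_cancel_right1)
    qed (use sT in auto)
    then show False using H by simp
  qed
qed

lemma exists_cantor_set:
  assumes "h > 0"
  shows "\<exists>D H0. D \<subseteq> sbox z1 z2 (2 * h) (2 * h) \<and> ereal T \<le> hausdorff_dim D \<and>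
    (\<forall>y\<in>D. \<forall>q\<ge>H0. well_approx_free q y) \<and>
    (\<forall>y\<in>D. \<forall>q. \<exists>q'\<ge>q. \<exists>p1 p2. q' > 0 \<and> \<bar>real q' * y $ 1 - of_int p1\<bar> < q' powr (-\<tau>1) \<and> \<bar>real q' * y $ 2 - of_int p2\<bar> < q' powr (-\<tau>2))"
proof -
  obtain H0 where H0: "\<exists>Q L. good_level H0 (sbox z1 z2 (2 * h) (2 * h)) Q L"
    using initial_level[OF assms] by blast
  let ?G = "\<lambda>w. good_level H0 (sbox z1 z2 (2 * h) (2 * h)) (fst w) (snd w)"
  have "\<exists>f. \<forall>n. ?G (f n) \<and> child_level (fst (f n)) (snd (f n)) (fst (f (Suc n))) (snd (f (Suc n)))"
  proof (rule dependent_nat_choice)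
    show "\<exists>w. ?G w" using H0 by auto
    show "\<exists>y. ?G y \<and> child_level (fst w) (snd w) (fst y) (snd y)" if "?G w" for w and n :: nat
      using next_level[OF that] by auto
  qed
  then obtain f where f: "\<And>n. ?G (f n)" "\<And>n. child_level (fst (f n)) (snd (f n)) (fst (f (Suc n))) (snd (f (Suc n)))"
    by blast
  define D where "D = (\<Inter>n. \<Union>u\<in>snd (f n). jbox u)"
  note D = cantor_set[where Qs = "\<lambda>n. fst (f n)" and Ls = "\<lambda>n. snd (f n)", OF f, folded D_def]
  show ?thesis
    by (rule exI[of _ D], rule exI[of _ H0], intro conjI ballI allI impI D)
qed

end

section \<open>Weighted badly approximable vectors\<close>

lemma eventually_powr_less:
  fixes C d p s :: real
  assumes "p < s" "d > 0"
  shows "\<forall>\<^sub>F x in at_top. C * x powr p < d * x powr s"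
proof -
  have "((\<lambda>x. C * x powr (p - s)) \<longlongrightarrow> C * 0) at_top"
    using assms by (intro tendsto_mult tendsto_const tendsto_neg_powr filterlim_ident) auto
  then have "\<forall>\<^sub>F x in at_top. C * x powr (p - s) < d" using assms by (intro order_tendstoD(2)) auto
  then show ?thesis using eventually_gt_at_top[of 0]
  proof eventually_elim
    case (elim x)
    have "C * x powr p = (C * x powr (p - s)) * x powr s" using elim by (simp flip: powr_add)
    also have "\<dots> < d * x powr s" using elim by (intro mult_strict_right_mono) auto
    finally show ?case .
  qed
qed

text \<open>For r2 = 1 the weight r2 - 1 would be 0, while both weights must be positive; a small
  rational below t replaces it. The dimension bound survives because of r2 <= 1 + s.\<close>

lemma exists_weights:
  fixes r2 t :: real
  assumes r: "1 \<le> r2" "r2 \<le> 3/2" "r2 \<in> \<rat>" "r2 < 1 + t" "t > 0"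
  shows "\<exists>a1 a2 :: nat. 0 < a1 \<and> 0 < a2 \<and> a2 \<le> a1 \<and> r2 \<le> 1 + real a2 / real (a1 + a2) \<and> real a2 / real (a1 + a2) < t \<and>
    (r2 > 1 \<longrightarrow> real a2 / real (a1 + a2) = r2 - 1)"
proof -
  have "\<exists>s\<in>\<rat>. 0 < s \<and> s \<le> 1/2 \<and> r2 \<le> 1 + s \<and> s < t \<and> (r2 > 1 \<longrightarrow> s = r2 - 1)"
  proof (cases "r2 > 1")
    case True
    then show ?thesis using r by (intro bexI[of _ "r2 - 1"]) auto
  next
    case False
    have "0 < min t (1/2)" using r by simp
    then obtain s where "s \<in> \<rat>" "0 < s" "s < min t (1/2)" using Rats_dense_in_real by blast
    then show ?thesis using False r by (intro bexI[of _ s]) auto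
  qed
  then obtain s where s: "s \<in> \<rat>" "0 < s" "s \<le> 1/2" "r2 \<le> 1 + s" "s < t" "r2 > 1 \<longrightarrow> s = r2 - 1" by blast
  obtain m n :: nat where mn: "n \<noteq> 0" "\<bar>s\<bar> = real m / real n" using Rats_abs_nat_div_natE[OF s(1)] by metis
  then have sm: "s = real m / real n" using s by simp
  then have ms: "real m = s * n" using mn by simp
  also have "\<dots> \<le> 1/2 * n" using s by (intro mult_right_mono) auto
  finally have "real m \<le> real n / 2" by simp
  moreover have "real m > 0" unfolding ms using s(2) mn(1) by (intro mult_pos_pos) auto
  ultimately have "m > 0" "real m \<le> real n / 2" by simp_all
  then have le: "2 * m \<le> n" by linarith
  have "real m / real (n - m + m) = s" using sm le by simp
  then show ?thesis using le \<open>m > 0\<close> s by (intro exI[of _ "n - m"] exI[of _ m]) auto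
qed

lemma exists_small_constant:
  assumes "t1 + t2 > (1::real)"
  shows "\<exists>c>0. c \<le> 1/4 \<and> (\<forall>n. 6400 * c\<^sup>2 * (\<Sum>j=1..n. real j powr (- t1 - t2)) \<le> 1)"
proof -
  have sm: "summable (\<lambda>n. real n powr (- t1 - t2))" using assms by (simp add: summable_real_powr_iff)
  define S where "S = (\<Sum>n. real n powr (- t1 - t2))"
  have S: "(\<Sum>j=1..n. real j powr (- t1 - t2)) \<le> S" for n unfolding S_def by (intro sum_le_suminf sm) auto
  have S0: "S \<ge> 0" using S[of 0] by simp
  \<comment> \<open>Since 80^2 = 6400, the expression is at most 1 / (S + 1).\<close>
  define c where "c = 1 / (80 * (S + 1))"
  have "6400 * c\<^sup>2 * (\<Sum>j=1..n. real j powr (- t1 - t2)) \<le> 1" for n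
  proof -
    have "6400 * c\<^sup>2 * (\<Sum>j=1..n. real j powr (- t1 - t2)) \<le> 6400 * c\<^sup>2 * (S + 1)"
      using S[of n] by (intro mult_left_mono) auto
    also have "\<dots> = 1 / (S + 1)"
    proof -
      have "6400 * (1 / (80 * u))\<^sup>2 * u = 1 / u" if "u > 0" for u :: real
        using that by (simp add: power2_eq_square field_simps)
      moreover have "S + 1 > 0" using S0 by simp
      ultimately show ?thesis unfolding c_def by blast
    qed
    also have "\<dots> \<le> 1" using S0 by simp
    finally show ?thesis .
  qed
  moreover have "c > 0" "c \<le> 1/4" using S0 by (auto simp: c_def)
  ultimately show ?thesis by blast
qed

text \<open>Half the radius fits into open and closed balls alike.\<close>

lemma sbox_subset_sup_ball:
  assumes "r > 0" "B = {x. infnorm (x - z) < r} \<or> B = {x. infnorm (x - z) \<le> r}"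
  shows "sbox (z $ 1) (z $ 2) (r / 2) (r / 2) \<subseteq> B"
proof
  fix x assume "x \<in> sbox (z $ 1) (z $ 2) (r / 2) (r / 2)"
  then have "infnorm (x - z) \<le> r / 2"
    unfolding infnorm_cart by (intro cSup_least) (auto simp: mem_sbox UNIV_2)
  then show "x \<in> B" using assms by auto
qed

section \<open>Criteria for membership in \<open>approx_vectors\<close>\<close>

lemma mem_approx_vectorsI:
  fixes y :: "real ^ 2"
  assumes y: "y \<in> cbox 0 1"
    and inf: "\<And>q. \<exists>q'\<ge>q. \<exists>p1 p2. q' > 0 \<and> \<bar>real q' * y $ 1 - of_int p1\<bar> < \<Psi> q' $ 1 \<and> \<bar>real q' * y $ 2 - of_int p2\<bar> < \<Psi> q' $ 2"
  shows "y \<in> approx_vectors \<Psi>"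
proof -
  let ?S = "{(q :: nat, p :: int ^ 2). q > 0 \<and> (\<forall>i. \<bar>real q * y $ i - of_int (p $ i)\<bar> < \<Psi> q $ i)}"
  have "infinite ?S"
  proof
    assume "finite ?S"
    then have "finite (fst ` ?S)" by (rule finite_imageI)
    then have "\<exists>M. \<forall>q\<in>fst ` ?S. q \<le> M" by (rule iffD1[OF finite_nat_set_iff_bounded_le])
    then obtain M where M: "\<forall>q\<in>fst ` ?S. q \<le> M" by (rule exE)
    obtain q' p1 p2 where q': "q' \<ge> Suc M" "q' > 0" "\<bar>real q' * y $ 1 - of_int p1\<bar> < \<Psi> q' $ 1" "\<bar>real q' * y $ 2 - of_int p2\<bar> < \<Psi> q' $ 2"
      using inf[of "Suc M"] by (elim exE conjE)
    then have "(q', vector [p1, p2]) \<in> ?S" by (simp add: forall_2 vector_2)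
    then have "fst (q', vector [p1, p2] :: int ^ 2) \<in> fst ` ?S" by (rule imageI)
    from bspec[OF M this] show False using q'(1) by simp
  qed
  with y show ?thesis unfolding approx_vectors_def mem_Collect_eq by (rule conjI)
qed

text \<open>The infinite set in the definition consists of pairs (q, p), so bounding q is not the
  whole story: y in the unit cube and the bound 1 on \<open>\<Psi>\<close> confine p as
  well.\<close>

lemma not_mem_approx_vectorsI:
  fixes y :: "real ^ 2"
  assumes y: "y \<in> cbox 0 1" and le1: "\<And>q i. q > 0 \<Longrightarrow> \<Psi> q $ i \<le> 1"
    and free: "\<And>q p1 p2. q \<ge> H0 \<Longrightarrow> q > 0 \<Longrightarrow> \<Psi> q $ 1 \<le> \<bar>real q * y $ 1 - of_int p1\<bar> \<or> \<Psi> q $ 2 \<le> \<bar>real q * y $ 2 - of_int p2\<bar>"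
  shows "y \<notin> approx_vectors \<Psi>"
proof -
  let ?S = "{(q :: nat, p :: int ^ 2). q > 0 \<and> (\<forall>i. \<bar>real q * y $ i - of_int (p $ i)\<bar> < \<Psi> q $ i)}"
  let ?M = "int H0 + 1"
  let ?F = "(\<lambda>(q, a, b). (q, vector [a, b] :: int ^ 2)) ` ({..H0} \<times> {-?M..?M} \<times> {-?M..?M})"
  have "?S \<subseteq> ?F"
  proof
    fix w assume w: "w \<in> ?S"
    obtain q p where wq: "w = (q, p)" by (cases w)
    have q: "q > 0" and d: "\<And>i. \<bar>real q * y $ i - of_int (p $ i)\<bar> < \<Psi> q $ i" using w wq by auto
    have qH: "q < H0" using free[of q "p $ 1" "p $ 2"] q d[of 1] d[of 2] by (meson not_le)
    have "p $ i \<in> {-?M..?M}" for i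
    proof -
      have "0 \<le> y $ i" "y $ i \<le> 1" using y by (auto simp: mem_box_cart)
      then have "0 \<le> real q * y $ i" "real q * y $ i \<le> real q" by (auto simp: mult_left_le)
      moreover have "\<bar>real q * y $ i - of_int (p $ i)\<bar> < 1" using d[of i] le1[OF q, of i] by linarith
      ultimately show ?thesis using qH by auto
    qed
    moreover have "p = vector [p $ 1, p $ 2]" by (simp add: vec_eq_iff forall_2 vector_2)
    ultimately show "w \<in> ?F" unfolding wq using qH by (intro image_eqI[of _ _ "(q, p $ 1, p $ 2)"]) auto
  qed
  moreover have "finite ?F" by simp
  ultimately have "finite ?S" by (rule finite_subset)
  then show ?thesis by (auto simp: approx_vectors_def)
qed

theorem theorem1p3:
  fixes \<tau> \<rho> :: "real ^ 2" and B :: "(real ^ 2) set" and \<epsilon> :: real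
  assumes "\<tau> $ 1 > 0" and "\<tau> $ 2 > 0"
    and "\<tau> $ 1 + \<tau> $ 2 > 1" and "\<tau> $ 1 \<ge> \<tau> $ 2"
    and "is_sup_ball B" and "B \<subseteq> cbox 0 1"
    and "\<epsilon> > 0"
    and "\<rho> $ 1 \<in> \<rat>" and "\<rho> $ 2 \<in> \<rat>"
    and "\<rho> $ 1 \<ge> 1" and "\<rho> $ 2 \<ge> 1"
    and "\<rho> $ 1 + \<rho> $ 2 = 3" and "\<rho> $ 1 \<ge> \<rho> $ 2"
    and "1 + \<tau> $ 1 - \<rho> $ 1 > 0" and "1 + \<tau> $ 2 - \<rho> $ 2 > 0"
  shows "\<exists>D. D \<subseteq> B \<inter> badly_approx_vectors (Psi_pow \<tau>) \<and>
    hausdorff_dim D \<ge>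
      ereal (min ((3 + \<tau> $ 1 - \<tau> $ 2) / (1 + \<tau> $ 1))
                 (min (3 / (1 + \<tau> $ 2)) (1 + \<rho> $ 2 / (1 + \<tau> $ 2))) - 2 * \<epsilon>)"
proof -
  define T where "T = min ((3 + \<tau> $ 1 - \<tau> $ 2) / (1 + \<tau> $ 1)) (min (3 / (1 + \<tau> $ 2)) (1 + \<rho> $ 2 / (1 + \<tau> $ 2))) - 2 * \<epsilon>"
  show ?thesis
    unfolding T_def[symmetric]
  proof (cases "T \<le> 0")
    \<comment> \<open>The levels are set up for T >= 0; for T <= 0 the empty set will do, as
      dimensions are never negative.\<close>
    case True
    have "ereal T \<le> hausdorff_dim ({} :: (real ^ 2) set)"
      unfolding hausdorff_dim_def using True by (intro INF_greatest) auto
    then show "\<exists>D. D \<subseteq> B \<inter> badly_approx_vectors (Psi_pow \<tau>) \<and> ereal T \<le> hausdorff_dim D" by (intro exI[of _ "{}"]) auto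
  next
    case False
    have "\<rho> $ 2 \<le> 3/2" "\<rho> $ 2 < 1 + \<tau> $ 2" using assms by linarith+
    then obtain a1 a2 :: nat where a: "0 < a1" "0 < a2" "a2 \<le> a1" "\<rho> $ 2 \<le> 1 + real a2 / real (a1 + a2)"
      "real a2 / real (a1 + a2) < \<tau> $ 2" "\<rho> $ 2 > 1 \<longrightarrow> real a2 / real (a1 + a2) = \<rho> $ 2 - 1"
      using exists_weights[of "\<rho> $ 2" "\<tau> $ 2"] assms by blast
    define \<sigma>1 \<sigma>2 where "\<sigma>1 = real a1 / real (a1 + a2)" and "\<sigma>2 = real a2 / real (a1 + a2)"
    have sum: "\<sigma>1 + \<sigma>2 = 1" unfolding \<sigma>1_def \<sigma>2_def using a by (simp flip: add_divide_distrib)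
    have pos: "\<sigma>1 > 0" "\<sigma>2 > 0" "\<sigma>2 \<le> \<sigma>1" unfolding \<sigma>1_def \<sigma>2_def using a by (auto intro: divide_right_mono)
    have s1: "\<sigma>1 < \<tau> $ 1"
    proof (cases "\<rho> $ 2 > 1")
      case True
      then have "\<sigma>2 = \<rho> $ 2 - 1" using a by (simp add: \<sigma>2_def)
      then show ?thesis using sum assms by linarith
    next
      case False
      \<comment> \<open>Here \<rho>2 = 1, hence \<rho>1 = 2 and \<tau>1 > 1 > \<sigma>1.\<close>
      then show ?thesis using sum pos assms by linarith
    qed
    have s2: "\<sigma>2 < \<tau> $ 2" "\<rho> $ 2 \<le> 1 + \<sigma>2" using a by (auto simp: \<sigma>2_def)
    obtain c where c: "c > 0" "c \<le> 1/4" "\<And>n. 6400 * c\<^sup>2 * (\<Sum>j=1..n. real j powr (- \<tau> $ 1 - \<tau> $ 2)) \<le> 1"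
      using exists_small_constant assms(3) by blast
    interpret W: weighted_setup "\<tau> $ 1" "\<tau> $ 2" \<sigma>1 \<sigma>2 c a1 a2
      using assms sum pos s1 s2 c a by unfold_locales (auto simp: \<sigma>1_def \<sigma>2_def)
    have sep_const: "sep_const > 0" by (simp add: sep_const_def q_ratio_def)
    let ?K = "24000 * (q_ratio powr (-1 - \<tau> $ 1)) ^ 6 / (sep_const ^ 3 * q_ratio ^ 2)"
    have "\<forall>\<^sub>F x in at_top. (1 + q_ratio powr (- \<tau> $ 1)) * x powr (- \<tau> $ 1) < sep_const * x powr (-\<sigma>1) \<and>
      (1 + q_ratio powr (- \<tau> $ 2)) * x powr (- \<tau> $ 2) < sep_const * x powr (-\<sigma>2) \<and>
      ?K * x powr (-\<epsilon>) < 1 * x powr 0 \<and>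
      4 * q_ratio powr (-1 - \<tau> $ 1) * x powr (-1 - \<tau> $ 1) < sep_const * x powr (-1 - \<sigma>1) \<and>
      4 * q_ratio powr (-1 - \<tau> $ 1) * x powr (-1 - \<tau> $ 2) < sep_const * x powr (-1 - \<sigma>2)"
      using sep_const s1 s2 assms(7) by (intro eventually_conj eventually_powr_less) auto
    then obtain X1 where X1: "\<And>x. x \<ge> X1 \<Longrightarrow> (1 + q_ratio powr (- \<tau> $ 1)) * x powr (- \<tau> $ 1) < sep_const * x powr (-\<sigma>1) \<and>
      (1 + q_ratio powr (- \<tau> $ 2)) * x powr (- \<tau> $ 2) < sep_const * x powr (-\<sigma>2) \<and>
      ?K * x powr (-\<epsilon>) < 1 * x powr 0 \<and>
      4 * q_ratio powr (-1 - \<tau> $ 1) * x powr (-1 - \<tau> $ 1) < sep_const * x powr (-1 - \<sigma>1) \<and>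
      4 * q_ratio powr (-1 - \<tau> $ 1) * x powr (-1 - \<tau> $ 2) < sep_const * x powr (-1 - \<sigma>2)"
      unfolding eventually_at_top_linorder by blast
    define X0 where "X0 = max 1 X1"
    have X0: "X0 \<ge> 1" "X0 \<ge> X1" by (auto simp: X0_def)
    have t: "T + 2 * \<epsilon> \<le> (3 + \<tau> $ 1 - \<tau> $ 2) / (1 + \<tau> $ 1)" "T + 2 * \<epsilon> \<le> 3 / (1 + \<tau> $ 2)" "T + 2 * \<epsilon> \<le> 1 + \<rho> $ 2 / (1 + \<tau> $ 2)"
      unfolding T_def by auto
    \<comment> \<open>Both e and g are \<epsilon>; multiplying by 1 + u >= 1 only enlarges the
      available 2 \<epsilon>.\<close>
    have mult: "T * (1 + u) + \<epsilon> + \<epsilon> \<le> A" if "T + 2 * \<epsilon> \<le> A / (1 + u)" "u > 0" for A u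
    proof -
      have "(T + 2 * \<epsilon>) * (1 + u) \<le> A" using that by (simp add: pos_le_divide_eq)
      moreover have "2 * \<epsilon> * 1 \<le> 2 * \<epsilon> * (1 + u)" using that assms(7) by (intro mult_left_mono) auto
      ultimately show ?thesis by (simp add: algebra_simps)
    qed
    have t3: "1 + \<rho> $ 2 / (1 + \<tau> $ 2) = (1 + \<tau> $ 2 + \<rho> $ 2) / (1 + \<tau> $ 2)" using assms(2) by (simp add: add_divide_distrib)
    have sl3: "T * (1 + \<tau> $ 2) + \<epsilon> + \<epsilon> \<le> 1 + \<tau> $ 2 + \<rho> $ 2" using mult[OF t(3)[unfolded t3] assms(2)] .
    \<comment> \<open>Since \<rho>2 < 1 + \<tau>2, the third term of the minimum is at most 2; this
      yields the condition on T for the r^2 term.\<close>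
    have "\<rho> $ 2 / (1 + \<tau> $ 2) \<le> 1" using assms by (simp add: divide_le_eq)
    then have sl4: "T + \<epsilon> + \<epsilon> \<le> 2" using t(3) by linarith
    interpret C: cantor_setup "\<tau> $ 1" "\<tau> $ 2" \<sigma>1 \<sigma>2 c a1 a2 X0 \<epsilon> \<epsilon> T
    proof unfold_locales
      fix x assume "X0 \<le> x"
      then have x: "x \<ge> X1" "x \<ge> 1" using X0 by linarith+
      note X = X1[OF x(1)]
      show "(1 + q_ratio powr (- \<tau> $ 1)) * x powr (- \<tau> $ 1) \<le> sep_const * x powr (-\<sigma>1)"
        "(1 + q_ratio powr (- \<tau> $ 2)) * x powr (- \<tau> $ 2) \<le> sep_const * x powr (-\<sigma>2)"
        "?K * x powr (-\<epsilon>) \<le> 1"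
        "4 * q_ratio powr (-1 - \<tau> $ 1) * x powr (-1 - \<tau> $ 1) < sep_const * x powr (-1 - \<sigma>1)"
        "4 * q_ratio powr (-1 - \<tau> $ 1) * x powr (-1 - \<tau> $ 2) < sep_const * x powr (-1 - \<sigma>2)"
        using X x by (auto intro: less_imp_le)
    qed (use X0 assms(7) False mult[OF t(1) assms(1)] mult[OF t(2) assms(2)] sl3 sl4 s2 in auto)
    obtain z r where r: "r > 0" "B = {x. infnorm (x - z) < r} \<or> B = {x. infnorm (x - z) \<le> r}"
      using assms(5) unfolding is_sup_ball_def by blast
    obtain D H0 where D: "D \<subseteq> sbox (z $ 1) (z $ 2) (2 * (r / 4)) (2 * (r / 4))" "ereal T \<le> hausdorff_dim D"
      "\<forall>y\<in>D. \<forall>q\<ge>H0. W.well_approx_free q y"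
      "\<forall>y\<in>D. \<forall>q. \<exists>q'\<ge>q. \<exists>p1 p2. q' > 0 \<and> \<bar>real q' * y $ 1 - of_int p1\<bar> < q' powr (- \<tau> $ 1) \<and> \<bar>real q' * y $ 2 - of_int p2\<bar> < q' powr (- \<tau> $ 2)"
      using C.exists_cantor_set[of "r / 4" "z $ 1" "z $ 2"] r(1) by auto
    have DB: "D \<subseteq> B" using D(1) sbox_subset_sup_ball[OF r] by simp
    have "D \<subseteq> badly_approx_vectors (Psi_pow \<tau>)"
    proof
      fix y assume y: "y \<in> D"
      then have y1: "y \<in> cbox 0 1" using DB assms(6) by blast
      have "y \<in> approx_vectors (Psi_pow \<tau>)"
        using D(4) y by (intro mem_approx_vectorsI y1) (simp add: Psi_pow_def)
      \<comment> \<open>Failure for the single constant c in (0,1) already removes y from the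
        intersection over all constants.\<close>
      moreover have "y \<notin> approx_vectors (\<lambda>q. c *\<^sub>R Psi_pow \<tau> q)"
      proof (rule not_mem_approx_vectorsI[OF y1, of _ H0])
        fix q :: nat and i :: 2 assume q: "q > 0"
        have "\<tau> $ i > 0" using assms(1,2) by (metis exhaust_2)
        then have "real q powr (- \<tau> $ i) \<le> real q powr 0" using q by (intro powr_mono) auto
        then have "c * real q powr (- \<tau> $ i) \<le> 1 * 1" using c q by (intro mult_mono) auto
        then show "(c *\<^sub>R Psi_pow \<tau> q) $ i \<le> 1" by (simp add: Psi_pow_def)
      next
        fix q :: nat and p1 p2 :: int assume "H0 \<le> q"
        then have "W.well_approx_free q y" using D(3) y by blast
        from this[unfolded W.well_approx_free_def, rule_format, of p1 p2]
        show "(c *\<^sub>R Psi_pow \<tau> q) $ 1 \<le> \<bar>real q * y $ 1 - of_int p1\<bar> \<or> (c *\<^sub>R Psi_pow \<tau> q) $ 2 \<le> \<bar>real q * y $ 2 - of_int p2\<bar>"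
          by (simp add: Psi_pow_def)
      qed
      moreover have "c \<in> {0<..<1}" using c by simp
      ultimately show "y \<in> badly_approx_vectors (Psi_pow \<tau>)" unfolding badly_approx_vectors_def by blast
    qed
    then show "\<exists>D. D \<subseteq> B \<inter> badly_approx_vectors (Psi_pow \<tau>) \<and> ereal T \<le> hausdorff_dim D"
      using DB D(2) by (intro exI[of _ D]) auto
  qed
qed

end
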